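(* Let $\sum_i h_i(u)^2\,du_i^2$ be a $\partial$-invariant flat Egoroff metric on $\Omega$ with potential $\phi$, rotation coefficient matrix $\beta$ and extended frame $F=\begin{pmatrix}E&X\\0&1\end{pmatrix}$. Let $\alpha\in\mathbb{R}\setminus\{0\}$, let $\pi$ be a Hermitian projection of $\mathbb{C}^n$ with $\bar\pi=\pi$, let $\tilde\pi(u)$ be the Hermitian projection onto $E(u,\mathrm{i}\alpha)^{-1}(\mathrm{Im}\,\pi)$, $\eta=E(u,\mathrm{i}\alpha)^tX(u,-\mathrm{i}\alpha)$, and $$\tilde X=g_{-\mathrm{i}\alpha,\pi^\perp}\Big(X+\frac{2\mathrm{i}\alpha}{\lambda-\mathrm{i}\alpha}E\tilde\pi\eta\Big),\quad \tilde h=h-2\alpha\tilde\pi\eta,\quad \tilde\phi=\phi-2\alpha\,\eta^t\tilde\pi\eta,\quad\tilde\beta=\beta-2\alpha\tilde\pi_\ast,$$ so that (on a connected neighbourhood of $0$ where all $\tilde h_i\ne0$) $\tilde X(\cdot,\lambda)$, $\lambda\in\mathbb{R}\setminus\{0\}$, is the associated family of flat Lagrangian immersions in $\mathbb{C}^n$ for the flat Egoroff metric $\sum_i\tilde h_i^2du_i^2$ with potential $\tilde\phi$ and rotation coefficient matrix $\tilde\beta$. Then the immersions $\tilde X(\cdot,\lambda)$, $\lambda\in\mathbb{R}\setminus\{0\}$, lie in hyperspheres if and only if $\mathrm{Im}\,\pi\perp h(0)$ (i.e. $\pi(h(0))=0$). Moreover, if $\mathrm{Im}\,\pi\perp h(0)$,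 then for each $\lambda\in\mathbb{R}\setminus\{0\}$ $\tilde X(\cdot,\lambda)$ is contained in the same hypersphere as $X(\cdot,\lambda)$, $\alpha\tilde\pi\eta=\tilde\pi h$, and $$\tilde X=g_{-\mathrm{i}\alpha,\pi^\perp}\Big(X+\frac{2\mathrm{i}}{\lambda-\mathrm{i}\alpha}E\tilde\pi h\Big),\qquad \tilde h=h-2\tilde\pi h,\qquad\tilde\phi=\phi-\frac{2}{\alpha}h^t\tilde\pi h,\qquad \tilde\beta=\beta-2\alpha\tilde\pi_\ast .$$
   Context: $\Omega\subset\mathbb{R}^n$ is a connected, simply connected open neighbourhood of $0$ with coordinates $u$. $\delta=\mathrm{diag}(du_1,\dots,du_n)$, $[\delta,\beta]=\delta\beta-\beta\delta$. For a matrix $\xi$, $\xi_\ast$ is $\xi$ with diagonal entries replaced by $0$. A flat Egoroff metric is a flat Riemannian metric $\sum_i h_i^2\,du_i^2$, with $h_i$ smooth, real-valued and nowhere zero, for which there is a potential $\phi$ with $\partial\phi/\partial u_i=h_i^2$; $h=(h_1,\dots,h_n)^t$. It is $\partial$-invariant if $\partial h_i=0$ for all $i$, $\partial=\sum_j\partial/\partial u_j$ (equivalently $\sum_ih_i^2$ is constant). Its rotation coefficient matrix is $\beta_{ij}=(h_i)_{u_j}/h_j$ for $i\ne j$, $\beta_{ii}=0$ (symmetric). Its extended frame is the unique $F(u,\lambda)=\begin{pmatrix}E&X\\0&1\end{pmatrix}$, holomorphic in $\lambda\in\mathbb{C}$, with $F^{-1}dF=\begin{pmatrix}\mathrm{i}\lambda\delta+[\delta,\beta]&\delta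 h\\0&0\end{pmatrix}$, $F(0,\lambda)=\mathrm{I}$. Its associated family is $X(\cdot,\lambda)$, $\lambda\in\mathbb{R}\setminus\{0\}$: flat Lagrangian immersions into $\mathbb{C}^n=\mathbb{R}^{2n}$ with $\mathrm{I}=\sum_ih_i^2du_i^2$ and $\mathrm{II}_\lambda=\lambda\sum_i du_i^2\otimes J(\partial X/\partial u_i)$, $J$ being multiplication by $\mathrm{i}$. In the $\partial$-invariant case $X(u,\lambda)=-\mathrm{i}\lambda^{-1}(E(u,\lambda)h(u)-h(0))$, so $X(\cdot,\lambda)$ lies in a hypersphere of radius $\|h(0)\|/|\lambda|$ for $\lambda\in\mathbb{R}\setminus\{0\}$. A Hermitian projection is a matrix $\pi$ with $\pi^2=\pi=\pi^*$; $\pi^\perp=\mathrm{I}-\pi$; $\bar\pi$ is the entrywise conjugate. For $w\in\mathbb{C}\setminus\mathbb{R}$, $g_{w,\pi}(\lambda)=\pi+\frac{\lambda-\bar w}{\lambda-w}\pi^\perp$. *)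

theory Defs
  imports "HOL-Analysis.Analysis"
begin

section \<open>Calculus in coordinates\<close>

definition partial :: "'n::finite \<Rightarrow> (real^'n \<Rightarrow> 'b::real_normed_vector) \<Rightarrow> real^'n \<Rightarrow> 'b" where
  "partial i f u = frechet_derivative f (at u) (axis i 1)"

primrec Ck_on :: "nat \<Rightarrow> (real^'n::finite) set \<Rightarrow> (real^'n \<Rightarrow> 'b::real_normed_vector) \<Rightarrow> bool" where
  "Ck_on 0 S f \<longleftrightarrow> continuous_on S f"
| "Ck_on (Suc k) S f \<longleftrightarrow> (\<forall>u\<in>S. f differentiable (at u)) \<and> (\<forall>i. Ck_on k S (partial i f))"

text \<open>Smooth means \<open>C\<close>-infinity; only used for open sets \<open>S\<close>.\<close>

definition smooth_on :: "(real^'n::finite) set \<Rightarrow> (real^'n \<Rightarrow> 'b::real_normed_vector) \<Rightarrow> bool" where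
  "smooth_on S f \<longleftrightarrow> (\<forall>k. Ck_on k S f)"


section \<open>Flat metrics\<close>

text \<open>A metric is given by the matrix-valued function of its coefficients \<open>g\<^sub>i\<^sub>j\<close>.
  \<open>christoffel g k i j\<close> is the symbol with upper index \<open>k\<close>, and \<open>riemann g l k i j\<close> is the
  coefficient of \<open>\<partial>\<^sub>l\<close> in \<open>R(\<partial>\<^sub>i, \<partial>\<^sub>j)\<partial>\<^sub>k\<close> for the Levi-Civita connection.\<close>

definition christoffel ::
    "(real^'n \<Rightarrow> real^'n^'n) \<Rightarrow> 'n::finite \<Rightarrow> 'n \<Rightarrow> 'n \<Rightarrow> real^'n \<Rightarrow> real" where
  "christoffel g k i j u =
     (\<Sum>l\<in>UNIV. matrix_inv (g u) $ k $ l *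
        (partial i (\<lambda>x. g x $ j $ l) u + partial j (\<lambda>x. g x $ i $ l) u
          - partial l (\<lambda>x. g x $ i $ j) u)) / 2"

definition riemann ::
    "(real^'n \<Rightarrow> real^'n^'n) \<Rightarrow> 'n::finite \<Rightarrow> 'n \<Rightarrow> 'n \<Rightarrow> 'n \<Rightarrow> real^'n \<Rightarrow> real" where
  "riemann g l k i j u =
     partial i (christoffel g l j k) u - partial j (christoffel g l i k) u
     + (\<Sum>m\<in>UNIV. christoffel g l i m u * christoffel g m j k u
                - christoffel g l j m u * christoffel g m i k u)"

definition flat_metric_on :: "(real^'n::finite) set \<Rightarrow> (real^'n \<Rightarrow> real^'n^'n) \<Rightarrow> bool" where
  "flat_metric_on S g \<longleftrightarrow> (\<forall>u\<in>S. \<forall>l k i j. riemann g l k i j u = 0)"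

definition diag_matrix :: "'a::zero^'n \<Rightarrow> 'a^'n^'n" where
  "diag_matrix w = (\<chi> i j. if i = j then w $ i else 0)"

definition diag_metric :: "(real^'n \<Rightarrow> real^'n) \<Rightarrow> real^'n \<Rightarrow> real^'n^'n" where
  "diag_metric h u = diag_matrix (\<chi> i. (h u $ i)\<^sup>2)"

definition flat_egoroff ::
    "(real^'n::finite) set \<Rightarrow> (real^'n \<Rightarrow> real^'n) \<Rightarrow> (real^'n \<Rightarrow> real) \<Rightarrow> bool" where
  "flat_egoroff S h \<phi> \<longleftrightarrow>
     smooth_on S h \<and> (\<forall>u\<in>S. \<forall>i. h u $ i \<noteq> 0) \<and>
     flat_metric_on S (diag_metric h) \<and>
     (\<forall>u\<in>S. (\<phi> has_derivative (\<lambda>v. \<Sum>i\<in>UNIV. (h u $ i)\<^sup>2 * v $ i)) (at u))"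

definition del_invariant :: "(real^'n::finite) set \<Rightarrow> (real^'n \<Rightarrow> real^'n) \<Rightarrow> bool" where
  "del_invariant S h \<longleftrightarrow> (\<forall>u\<in>S. \<forall>i. (\<Sum>j\<in>UNIV. partial j (\<lambda>x. h x $ i) u) = 0)"

definition rotation_coeff :: "(real^'n::finite \<Rightarrow> real^'n) \<Rightarrow> real^'n \<Rightarrow> real^'n^'n" where
  "rotation_coeff h u =
     (\<chi> i j. if i = j then 0 else partial j (\<lambda>x. h x $ i) u / h u $ j)"


section \<open>Extended frames and associated families\<close>

definition cvec :: "real^'n \<Rightarrow> complex^'n" where
  "cvec v = (\<chi> i. of_real (v $ i))"

definition cmat :: "real^'n^'m \<Rightarrow> complex^'n^'m" where
  "cmat A = (\<chi> i j. of_real (A $ i $ j))"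

definition cscale :: "complex \<Rightarrow> complex^'n^'m \<Rightarrow> complex^'n^'m" where
  "cscale c A = (\<chi> i j. c * A $ i $ j)"

text \<open>The block matrix with rows \<open>(A, x)\<close> and \<open>(0, c)\<close>; the extra index is \<^term>\<open>None\<close>.\<close>

definition block :: "complex^'n^'n \<Rightarrow> complex^'n \<Rightarrow> complex \<Rightarrow> complex^('n option)^('n option)" where
  "block A x c =
     (\<chi> p q. case p of
         Some i \<Rightarrow> (case q of Some j \<Rightarrow> A $ i $ j | None \<Rightarrow> x $ i)
       | None \<Rightarrow> (case q of Some j \<Rightarrow> 0 | None \<Rightarrow> c))"

text \<open>A matrix-valued 1-form is a function of the tangent vector \<open>v\<close>; the form
  \<open>diag(du\<^sub>1, \<dots>, du\<^sub>n)\<close> sends \<open>v\<close> to \<open>diag_matrix (cvec v)\<close>.\<close>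

definition frame_form ::
    "(real^'n::finite \<Rightarrow> real^'n) \<Rightarrow> real^'n \<Rightarrow> complex \<Rightarrow> real^'n
      \<Rightarrow> complex^('n option)^('n option)" where
  "frame_form h u z v =
     (let \<delta> = diag_matrix (cvec v); \<beta> = cmat (rotation_coeff h u)
      in block (cscale (\<i> * z) \<delta> + (\<delta> ** \<beta> - \<beta> ** \<delta>)) (\<delta> *v cvec (h u)) 0)"

definition extended_frame ::
    "(real^'n::finite) set \<Rightarrow> (real^'n \<Rightarrow> real^'n)
      \<Rightarrow> (real^'n \<Rightarrow> complex \<Rightarrow> complex^'n^'n) \<Rightarrow> (real^'n \<Rightarrow> complex \<Rightarrow> complex^'n) \<Rightarrow> bool" where
  "extended_frame S h E X \<longleftrightarrow>
     (let F = (\<lambda>u z. block (E u z) (X u z) 1) in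
        (\<forall>z. F 0 z = mat 1) \<and>
        (\<forall>u\<in>S. \<forall>p q. (\<lambda>z. F u z $ p $ q) holomorphic_on UNIV) \<and>
        (\<forall>u\<in>S. \<forall>z. invertible (F u z) \<and>
           ((\<lambda>x. F x z) has_derivative (\<lambda>v. F u z ** frame_form h u z v)) (at u)))"

definition associated_family ::
    "(real^'n::finite) set \<Rightarrow> (real^'n \<Rightarrow> real^'n) \<Rightarrow> (real^'n \<Rightarrow> real \<Rightarrow> complex^'n) \<Rightarrow> bool" where
  "associated_family S h Y \<longleftrightarrow>
     (\<exists>E X. extended_frame S h E X \<and>
        (\<forall>u\<in>S. \<forall>t. t \<noteq> 0 \<longrightarrow> Y u t = X u (of_real t)))"


section \<open>Immersions into complex space\<close>

text \<open>The inner product of \<^typ>\<open>complex^'n\<close> is the Euclidean one of the underlying real space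
  \<open>\<real>\<^sup>2\<^sup>n\<close>, so that \<open>x \<bullet> (\<i> *s y)\<close> is, up to sign, the standard symplectic form.\<close>

definition first_ff :: "(real^'n::finite \<Rightarrow> complex^'n) \<Rightarrow> real^'n \<Rightarrow> real^'n^'n" where
  "first_ff Y u = (\<chi> i j. partial i Y u \<bullet> partial j Y u)"

definition second_ff :: "(real^'n::finite \<Rightarrow> complex^'n) \<Rightarrow> real^'n \<Rightarrow> 'n \<Rightarrow> 'n \<Rightarrow> complex^'n" where
  "second_ff Y u i j =
     (let T = range (frechet_derivative Y (at u)) in
      THE w. (\<forall>t\<in>T. orthogonal t w) \<and> partial i (partial j Y) u - w \<in> T)"

definition flat_lagrangian_immersion ::
    "(real^'n::finite) set \<Rightarrow> (real^'n \<Rightarrow> complex^'n) \<Rightarrow> bool" where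
  "flat_lagrangian_immersion S Y \<longleftrightarrow>
     smooth_on S Y \<and> (\<forall>u\<in>S. inj (frechet_derivative Y (at u))) \<and>
     (\<forall>u\<in>S. \<forall>i j. partial i Y u \<bullet> (\<i> *s partial j Y u) = 0) \<and>
     flat_metric_on S (first_ff Y)"

definition in_hypersphere :: "(real^'n::finite) set \<Rightarrow> (real^'n \<Rightarrow> complex^'n) \<Rightarrow> bool" where
  "in_hypersphere S Y \<longleftrightarrow> (\<exists>c r. r > 0 \<and> Y ` S \<subseteq> sphere c r)"


section \<open>Projections and the dressing action\<close>

definition conj_mat :: "complex^'n^'m \<Rightarrow> complex^'n^'m" where
  "conj_mat A = (\<chi> i j. cnj (A $ i $ j))"

definition hermitian_projection :: "complex^'n::finite^'n \<Rightarrow> bool" where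
  "hermitian_projection P \<longleftrightarrow> P ** P = P \<and> transpose (conj_mat P) = P"

definition hermitian_projection_onto :: "(complex^'n::finite) set \<Rightarrow> complex^'n^'n" where
  "hermitian_projection_onto V = (THE P. hermitian_projection P \<and> range ((*v) P) = V)"

definition off_diag :: "'a::zero^'n^'n \<Rightarrow> 'a^'n^'n" where
  "off_diag A = (\<chi> i j. if i = j then 0 else A $ i $ j)"

text \<open>The bilinear (not sesquilinear) pairing \<open>x\<^sup>t y\<close>.\<close>

definition bdot :: "complex^'n::finite \<Rightarrow> complex^'n \<Rightarrow> complex" where
  "bdot x y = (\<Sum>i\<in>UNIV. x $ i * y $ i)"

definition simple_factor :: "complex \<Rightarrow> complex^'n^'n \<Rightarrow> complex \<Rightarrow> complex^'n^'n" where
  "simple_factor w P z = P + cscale ((z - cnj w) / (z - w)) (mat 1 - P)"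

definition dressed_proj ::
    "(real^'n::finite \<Rightarrow> complex \<Rightarrow> complex^'n^'n) \<Rightarrow> real \<Rightarrow> complex^'n^'n \<Rightarrow> real^'n
      \<Rightarrow> complex^'n^'n" where
  "dressed_proj E \<alpha> P u =
     hermitian_projection_onto ((\<lambda>x. matrix_inv (E u (\<i> * of_real \<alpha>)) *v x) ` range ((*v) P))"

definition dressing_eta ::
    "(real^'n::finite \<Rightarrow> complex \<Rightarrow> complex^'n^'n) \<Rightarrow> (real^'n \<Rightarrow> complex \<Rightarrow> complex^'n)
      \<Rightarrow> real \<Rightarrow> real^'n \<Rightarrow> complex^'n" where
  "dressing_eta E X \<alpha> u = transpose (E u (\<i> * of_real \<alpha>)) *v X u (- \<i> * of_real \<alpha>)"

definition dressed_X ::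
    "(real^'n::finite \<Rightarrow> complex \<Rightarrow> complex^'n^'n) \<Rightarrow> (real^'n \<Rightarrow> complex \<Rightarrow> complex^'n)
      \<Rightarrow> real \<Rightarrow> complex^'n^'n \<Rightarrow> real^'n \<Rightarrow> complex \<Rightarrow> complex^'n" where
  "dressed_X E X \<alpha> P u z =
     simple_factor (- \<i> * of_real \<alpha>) (mat 1 - P) z *v
       (X u z + (2 * \<i> * of_real \<alpha> / (z - \<i> * of_real \<alpha>)) *s
                 (E u z *v (dressed_proj E \<alpha> P u *v dressing_eta E X \<alpha> u)))"

definition nonvanishing_nbhd ::
    "(real^'n::finite) set \<Rightarrow> (real^'n \<Rightarrow> real^'n) \<Rightarrow> (real^'n) set \<Rightarrow> bool" where
  "nonvanishing_nbhd S k U \<longleftrightarrow>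
     open U \<and> connected U \<and> 0 \<in> U \<and> U \<subseteq> S \<and> (\<forall>u\<in>U. \<forall>i. k u $ i \<noteq> 0)"

end

theory Submission
  imports Defs "HOL-Complex_Analysis.Conformal_Mappings"
begin

text \<open>
  The extended frame \<open>F\<close> of a flat Egoroff metric solves a linear system \<open>F\<^sup>-\<^sup>1 dF = \<i>\<lambda>D + K\<close>, where in block form
  \<open>D\<close> is \<open>\<delta>\<close> bordered by zeros and \<open>K\<close> contains \<open>[\<delta>, \<beta>]\<close> and \<open>\<delta>h\<close>. Multiplying \<open>F\<close> from the left by
  a rational matrix in \<open>\<lambda>\<close> with poles at \<open>\<plusminus> \<i>\<alpha>\<close> and from the right by a \<open>u\<close>-dependent matrix of the same kind gives
  \<open>(1 - P + c\<^sup>-\<^sup>1 P) F (1 - Q + c Q)\<close> with \<open>c = (\<lambda> + \<i>\<alpha>) / (\<lambda> - \<i>\<alpha>)\<close>. Its singularities are removable when \<open>Q\<close> is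
  the projection onto \<open>F (\<i>\<alpha>)\<^sup>-\<^sup>1 (Im P)\<close> along \<open>F (- \<i>\<alpha>)\<^sup>-\<^sup>1 (ker P)\<close>. These two conditions determine the derivative of
  \<open>Q\<close>, and then the product solves the system with \<open>K\<close> replaced by \<open>K - 2\<alpha> [D, Q]\<close> (lemma \<open>dressed_deriv\<close>; the
  parameters \<open>\<plusminus> \<i>\<alpha>\<close> themselves are reached by the limit argument \<open>has_derivative_fill\<close>). For the block matrices of an extended
  frame, \<open>Q\<close> consists of the Hermitian projection \<open>Q u\<close> onto \<open>E (u, \<i>\<alpha>)\<^sup>-\<^sup>1 (Im P)\<close> and the column \<open>\<xi> = Q \<eta>\<close>, so
  this one computation yields \<open>\<beta> - 2\<alpha> Q\<^sub>*\<close>, \<open>h - 2\<alpha> \<xi>\<close> and the dressed \<open>X\<close> together.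

  A solution of the linear system with symmetric coefficients \<open>R\<close> is unitary for real parameters and real for imaginary
  ones. Hence \<open>X\<close> at a real parameter has the asserted fundamental forms, while at the parameter \<open>0\<close> it is an isometric
  immersion into the real space. The latter gives flatness of the metric, and the symmetry of its second derivatives shows that
  \<open>R\<close> is the rotation coefficient matrix of the metric. So everything about the dressed family follows from the
  dressed linear system, except for the potential, which is a short computation.

  For the spheres, write \<open>\<partial>\<close> for the derivative along \<open>(1, \<dots>, 1)\<close>. If \<open>\<partial>h = 0\<close>, then \<open>E h = h(0) + \<i>\<lambda>X\<close>, so \<open>X\<close>
  lies in a sphere that depends only on \<open>h(0)\<close> and \<open>\<lambda>\<close>; conversely a position vector orthogonal to the tangent
  spaces forces \<open>\<partial>h = 0\<close>. The immersions of a metric are therefore spherical if and only if the metric is \<open>\<partial>\<close>-invariant.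
  For the dressed metric \<open>\<partial>(h - 2\<alpha>\<xi>) = - 2\<alpha> (Q h - \<alpha>\<xi>)\<close>, which is \<open>- 2\<alpha> P h(0)\<close> at the origin, and which vanishes
  identically if \<open>P h(0) = 0\<close>, by the formula for \<open>E h\<close> at \<open>\<lambda> = - \<i>\<alpha>\<close>. In that case the spheres agree, since \<open>h\<close> does
  not change at the origin.
\<close>

section \<open>Functions of class \<open>C\<^sup>k\<close>\<close>

(* Products with transposed matrices stay products, so that associativity applies to them. *)
declare transpose_matrix_vector [simp del] vector_transpose_matrix [simp del]

lemma partial_eq:
  assumes "(f has_derivative D) (at u)" shows "partial i f u = D (axis i 1)"
  using frechet_derivative_at[OF assms] by (simp add: partial_def)

text \<open>Being defined through \<^const>\<open>frechet_derivative\<close>, a partial derivative depends only on the germ of the function;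
  this holds for non-differentiable functions as well, since both choices are made from the same set.\<close>

lemma partial_cong:
  assumes "open S" "u \<in> S" "\<And>x. x \<in> S \<Longrightarrow> f x = g x"
  shows "partial i f u = partial i g u"
proof -
  have "(f has_derivative D) (at u) \<longleftrightarrow> (g has_derivative D) (at u)" for D
    using has_derivative_transform_within_open[OF _ assms(1,2), of f D UNIV g]
      has_derivative_transform_within_open[OF _ assms(1,2), of g D UNIV f] assms(3) by auto
  then show ?thesis by (simp add: partial_def frechet_derivative_def)
qed

lemma linear_axis_sum:
  fixes v :: "real^'n::finite"
  assumes "linear D" shows "D v = (\<Sum>i\<in>UNIV. v $ i *\<^sub>R D (axis i 1))"
proof -
  have "v = (\<Sum>i\<in>UNIV. v $ i *\<^sub>R axis i 1)"
    by (simp add: vec_eq_iff axis_def if_distrib sum.If_cases cong: if_cong)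
  then have "D v = D (\<Sum>i\<in>UNIV. v $ i *\<^sub>R axis i 1)" by simp
  then show ?thesis by (simp add: linear_sum[OF assms] linear_cmul[OF assms])
qed

lemma Ck_on_cong:
  assumes "open S" "\<And>u. u \<in> S \<Longrightarrow> f u = g u" "Ck_on k S f"
  shows "Ck_on k S g"
  using assms(2,3)
proof (induction k arbitrary: f g)
  case 0
  then show ?case using continuous_on_cong[of S S f g] by simp
next
  case (Suc k)
  have "g differentiable (at u)" if "u \<in> S" for u
    using Suc.prems that has_derivative_transform_within_open[OF _ assms(1) that, of f _ UNIV g]
    unfolding differentiable_def by (metis Ck_on.simps(2) differentiable_def)
  moreover have "Ck_on k S (partial i g)" for i
    using Suc.IH[of "partial i f" "partial i g"] Suc.prems partial_cong[OF assms(1), of _ f g i] by auto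
  ultimately show ?case by simp
qed

text \<open>The form in which a differential equation is used: if the derivative of \<open>f\<close> is an expression in \<open>f\<close> and smooth
  coefficients, then \<open>f\<close> being of class \<open>k\<close> makes the derivative of class \<open>k\<close>, hence \<open>f\<close> of class \<open>k + 1\<close>.\<close>

lemma Ck_on_SucI:
  assumes "open S" "\<And>u. u \<in> S \<Longrightarrow> (f has_derivative D u) (at u)"
    "\<And>i. Ck_on k S (\<lambda>u. D u (axis i 1))"
  shows "Ck_on (Suc k) S f"
proof -
  have "Ck_on k S (partial i f)" for i
    by (rule Ck_on_cong[OF assms(1) _ assms(3)[of i]]) (simp add: partial_eq[OF assms(2)])
  then show ?thesis using assms(2) by (auto simp: differentiable_def)
qed

lemma Ck_on_SucD: "Ck_on (Suc k) S f \<Longrightarrow> Ck_on k S f"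
proof (induction k arbitrary: f)
  case 0
  then show ?case
    by (auto simp: differentiable_on_def differentiable_at_withinI intro!: differentiable_imp_continuous_on)
next
  case (Suc k)
  then have "Ck_on k S (partial i f)" for i by auto
  then show ?case using Suc.prems by auto
qed

lemma Ck_on_const: "open S \<Longrightarrow> Ck_on k S (\<lambda>u. c)"
proof (induction k arbitrary: c)
  case (Suc k)
  show ?case by (rule Ck_on_SucI[where D="\<lambda>u v. 0"]) (use Suc in auto)
qed auto

lemma Ck_on_linear:
  assumes "open S" "bounded_linear L"
  shows "Ck_on k S f \<Longrightarrow> Ck_on k S (\<lambda>u. L (f u))"
proof (induction k arbitrary: f)
  case 0
  then show ?case using bounded_linear.continuous_on[OF assms(2)] by simp
next
  case (Suc k)
  show ?case
    by (rule Ck_on_SucI[where D="\<lambda>u v. L (frechet_derivative f (at u) v)", OF assms(1)])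
      (use Suc in \<open>auto intro!: bounded_linear.has_derivative[OF assms(2)] simp: frechet_derivative_works
         simp flip: partial_def\<close>)
qed

lemma Ck_on_add:
  assumes "open S" shows "Ck_on k S f \<Longrightarrow> Ck_on k S g \<Longrightarrow> Ck_on k S (\<lambda>u. f u + g u)"
proof (induction k arbitrary: f g)
  case 0
  then show ?case by (simp add: continuous_on_add)
next
  case (Suc k)
  show ?case
    by (rule Ck_on_SucI[where D="\<lambda>u v. frechet_derivative f (at u) v + frechet_derivative g (at u) v", OF assms])
      (use Suc in \<open>auto intro!: has_derivative_add simp: frechet_derivative_works simp flip: partial_def\<close>)
qed

lemma Ck_on_bilinear:
  assumes "open S" "bounded_bilinear b"
  shows "Ck_on k S f \<Longrightarrow> Ck_on k S g \<Longrightarrow> Ck_on k S (\<lambda>u. b (f u) (g u))"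
proof (induction k arbitrary: f g)
  case 0
  then show ?case using bounded_bilinear.continuous_on[OF assms(2)] by simp
next
  case (Suc k)
  have fg: "Ck_on k S f" "Ck_on k S g" using Suc.prems Ck_on_SucD by auto
  show ?case
  proof (rule Ck_on_SucI[where D="\<lambda>u v. b (f u) (frechet_derivative g (at u) v) + b (frechet_derivative f (at u) v) (g u)", OF assms(1)])
    show "((\<lambda>x. b (f x) (g x)) has_derivative (\<lambda>v. b (f u) (frechet_derivative g (at u) v) + b (frechet_derivative f (at u) v) (g u))) (at u)"
      if "u \<in> S" for u
      by (rule bounded_bilinear.FDERIV[OF assms(2)]) (use Suc.prems that in \<open>auto simp: frechet_derivative_works\<close>)
    show "Ck_on k S (\<lambda>u. b (f u) (frechet_derivative g (at u) (axis i 1)) + b (frechet_derivative f (at u) (axis i 1)) (g u))" for i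
      using Suc fg by (auto intro!: Ck_on_add assms simp flip: partial_def)
  qed
qed

lemma Ck_on_sum:
  assumes "open S" "finite I" "\<And>i. i \<in> I \<Longrightarrow> Ck_on k S (f i)"
  shows "Ck_on k S (\<lambda>u. \<Sum>i\<in>I. f i u)"
  using assms(2,3) by (induction I rule: finite_induct) (simp_all add: Ck_on_const Ck_on_add assms(1))

lemma Ck_on_inverse:
  fixes f :: "real^'n::finite \<Rightarrow> real"
  assumes "open S" "\<And>u. u \<in> S \<Longrightarrow> f u \<noteq> 0"
  shows "Ck_on k S f \<Longrightarrow> Ck_on k S (\<lambda>u. inverse (f u))"
proof (induction k)
  case 0
  then show ?case using assms by (auto intro!: continuous_on_inverse)
next
  case (Suc k)
  have fk: "Ck_on k S f" using Suc.prems Ck_on_SucD by auto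
  show ?case
  proof (rule Ck_on_SucI[where D="\<lambda>u v. - (inverse (f u) * frechet_derivative f (at u) v * inverse (f u))", OF assms(1)])
    show "((\<lambda>x. inverse (f x)) has_derivative (\<lambda>v. - (inverse (f u) * frechet_derivative f (at u) v * inverse (f u)))) (at u)"
      if "u \<in> S" for u
      by (rule Deriv.has_derivative_inverse) (use Suc.prems that assms in \<open>auto simp: frechet_derivative_works\<close>)
    show "Ck_on k S (\<lambda>u. - (inverse (f u) * frechet_derivative f (at u) (axis i 1) * inverse (f u)))" for i
      using Suc fk by (auto intro!: Ck_on_linear[OF assms(1) bounded_linear_minus[OF bounded_linear_ident]]
          Ck_on_bilinear[OF assms(1) bounded_bilinear_mult] simp flip: partial_def)
  qed
qed

lemma bounded_linear_axis: "bounded_linear (axis i :: 'a::real_normed_vector \<Rightarrow> 'a^'n::finite)"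
  by (rule bounded_linear_intro[where K=1])
    (auto simp: axis_def vec_eq_iff norm_vec_def L2_set_def if_distrib if_distribR sum.If_cases cong: if_cong)

lemma Ck_on_vec:
  assumes "open S" "\<And>i. Ck_on k S (\<lambda>u. f u $ i)" shows "Ck_on k S f"
proof -
  have "f u = (\<Sum>i\<in>UNIV. axis i (f u $ i))" for u
    by (simp add: vec_eq_iff axis_def if_distrib sum.If_cases cong: if_cong)
  moreover have "Ck_on k S (\<lambda>u. \<Sum>i\<in>UNIV. axis i (f u $ i))"
    using assms by (intro Ck_on_sum Ck_on_linear[OF _ bounded_linear_axis]) auto
  ultimately show ?thesis by simp
qed

lemma Ck_on_diff:
  assumes "open S" "Ck_on k S f" "Ck_on k S g" shows "Ck_on k S (\<lambda>u. f u - g u)"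
  using Ck_on_add[OF assms(1,2) Ck_on_linear[OF assms(1) bounded_linear_minus[OF bounded_linear_ident] assms(3)]]
  by simp

lemma Ck_on_subset: "U \<subseteq> S \<Longrightarrow> Ck_on k S f \<Longrightarrow> Ck_on k U f"
  by (induction k arbitrary: f) (auto intro: continuous_on_subset)

lemma differentiable_transform_open:
  assumes "f differentiable (at u)" "open S" "u \<in> S" "\<And>x. x \<in> S \<Longrightarrow> f x = g x"
  shows "g differentiable (at u)"
  using assms has_derivative_transform_within_open[of f _ u UNIV S g] unfolding differentiable_def by blast

section \<open>Mixed partial derivatives and flat metrics\<close>

lemma line_derivative:
  fixes f :: "real^'n::finite \<Rightarrow> real"
  assumes "f differentiable (at (w + a *\<^sub>R axis i 1))"
  shows "((\<lambda>a. f (w + a *\<^sub>R axis i 1)) has_real_derivative partial i f (w + a *\<^sub>R axis i 1)) (at a)"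
proof -
  let ?D = "frechet_derivative f (at (w + a *\<^sub>R axis i 1))"
  have D: "(f has_derivative ?D) (at (w + a *\<^sub>R axis i 1))"
    using assms frechet_derivative_works by blast
  have "((\<lambda>a. w + a *\<^sub>R axis i 1) has_derivative (\<lambda>s. s *\<^sub>R axis i 1)) (at a)"
    by (auto intro!: derivative_eq_intros)
  from diff_chain_at[OF this D]
  have "((\<lambda>a. f (w + a *\<^sub>R axis i 1)) has_derivative (\<lambda>s. ?D (s *\<^sub>R axis i 1))) (at a)"
    by (simp add: o_def)
  moreover have "(\<lambda>s. ?D (s *\<^sub>R axis i 1)) = (*) (?D (axis i 1))"
    by (simp add: fun_eq_iff linear_cmul[OF has_derivative_linear[OF D]])
  ultimately show ?thesis
    by (simp add: has_field_derivative_def partial_def)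
qed

text \<open>Two applications of the mean value theorem, first in direction \<open>i\<close> and then in direction \<open>j\<close>.
  The left-hand side is symmetric in \<open>i\<close> and \<open>j\<close>, which gives the symmetry of second derivatives in the limit.\<close>

lemma second_difference:
  fixes f :: "real^'n::finite \<Rightarrow> real"
  assumes "Ck_on 2 S f" "ball u r \<subseteq> S" "0 < s" "2 * s < r"
  shows "\<exists>\<xi>. dist u \<xi> \<le> 2 * s \<and>
    f (u + s *\<^sub>R axis i 1 + s *\<^sub>R axis j 1) - f (u + s *\<^sub>R axis i 1) - f (u + s *\<^sub>R axis j 1) + f u
      = s * s * partial j (partial i f) \<xi>"
proof -
  have dist_add: "dist u (u + w) = norm w" for w by (simp add: dist_norm)
  have near: "u + a *\<^sub>R axis i 1 + b *\<^sub>R axis j 1 \<in> S \<and> dist u (u + a *\<^sub>R axis i 1 + b *\<^sub>R axis j 1) \<le> 2 * s"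
    if "0 \<le> a" "a \<le> s" "0 \<le> b" "b \<le> s" for a b
  proof -
    have "norm (a *\<^sub>R axis i (1::real) + b *\<^sub>R axis j 1) \<le> 2 * s"
      using norm_triangle_ineq[of "a *\<^sub>R axis i (1::real)" "b *\<^sub>R axis j 1"] that by (simp add: norm_axis_1)
    then have *: "dist u (u + a *\<^sub>R axis i 1 + b *\<^sub>R axis j 1) \<le> 2 * s"
      using dist_add[of "a *\<^sub>R axis i 1 + b *\<^sub>R axis j 1"] by (simp add: add.assoc)
    then have "u + a *\<^sub>R axis i 1 + b *\<^sub>R axis j 1 \<in> ball u r" using assms by auto
    with * show ?thesis using assms by auto
  qed
  have df: "f differentiable (at w)" "partial i f differentiable (at w)" if "w \<in> S" for w
    using assms(1) that by (auto simp: numeral_2_eq_2)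
  define p where "p a = f (u + s *\<^sub>R axis j 1 + a *\<^sub>R axis i 1) - f (u + a *\<^sub>R axis i 1)" for a
  have "\<exists>a. 0 < a \<and> a < s \<and> p s - p 0 =
      (s - 0) * (partial i f (u + s *\<^sub>R axis j 1 + a *\<^sub>R axis i 1) - partial i f (u + a *\<^sub>R axis i 1))"
  proof (rule MVT2[OF assms(3)])
    fix a :: real assume a: "0 \<le> a" "a \<le> s"
    have 1: "u + s *\<^sub>R axis j 1 + a *\<^sub>R axis i 1 \<in> S" "u + a *\<^sub>R axis i 1 \<in> S"
      using near[of a s] near[of a 0] a by (auto simp: algebra_simps)
    show "(p has_real_derivative partial i f (u + s *\<^sub>R axis j 1 + a *\<^sub>R axis i 1) - partial i f (u + a *\<^sub>R axis i 1)) (at a)"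
      unfolding p_def by (intro DERIV_diff line_derivative df 1)
  qed
  then obtain a where a: "0 < a" "a < s" "p s - p 0 =
      s * (partial i f (u + s *\<^sub>R axis j 1 + a *\<^sub>R axis i 1) - partial i f (u + a *\<^sub>R axis i 1))"
    by auto
  have "\<exists>b. 0 < b \<and> b < s \<and>
      partial i f (u + a *\<^sub>R axis i 1 + s *\<^sub>R axis j 1) - partial i f (u + a *\<^sub>R axis i 1 + 0 *\<^sub>R axis j 1)
      = (s - 0) * partial j (partial i f) (u + a *\<^sub>R axis i 1 + b *\<^sub>R axis j 1)"
    by (rule MVT2[OF assms(3)]) (use near a in \<open>auto intro!: line_derivative df\<close>)
  then obtain b where b: "0 < b" "b < s"
    "partial i f (u + a *\<^sub>R axis i 1 + s *\<^sub>R axis j 1) - partial i f (u + a *\<^sub>R axis i 1)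
      = s * partial j (partial i f) (u + a *\<^sub>R axis i 1 + b *\<^sub>R axis j 1)"
    by auto
  have "p s - p 0 = s * s * partial j (partial i f) (u + a *\<^sub>R axis i 1 + b *\<^sub>R axis j 1)"
    using a(3) b(3) by (simp add: add.commute add.left_commute)
  moreover have "p s - p 0 = f (u + s *\<^sub>R axis i 1 + s *\<^sub>R axis j 1) - f (u + s *\<^sub>R axis i 1) - f (u + s *\<^sub>R axis j 1) + f u"
    by (simp add: p_def add.commute add.left_commute)
  moreover have "dist u (u + a *\<^sub>R axis i 1 + b *\<^sub>R axis j 1) \<le> 2 * s"
    using near[of a b] a b by auto
  ultimately show ?thesis by metis
qed

lemma partial_commute_real:
  fixes f :: "real^'n::finite \<Rightarrow> real"
  assumes "open S" "u \<in> S" "Ck_on 2 S f"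
  shows "partial i (partial j f) u = partial j (partial i f) u"
proof (rule ccontr)
  let ?A = "partial i (partial j f)" and ?B = "partial j (partial i f)"
  assume ne: "?A u \<noteq> ?B u"
  define e where "e = dist (?A u) (?B u) / 2"
  have e: "e > 0" using ne by (simp add: e_def)
  have "continuous_on S ?A" "continuous_on S ?B" using assms(3) by (auto simp: numeral_2_eq_2)
  then have "isCont ?A u" "isCont ?B u" using assms by (auto simp: continuous_on_eq_continuous_at)
  then obtain d1 d2 where d: "d1 > 0" "\<And>x. dist x u < d1 \<Longrightarrow> dist (?A x) (?A u) < e"
    "d2 > 0" "\<And>x. dist x u < d2 \<Longrightarrow> dist (?B x) (?B u) < e"
    using e unfolding continuous_at_eps_delta by metis
  obtain r where r: "r > 0" "ball u r \<subseteq> S" using assms openE by blast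
  (* the intermediate points of the second difference lie within 2 s of u *)
  define s where "s = Min {r, d1, d2} / 3"
  have s: "0 < s" "2 * s < r" "2 * s < d1" "2 * s < d2" using r d by (auto simp: s_def min_def)
  obtain x where x: "dist u x \<le> 2 * s"
    "f (u + s *\<^sub>R axis i 1 + s *\<^sub>R axis j 1) - f (u + s *\<^sub>R axis i 1) - f (u + s *\<^sub>R axis j 1) + f u = s * s * ?B x"
    using second_difference[OF assms(3) r(2) s(1,2)] by blast
  obtain y where y: "dist u y \<le> 2 * s"
    "f (u + s *\<^sub>R axis j 1 + s *\<^sub>R axis i 1) - f (u + s *\<^sub>R axis j 1) - f (u + s *\<^sub>R axis i 1) + f u = s * s * ?A y"
    using second_difference[OF assms(3) r(2) s(1,2)] by blast
  have "f (u + s *\<^sub>R axis i 1 + s *\<^sub>R axis j 1) = f (u + s *\<^sub>R axis j 1 + s *\<^sub>R axis i 1)"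
    by (simp add: add_ac)
  then have "s * s * ?A y = s * s * ?B x" using x(2) y(2) by linarith
  then have "?A y = ?B x" using s by simp
  moreover have "dist (?A y) (?A u) < e" using d(2)[of y] y s by (simp add: dist_commute)
  moreover have "dist (?B x) (?B u) < e" using d(4)[of x] x s by (simp add: dist_commute)
  ultimately have "dist (?A u) (?B u) < dist (?A u) (?B u)"
    unfolding e_def by (metis dist_triangle_half_r)
  then show False by simp
qed

text \<open>The scalar case, applied to the inner product of \<open>f\<close> with every fixed vector.\<close>

lemma partial_commute:
  fixes f :: "real^'n::finite \<Rightarrow> 'b::real_inner"
  assumes "open S" "u \<in> S" "Ck_on 2 S f"
  shows "partial i (partial j f) u = partial j (partial i f) u"
proof -
  have bl: "bounded_linear (\<lambda>x. x \<bullet> c)" for c :: 'b by (rule bounded_linear_inner_left)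
  have inn: "partial i (\<lambda>x. g x \<bullet> c) x = partial i g x \<bullet> c"
    if "g differentiable (at x)" for g :: "real^'n \<Rightarrow> 'b" and c x i
    using partial_eq[OF bounded_linear.has_derivative[OF bl that[unfolded frechet_derivative_works]]]
    by (simp add: partial_def)
  have "partial i (partial j f) u \<bullet> c = partial j (partial i f) u \<bullet> c" for c
  proof -
    have fd: "f differentiable (at x)" "partial k f differentiable (at x)" if "x \<in> S" for x k
      using assms(3) that by (auto simp: numeral_2_eq_2)
    have 2: "partial k (partial l (\<lambda>x. f x \<bullet> c)) u = partial k (partial l f) u \<bullet> c" for k l
      using partial_cong[OF assms(1,2), of "partial l (\<lambda>x. f x \<bullet> c)" "\<lambda>x. partial l f x \<bullet> c" k] fd inn assms(2)
      by auto
    have "Ck_on 2 S (\<lambda>x. f x \<bullet> c)" by (rule Ck_on_linear[OF assms(1) bl assms(3)])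
    from partial_commute_real[OF assms(1,2) this, of i j] show ?thesis by (simp add: 2)
  qed
  then show ?thesis by (metis vector_eq_rdot)
qed

lemma matrix_inv_left:
  assumes "invertible A" shows "matrix_inv A ** A = mat 1"
  using someI_ex[of "\<lambda>A'. A ** A' = mat 1 \<and> A' ** A = mat 1"] assms
  unfolding matrix_inv_def invertible_def by blast

text \<open>A metric is flat if it is induced by a map \<open>Y\<close> whose second derivatives are tangential. By the Koszul formula the
  coefficients \<open>c\<close> of these second derivatives are the Christoffel symbols. The coefficients of the third derivatives of
  \<open>Y\<close> are then the terms of the curvature tensor, so the symmetry of third derivatives is the vanishing of the curvature.\<close>

lemma flat_metric_on_parallel:
  fixes Y :: "real^'n::finite \<Rightarrow> 'b::real_inner" and g :: "real^'n \<Rightarrow> real^'n^'n"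
  assumes S: "open S" and Y: "Ck_on 3 S Y"
    and g: "\<And>u i j. u \<in> S \<Longrightarrow> g u $ i $ j = partial i Y u \<bullet> partial j Y u"
    and inv: "\<And>u. u \<in> S \<Longrightarrow> invertible (g u)"
    and cdiff: "\<And>u l i j. u \<in> S \<Longrightarrow> c l i j differentiable (at u)"
    and c: "\<And>u i j. u \<in> S \<Longrightarrow> partial i (partial j Y) u = (\<Sum>l\<in>UNIV. c l i j u *\<^sub>R partial l Y u)"
  shows "flat_metric_on S g"
proof -
  have Y': "Y differentiable (at u)" "partial i Y differentiable (at u)" if "u \<in> S" for u i
    using Y that by (auto simp: numeral_3_eq_3)
  have Y2: "Ck_on 2 S Y" by (rule Ck_on_SucD) (use Y in \<open>simp only: numeral_3_eq_3 numeral_2_eq_2\<close>)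
  have DY2: "Ck_on 2 S (partial k Y)" for k using Y by (simp add: numeral_3_eq_3 numeral_2_eq_2)
  have dg: "partial i (\<lambda>x. g x $ j $ l) u =
      partial i (partial j Y) u \<bullet> partial l Y u + partial j Y u \<bullet> partial i (partial l Y) u"
    if u: "u \<in> S" for u i j l
  proof -
    have "((\<lambda>x. partial j Y x \<bullet> partial l Y x) has_derivative
       (\<lambda>h. partial j Y u \<bullet> frechet_derivative (partial l Y) (at u) h
          + frechet_derivative (partial j Y) (at u) h \<bullet> partial l Y u)) (at u)"
      by (rule has_derivative_inner) (use Y'(2)[OF u] in \<open>simp_all add: frechet_derivative_works\<close>)
    from partial_eq[OF this, of i] show ?thesis
      using partial_cong[OF S u, of "\<lambda>x. g x $ j $ l" "\<lambda>x. partial j Y x \<bullet> partial l Y x" i] g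
      by (simp add: partial_def[of i "partial _ Y"])
  qed
  have gamma: "christoffel g l i j u = c l i j u" if u: "u \<in> S" for l i j u
  proof -
    have "partial i (\<lambda>x. g x $ j $ m) u + partial j (\<lambda>x. g x $ i $ m) u - partial m (\<lambda>x. g x $ i $ j) u
        = 2 * (\<Sum>k\<in>UNIV. g u $ m $ k * c k i j u)" for m
    proof -
      have com: "partial i (partial m Y) u = partial m (partial i Y) u"
        "partial j (partial m Y) u = partial m (partial j Y) u"
        "partial j (partial i Y) u = partial i (partial j Y) u"
        using partial_commute[OF S u Y2] by auto
      have "partial i (\<lambda>x. g x $ j $ m) u + partial j (\<lambda>x. g x $ i $ m) u - partial m (\<lambda>x. g x $ i $ j) u
        = 2 * (partial m Y u \<bullet> partial i (partial j Y) u)"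
        by (simp add: dg[OF u] com inner_commute)
      also have "partial m Y u \<bullet> partial i (partial j Y) u = (\<Sum>k\<in>UNIV. g u $ m $ k * c k i j u)"
        by (simp add: c[OF u] inner_sum_right g[OF u] mult.commute)
      finally show ?thesis .
    qed
    then have "christoffel g l i j u = (matrix_inv (g u) *v (g u *v (\<chi> k. c k i j u))) $ l"
      by (simp add: christoffel_def matrix_vector_mult_def sum_distrib_left mult.assoc sum_divide_distrib
          mult.left_commute)
    also have "\<dots> = c l i j u"
      using matrix_inv_left[OF inv[OF u]] by (simp add: matrix_vector_mul_assoc)
    finally show ?thesis .
  qed
  have indep: "a = b" if u: "u \<in> S" and eq: "(\<Sum>l\<in>UNIV. a $ l *\<^sub>R partial l Y u) = (\<Sum>l\<in>UNIV. b $ l *\<^sub>R partial l Y u)"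
    for a b :: "real^'n" and u
  proof -
    have "g u *v a = g u *v b"
    proof (rule vec_eq_iff[THEN iffD2, rule_format])
      fix m
      have "(g u *v x) $ m = partial m Y u \<bullet> (\<Sum>l\<in>UNIV. x $ l *\<^sub>R partial l Y u)" for x
        by (simp add: matrix_vector_mult_def inner_sum_right g[OF u] mult.commute)
      then show "(g u *v a) $ m = (g u *v b) $ m" using eq by simp
    qed
    then show ?thesis
      using matrix_inv_left[OF inv[OF u]] by (metis matrix_vector_mul_assoc matrix_vector_mul_lid)
  qed
  have third: "partial i (partial j (partial k Y)) u =
      (\<Sum>l\<in>UNIV. (partial i (c l j k) u + (\<Sum>m\<in>UNIV. c l i m u * c m j k u)) *\<^sub>R partial l Y u)"
    if u: "u \<in> S" for u i j k
  proof -
    have "((\<lambda>x. \<Sum>l\<in>UNIV. c l j k x *\<^sub>R partial l Y x) has_derivative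
       (\<lambda>h. \<Sum>l\<in>UNIV. c l j k u *\<^sub>R frechet_derivative (partial l Y) (at u) h
          + frechet_derivative (c l j k) (at u) h *\<^sub>R partial l Y u)) (at u)"
      by (intro has_derivative_sum has_derivative_scaleR)
         (use Y'(2)[OF u] cdiff[OF u] in \<open>simp_all add: frechet_derivative_works\<close>)
    from partial_eq[OF this, of i]
    have "partial i (\<lambda>x. \<Sum>l\<in>UNIV. c l j k x *\<^sub>R partial l Y x) u =
        (\<Sum>l\<in>UNIV. c l j k u *\<^sub>R partial i (partial l Y) u + partial i (c l j k) u *\<^sub>R partial l Y u)"
      by (simp add: partial_def[of i "partial _ Y"] partial_def[of i "c _ _ _"])
    moreover have "partial i (partial j (partial k Y)) u = partial i (\<lambda>x. \<Sum>l\<in>UNIV. c l j k x *\<^sub>R partial l Y x) u"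
      by (rule partial_cong[OF S u]) (simp add: c)
    moreover have "(\<Sum>m\<in>UNIV. c m j k u *\<^sub>R partial i (partial m Y) u) =
        (\<Sum>l\<in>UNIV. (\<Sum>m\<in>UNIV. c l i m u * c m j k u) *\<^sub>R partial l Y u)"
      by (simp add: c[OF u] scaleR_sum_right scaleR_sum_left, subst sum.swap, simp add: mult.commute)
    ultimately show ?thesis by (simp add: sum.distrib scaleR_left_distrib)
  qed
  show ?thesis
    unfolding flat_metric_on_def
  proof (intro ballI allI)
    fix u l k i j assume u: "u \<in> S"
    define R where "R i j = (\<chi> l. partial i (c l j k) u + (\<Sum>m\<in>UNIV. c l i m u * c m j k u))" for i j
    have "(\<Sum>l\<in>UNIV. R i j $ l *\<^sub>R partial l Y u) = (\<Sum>l\<in>UNIV. R j i $ l *\<^sub>R partial l Y u)"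
      using third[OF u, of i j k] third[OF u, of j i k] partial_commute[OF S u DY2, of i j k]
      by (simp add: R_def)
    then have "R i j $ l = R j i $ l" using indep[OF u] by metis
    moreover have "partial i (christoffel g l j k) u = partial i (c l j k) u" for i j
      by (rule partial_cong[OF S u]) (simp add: gamma)
    ultimately show "riemann g l k i j u = 0"
      by (simp add: riemann_def gamma[OF u] R_def sum_subtractf)
  qed
qed

lemma flat_metric_on_cong:
  assumes "open S" "\<And>u. u \<in> S \<Longrightarrow> g u = g' u" "flat_metric_on S g"
  shows "flat_metric_on S g'"
proof -
  have chr: "christoffel g k i j u = christoffel g' k i j u" if "u \<in> S" for k i j u
    using partial_cong[OF assms(1) that, of "\<lambda>x. g x $ _ $ _" "\<lambda>x. g' x $ _ $ _"] assms(2) that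
    by (simp add: christoffel_def)
  have "riemann g l k i j u = riemann g' l k i j u" if "u \<in> S" for l k i j u
    using partial_cong[OF assms(1) that, of "christoffel g _ _ _" "christoffel g' _ _ _"] chr that
    by (simp add: riemann_def)
  then show ?thesis using assms(3) by (simp add: flat_metric_on_def)
qed

section \<open>Complex vectors and matrices\<close>

lemma matrix_diff_ldistrib: "A ** (B - C) = A ** B - A ** (C :: 'a::ring_1^'n^'m)"
  by (simp add: matrix_matrix_mult_def vec_eq_iff right_diff_distrib sum_subtractf)

lemma matrix_diff_rdistrib: "(A - B) ** C = A ** C - B ** (C :: 'a::ring_1^'n^'m)"
  by (simp add: matrix_matrix_mult_def vec_eq_iff left_diff_distrib sum_subtractf)

lemma matrix_add_rdistrib': "(A + B) ** C = A ** C + B ** (C :: 'a::semiring_1^'n^'m)"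
  by (simp add: matrix_matrix_mult_def vec_eq_iff distrib_right sum.distrib)

lemma matrix_minus_left: "(- A) ** B = - (A ** (B :: 'a::ring_1^'n^'m))"
  by (simp add: matrix_matrix_mult_def vec_eq_iff sum_negf)

lemma matrix_minus_right: "A ** (- B) = - (A ** (B :: 'a::ring_1^'n^'m))"
  by (simp add: matrix_matrix_mult_def vec_eq_iff sum_negf)

lemma cscale_mult_left: "cscale c A ** B = cscale c (A ** B)"
  by (simp add: matrix_matrix_mult_def vec_eq_iff cscale_def sum_distrib_left mult.assoc)

lemma cscale_mult_right: "A ** cscale c B = cscale c (A ** B)"
  by (simp add: matrix_matrix_mult_def vec_eq_iff cscale_def sum_distrib_left mult.left_commute)

lemma cscale_add: "cscale c (A + B) = cscale c A + cscale c B"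
  by (simp add: vec_eq_iff cscale_def distrib_left)

lemma cscale_diff: "cscale c (A - B) = cscale c A - cscale c B"
  by (simp add: vec_eq_iff cscale_def right_diff_distrib)

lemma cscale_cscale: "cscale c (cscale d A) = cscale (c * d) A"
  by (simp add: vec_eq_iff cscale_def mult.assoc)

lemma cscale_simps [simp]: "cscale 1 A = A" "cscale 0 A = 0" "cscale c 0 = 0" "cscale (-1) A = - A"
  by (simp_all add: vec_eq_iff cscale_def)

lemma matrix_vector_minus: "A *v (- x) = - (A *v x)" "(- A) *v x = - (A *v x)"
  for x :: "'a::ring_1^'n"
  by (simp_all add: vec_eq_iff matrix_vector_mult_def sum_negf)

lemma cscale_vector: "cscale c A *v x = c *s (A *v x)"
  by (simp add: vec_eq_iff cscale_def matrix_vector_mult_def sum_distrib_left mult.assoc)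

lemma matrix_mult_zero [simp]: "(0 :: 'a::semiring_1^'k^'m) ** B = 0" "B' ** (0 :: 'a::semiring_1^'k^'m) = 0"
  by (simp_all add: matrix_matrix_mult_def vec_eq_iff)

lemmas mat_distribs = matrix_add_ldistrib matrix_add_rdistrib' matrix_diff_ldistrib matrix_diff_rdistrib
  matrix_minus_left matrix_minus_right cscale_mult_left cscale_mult_right cscale_add cscale_diff
  cscale_cscale matrix_mul_assoc

lemma transpose_diff: "transpose (A - B) = transpose A - transpose B"
  by (simp add: vec_eq_iff transpose_def)

lemma transpose_cscale: "transpose (cscale c A) = cscale c (transpose A)"
  by (simp add: vec_eq_iff transpose_def cscale_def)

lemma conj_mat_mult: "conj_mat (A ** B) = conj_mat A ** conj_mat B"
  by (simp add: vec_eq_iff conj_mat_def matrix_matrix_mult_def)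

lemma conj_mat_add: "conj_mat (A + B) = conj_mat A + conj_mat B"
  by (simp add: vec_eq_iff conj_mat_def)

lemma conj_mat_diff: "conj_mat (A - B) = conj_mat A - conj_mat B"
  by (simp add: vec_eq_iff conj_mat_def)

lemma conj_mat_mat1 [simp]: "conj_mat (mat 1) = mat 1"
  by (simp add: vec_eq_iff conj_mat_def mat_def)

definition conj_vec :: "complex^'n \<Rightarrow> complex^'n" where
  "conj_vec x = (\<chi> i. cnj (x $ i))"

lemma conj_vec_simps [simp]:
  "conj_vec (cvec v) = cvec v" "conj_vec 0 = 0"
  by (simp_all add: conj_vec_def cvec_def vec_eq_iff)

lemma conj_vec_mult: "conj_vec (A *v x) = conj_mat A *v conj_vec x"
  by (simp add: vec_eq_iff conj_vec_def conj_mat_def matrix_vector_mult_def)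

lemma conj_mat_diag [simp]: "conj_mat (diag_matrix (cvec v)) = diag_matrix (cvec v)"
  by (simp add: vec_eq_iff conj_mat_def diag_matrix_def cvec_def)

lemma cvec_eq_iff [simp]: "cvec v = cvec w \<longleftrightarrow> v = w"
  by (simp add: cvec_def vec_eq_iff)

lemma cvec_simps: "cvec (v + w) = cvec v + cvec w" "cvec (v - w) = cvec v - cvec w"
  "cvec (a *\<^sub>R v) = a *\<^sub>R cvec v" "cvec (0 :: real^'n) = 0"
  by (simp_all add: cvec_def vec_eq_iff scaleR_conv_of_real[where 'a=complex])

lemma cvec_axis: "cvec (axis i a) = axis i (of_real a)"
  by (simp add: cvec_def vec_eq_iff axis_def)

lemma diag_matrix_vector: "diag_matrix w *v x = (\<chi> i. w $ i * x $ i)"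
  by (simp add: diag_matrix_def matrix_vector_mult_def vec_eq_iff if_distribR if_distrib sum.If_cases cong: if_cong)

lemma diag_matrix_mult_left: "(diag_matrix w ** A) $ i $ j = w $ i * A $ i $ j"
  by (simp add: diag_matrix_def matrix_matrix_mult_def if_distribR if_distrib sum.If_cases cong: if_cong)

lemma diag_matrix_mult_right: "(A ** diag_matrix w) $ i $ j = A $ i $ j * w $ j"
  by (simp add: diag_matrix_def matrix_matrix_mult_def if_distribR if_distrib sum.If_cases cong: if_cong)

lemma diag_matrix_ones: "diag_matrix (cvec (\<chi> i. 1)) = mat 1"
  by (simp add: vec_eq_iff diag_matrix_def cvec_def mat_def)

lemma vector_mult_scale: "A *v (c *s x) = c *s (A *v (x :: complex^'n))"
  by (simp add: vec_eq_iff matrix_vector_mult_def sum_distrib_left mult.left_commute)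

lemma bdot_transpose: "bdot (A *v x) y = bdot x (transpose A *v y)"
  unfolding bdot_def matrix_vector_mult_def transpose_def
  by (simp add: sum_distrib_left sum_distrib_right, subst sum.swap, simp add: ac_simps)

lemma bdot_commute: "bdot x y = bdot y x"
  by (simp add: bdot_def mult.commute)

lemma bdot_linear: "bdot (x + y) w = bdot x w + bdot y w" "bdot (x - y) w = bdot x w - bdot y w"
  "bdot w (x + y) = bdot w x + bdot w y" "bdot w (x - y) = bdot w x - bdot w y"
  "bdot (c *s x) w = c * bdot x w" "bdot w (c *s x) = c * bdot w x" "bdot (- x) w = - bdot x w"
  "bdot w (- x) = - bdot w x" "bdot 0 w = 0" "bdot w 0 = 0"
  by (simp_all add: bdot_def algebra_simps sum.distrib sum_subtractf sum_distrib_left sum_negf)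

text \<open>The real inner product is the real part of the Hermitian one; products with complex matrices are moved across the
  bilinear pairing, where only the transpose enters.\<close>

lemma inner_bdot: "x \<bullet> y = Re (bdot (conj_vec x) y)" for x y :: "complex^'n::finite"
  by (simp add: inner_vec_def bdot_def conj_vec_def inner_complex_def)

lemma bdot_conj_self: "bdot (conj_vec x) x = of_real ((norm x)\<^sup>2)"
proof -
  have "bdot (conj_vec x) x = of_real (Re (bdot (conj_vec x) x))"
    by (simp add: bdot_def conj_vec_def complex_eq_iff algebra_simps)
  then show ?thesis by (simp add: power2_norm_eq_inner inner_bdot)
qed

lemma unitary_inner:
  assumes "transpose (conj_mat A) ** A = mat 1"
  shows "(A *v x) \<bullet> (A *v y) = x \<bullet> y"
  by (simp add: inner_bdot conj_vec_mult bdot_transpose matrix_vector_mul_assoc assms)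

lemma bounded_linear_cscale: "bounded_linear (cscale c :: complex^'n::finite^'m::finite \<Rightarrow> _)"
  unfolding linear_conv_bounded_linear[symmetric]
  by (rule linearI) (simp_all add: vec_eq_iff cscale_def distrib_left)

lemma bounded_linear_transpose: "bounded_linear (transpose :: complex^'n::finite^'m::finite \<Rightarrow> _)"
  unfolding linear_conv_bounded_linear[symmetric]
  by (rule linearI) (simp_all add: vec_eq_iff transpose_def)

lemma bounded_linear_conj_mat: "bounded_linear (conj_mat :: complex^'n::finite^'m::finite \<Rightarrow> _)"
  unfolding linear_conv_bounded_linear[symmetric]
  by (rule linearI) (simp_all add: vec_eq_iff conj_mat_def)

lemma bounded_linear_conj_vec: "bounded_linear (conj_vec :: complex^'n::finite \<Rightarrow> _)"
  unfolding linear_conv_bounded_linear[symmetric]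
  by (rule linearI) (simp_all add: vec_eq_iff conj_vec_def)

lemma bounded_linear_cvec: "bounded_linear (cvec :: real^'n::finite \<Rightarrow> _)"
  unfolding linear_conv_bounded_linear[symmetric]
  by (rule linearI) (simp_all add: cvec_simps)

lemma diag_cvec_linear: "diag_matrix (cvec (v + w)) = diag_matrix (cvec v) + diag_matrix (cvec w)"
  "diag_matrix (cvec (a *\<^sub>R v)) = a *\<^sub>R diag_matrix (cvec v)"
  by (simp_all add: vec_eq_iff diag_matrix_def cvec_def scaleR_conv_of_real[where 'a=complex])

text \<open>The rewriting rules that make products of \<open>P\<close> and its complementary projection collapse.\<close>

lemma projection_absorb:
  fixes P :: "'a::ring_1^'m^'m"
  assumes "P ** P = P"
  shows "P ** (P ** A) = P ** A" "(mat 1 - P) ** (P ** A) = 0" "P ** ((mat 1 - P) ** A) = 0"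
    "(mat 1 - P) ** ((mat 1 - P) ** A) = (mat 1 - P) ** A"
  by (simp_all add: matrix_diff_ldistrib matrix_diff_rdistrib matrix_mul_assoc assms)

lemma axis_zero: "axis j 0 = 0"
  by (simp add: axis_def vec_eq_iff)

lemma norm_cscale: "norm (cscale c A) = cmod c * norm A"
  by (simp add: norm_vec_def L2_set_def cscale_def norm_mult power_mult_distrib real_sqrt_mult flip: sum_distrib_left)

lemma entry_norm_le: "cmod (A $ i $ j) \<le> norm (A :: complex^'n::finite^'m::finite)"
  using order_trans[OF Finite_Cartesian_Product.norm_nth_le[of "A $ i" j] Finite_Cartesian_Product.norm_nth_le[of A i]] .

lemma matrix_norm_entries:
  fixes A :: "complex^'m::finite^'m"
  assumes "\<And>i j. cmod (A $ i $ j) \<le> B" shows "norm A \<le> real CARD('m) * (real CARD('m) * B)"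
proof -
  have "norm A \<le> (\<Sum>i\<in>UNIV. norm (A $ i))" by (simp add: norm_vec_def L2_set_le_sum)
  also have "\<dots> \<le> (\<Sum>i\<in>(UNIV :: 'm set). real CARD('m) * B)"
  proof (rule sum_mono)
    fix i
    have "norm (A $ i) \<le> (\<Sum>j\<in>UNIV. norm (A $ i $ j))" by (simp add: norm_vec_def L2_set_le_sum)
    also have "\<dots> \<le> (\<Sum>j\<in>(UNIV :: 'm set). B)" by (intro sum_mono assms)
    finally show "norm (A $ i) \<le> real CARD('m) * B" by simp
  qed
  finally show ?thesis by simp
qed

lemma transpose_scalar: "transpose (c *\<^sub>R A) = c *\<^sub>R transpose A"
  by (simp add: vec_eq_iff transpose_def)

definition re_vec :: "complex^'n \<Rightarrow> real^'n" where
  "re_vec x = (\<chi> i. Re (x $ i))"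

text \<open>Real vectors are carried as complex ones fixed by conjugation; \<open>re_vec\<close> goes back.\<close>

lemma cvec_re_vec: "conj_vec x = x \<Longrightarrow> cvec (re_vec x) = x"
  by (auto simp: conj_vec_def cvec_def re_vec_def vec_eq_iff complex_eq_iff)

lemma bounded_linear_re_vec: "bounded_linear (re_vec :: complex^'n::finite \<Rightarrow> _)"
  unfolding linear_conv_bounded_linear[symmetric]
  by (rule linearI) (simp_all add: re_vec_def vec_eq_iff)

definition re_off_diag :: "complex^'n^'n \<Rightarrow> real^'n^'n" where
  "re_off_diag A = (\<chi> i j. if i = j then 0 else Re (A $ i $ j))"

lemma bounded_linear_re_off_diag: "bounded_linear (re_off_diag :: complex^'n::finite^'n \<Rightarrow> _)"
  unfolding linear_conv_bounded_linear[symmetric]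
  by (rule linearI) (simp_all add: re_off_diag_def vec_eq_iff)

lemma bounded_bilinear_matrix_matrix:
  "bounded_bilinear ((**) :: complex^'k::finite^'m::finite \<Rightarrow> complex^'n::finite^'k \<Rightarrow> complex^'n^'m)"
proof (rule bilinear_conv_bounded_bilinear[THEN iffD1])
  show "bilinear ((**) :: complex^'k::finite^'m::finite \<Rightarrow> complex^'n::finite^'k \<Rightarrow> complex^'n^'m)"
    unfolding bilinear_def
    by (intro conjI allI linearI)
      (auto simp: vec_eq_iff matrix_matrix_mult_def distrib_left distrib_right sum.distrib scaleR_sum_right)
qed

lemma bounded_bilinear_matrix_vector:
  "bounded_bilinear ((*v) :: complex^'k::finite^'m::finite \<Rightarrow> complex^'k \<Rightarrow> complex^'m)"
proof (rule bilinear_conv_bounded_bilinear[THEN iffD1])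
  show "bilinear ((*v) :: complex^'k::finite^'m::finite \<Rightarrow> complex^'k \<Rightarrow> complex^'m)"
    unfolding bilinear_def
    by (intro conjI allI linearI)
      (auto simp: vec_eq_iff matrix_vector_mult_def distrib_left distrib_right sum.distrib scaleR_sum_right)
qed

lemma bounded_bilinear_bdot: "bounded_bilinear (bdot :: complex^'k::finite \<Rightarrow> _)"
proof (rule bilinear_conv_bounded_bilinear[THEN iffD1])
  show "bilinear (bdot :: complex^'k::finite \<Rightarrow> _)"
    unfolding bilinear_def
    by (intro conjI allI linearI)
      (auto simp: bdot_def distrib_left distrib_right sum.distrib scaleR_sum_right)
qed

lemmas matrix_vector_scaleR = bounded_bilinear.scaleR_right[OF bounded_bilinear_matrix_vector]

lemma bounded_linear_scale: "bounded_linear (\<lambda>x :: complex^'n::finite. c *s x)"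
  unfolding linear_conv_bounded_linear[symmetric]
  by (rule linearI) (simp_all add: vec_eq_iff distrib_left)

section \<open>Block matrices\<close>

lemma sum_option: "(\<Sum>p\<in>(UNIV :: 'n::finite option set). f p) = f None + (\<Sum>i\<in>UNIV. f (Some i))"
  by (simp add: UNIV_option_conv sum.reindex)

lemma block_nth [simp]:
  "block A x c $ Some i $ Some j = A $ i $ j" "block A x c $ Some i $ None = x $ i"
  "block A x c $ None $ Some j = 0" "block A x c $ None $ None = c"
  by (simp_all add: block_def)

lemma option_vec_eq_iff: "M = N \<longleftrightarrow> (\<forall>i j. M $ Some i $ Some j = N $ Some i $ Some j) \<and>
   (\<forall>i. M $ Some i $ None = N $ Some i $ None) \<and> (\<forall>j. M $ None $ Some j = N $ None $ Some j) \<and>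
   M $ None $ None = N $ None $ None"
  for M N :: "'a^('n::finite option)^('m::finite option)"
  by (auto simp: vec_eq_iff split_option_all)

lemma block_mult:
  "block A x c ** block B y d = block (A ** B) (A *v y + d *s x) (c * d)"
  by (simp add: option_vec_eq_iff matrix_matrix_mult_def matrix_vector_mult_def sum_option mult.commute)

lemma block_simps: "block A x c + block B y d = block (A + B) (x + y) (c + d)"
  "block A x c - block B y d = block (A - B) (x - y) (c - d)"
  "cscale a (block A x c) = block (cscale a A) (a *s x) (a * c)"
  "block A x c = block B y d \<longleftrightarrow> A = B \<and> x = y \<and> c = d"
  "mat 1 = block (mat 1) 0 1"
  "r *\<^sub>R block A x c = block (r *\<^sub>R A) (r *\<^sub>R x) (r *\<^sub>R c)"
  by (auto simp: option_vec_eq_iff cscale_def vec_eq_iff mat_def)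

definition block_mat :: "complex^('n option)^('n option) \<Rightarrow> complex^'n^'n" where
  "block_mat M = (\<chi> i j. M $ Some i $ Some j)"

definition block_vec :: "complex^('n option)^('n option) \<Rightarrow> complex^'n" where
  "block_vec M = (\<chi> i. M $ Some i $ None)"

lemma block_mat_vec [simp]: "block_mat (block A x c) = A" "block_vec (block A x c) = x"
  by (simp_all add: block_mat_def block_vec_def vec_eq_iff)

lemma bounded_linear_block_mat: "bounded_linear (block_mat :: complex^('n::finite option)^('n option) \<Rightarrow> _)"
  unfolding linear_conv_bounded_linear[symmetric]
  by (rule linearI) (simp_all add: block_mat_def vec_eq_iff)

lemma bounded_linear_block_vec: "bounded_linear (block_vec :: complex^('n::finite option)^('n option) \<Rightarrow> _)"
  unfolding linear_conv_bounded_linear[symmetric]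
  by (rule linearI) (simp_all add: block_vec_def vec_eq_iff)

text \<open>Splits the differential equation of a block matrix into those of its entries.\<close>

lemma has_derivative_block_iff:
  fixes f :: "'a::real_normed_vector \<Rightarrow> complex^'n::finite^'n"
  shows "((\<lambda>x. block (f x) (g x) c) has_derivative (\<lambda>v. block (f' v) (g' v) 0)) F \<longleftrightarrow>
    (f has_derivative f') F \<and> (g has_derivative g') F"
proof safe
  assume d: "((\<lambda>x. block (f x) (g x) c) has_derivative (\<lambda>v. block (f' v) (g' v) 0)) F"
  show "(f has_derivative f') F"
    using bounded_linear.has_derivative[OF bounded_linear_block_mat d] by simp
  show "(g has_derivative g') F"
    using bounded_linear.has_derivative[OF bounded_linear_block_vec d] by simp
next
  assume fg: "(f has_derivative f') F" "(g has_derivative g') F"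
  have l1: "bounded_linear (\<lambda>A :: complex^'n^'n. block A 0 0)"
    unfolding linear_conv_bounded_linear[symmetric]
    by (rule linearI) (simp_all add: block_simps)
  have l2: "bounded_linear (\<lambda>x :: complex^'n. block 0 x 0)"
    unfolding linear_conv_bounded_linear[symmetric]
    by (rule linearI) (simp_all add: block_simps)
  have "((\<lambda>x. block (f x) 0 0 + block 0 (g x) 0 + block 0 0 c) has_derivative
      (\<lambda>v. block (f' v) 0 0 + block 0 (g' v) 0 + 0)) F"
    by (intro has_derivative_add has_derivative_const
        bounded_linear.has_derivative[OF l1 fg(1)] bounded_linear.has_derivative[OF l2 fg(2)])
  then show "((\<lambda>x. block (f x) (g x) c) has_derivative (\<lambda>v. block (f' v) (g' v) 0)) F"
    by (simp add: block_simps)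
qed

lemma block_invertible_iff: "invertible (block A x 1) \<longleftrightarrow> invertible A"
proof
  assume "invertible A"
  then obtain B where B: "A ** B = mat 1" by (auto simp: invertible_def)
  have "block A x 1 ** block B (- (B *v x)) 1 = mat 1"
    using B by (simp add: block_mult block_simps matrix_vector_minus matrix_vector_mul_assoc)
  then show "invertible (block A x 1)" by (auto simp: invertible_right_inverse)
next
  assume "invertible (block A x 1)"
  then obtain M where M: "M ** block A x 1 = mat 1" by (auto simp: invertible_def)
  have "block_mat M ** A = mat 1"
  proof (rule vec_eq_iff[THEN iffD2, rule_format], rule vec_eq_iff[THEN iffD2, rule_format])
    fix i j
    have "(block_mat M ** A) $ i $ j = (M ** block A x 1) $ Some i $ Some j"
      by (simp add: block_mat_def matrix_matrix_mult_def sum_option)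
    then show "(block_mat M ** A) $ i $ j = mat 1 $ i $ j" by (simp add: M mat_def)
  qed
  then show "invertible A" by (auto simp: invertible_left_inverse)
qed

lemma linear_block:
  fixes f :: "real^'n::finite \<Rightarrow> complex^'m::finite^'m"
  assumes "linear f" "linear g" shows "bounded_linear (\<lambda>v. block (f v) (g v) 0)"
  unfolding linear_conv_bounded_linear[symmetric]
  by (rule linearI) (simp_all add: linear_add[OF assms(1)] linear_add[OF assms(2)] linear_cmul[OF assms(1)]
      linear_cmul[OF assms(2)] block_simps)

section \<open>Symmetries of the linear system\<close>

definition comm_form :: "real^'n::finite^'n \<Rightarrow> real^'n \<Rightarrow> complex^'n^'n" where
  "comm_form R v = diag_matrix (cvec v) ** cmat R - cmat R ** diag_matrix (cvec v)"

text \<open>The form \<open>E\<^sup>-\<^sup>1 dE\<close> of the rotational part of an extended frame, with \<open>R\<close> in the role of \<open>\<beta>\<close> and \<open>z\<close> in that of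
  the spectral parameter.\<close>

definition lax_form :: "real^'n::finite^'n \<Rightarrow> complex \<Rightarrow> real^'n \<Rightarrow> complex^'n^'n" where
  "lax_form R z v = cscale (\<i> * z) (diag_matrix (cvec v)) + comm_form R v"

lemma frame_form_lax:
  "frame_form k u z v = block (lax_form (rotation_coeff k u) z v) (diag_matrix (cvec v) *v cvec (k u)) 0"
  by (simp add: frame_form_def lax_form_def comm_form_def Let_def)

lemma comm_form_nth: "comm_form R v $ i $ j = of_real ((v $ i - v $ j) * R $ i $ j)"
  by (simp add: comm_form_def diag_matrix_mult_left diag_matrix_mult_right cvec_def cmat_def algebra_simps)

text \<open>The two symmetries of the form, under transposition and under conjugation. Each of them yields a symmetry of the solutions.\<close>

lemma transpose_lax_form:
  assumes "transpose R = R"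
  shows "transpose (lax_form R z v) = - lax_form R (- z) v"
proof -
  have "R $ i $ j = R $ j $ i" for i j using assms by (metis transpose_def vec_lambda_beta)
  then show ?thesis
    by (simp add: lax_form_def vec_eq_iff transpose_def comm_form_nth cscale_def diag_matrix_def algebra_simps)
qed

lemma conj_lax_form: "conj_mat (lax_form R z v) = lax_form R (- cnj z) v"
  by (simp add: lax_form_def vec_eq_iff conj_mat_def comm_form_nth cscale_def diag_matrix_def cvec_def)

lemma bounded_linear_lax_form_coeff: "bounded_linear (\<lambda>R. comm_form R v)"
  unfolding linear_conv_bounded_linear[symmetric]
  by (rule linearI) (simp_all add: vec_eq_iff comm_form_nth algebra_simps scaleR_conv_of_real[where 'a=complex])

text \<open>The linear system of an extended frame, with a symmetric matrix \<open>R\<close> in place of the rotation coefficients of \<open>k\<close>, and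
  allowing zeros of \<open>k\<close>. Dressed data are first known to satisfy only this.\<close>

locale flat_frame =
  fixes S :: "(real^'n::finite) set" and R :: "real^'n \<Rightarrow> real^'n^'n" and k :: "real^'n \<Rightarrow> real^'n"
    and E :: "real^'n \<Rightarrow> complex \<Rightarrow> complex^'n^'n" and X :: "real^'n \<Rightarrow> complex \<Rightarrow> complex^'n"
  assumes open_S: "open S" and connected_S: "connected S" and zero_S: "0 \<in> S"
    and R_sym: "u \<in> S \<Longrightarrow> transpose (R u) = R u"
    and E_0: "E 0 z = mat 1" and X_0: "X 0 z = 0"
    and E_deriv: "u \<in> S \<Longrightarrow> ((\<lambda>x. E x z) has_derivative (\<lambda>v. E u z ** lax_form (R u) z v)) (at u)"
    and X_deriv: "u \<in> S \<Longrightarrow> ((\<lambda>x. X x z) has_derivative (\<lambda>v. E u z *v (diag_matrix (cvec v) *v cvec (k u)))) (at u)"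
begin

lemma const_on_S:
  assumes "\<And>u. u \<in> S \<Longrightarrow> (f has_derivative (\<lambda>v. 0)) (at u)" "u \<in> S"
  shows "f u = f 0"
  using has_derivative_zero_unique_connected[OF open_S connected_S assms(1) assms(2) zero_S] by blast

text \<open>The form changes sign under transposition together with \<open>z \<mapsto> - z\<close>, so the product of a solution for \<open>z\<close> with the
  transposed solution for \<open>- z\<close> has derivative zero. In particular every \<open>E u z\<close> is invertible, with an explicit inverse.\<close>

lemma solution_transpose:
  assumes A: "\<And>u. u \<in> S \<Longrightarrow> (A has_derivative (\<lambda>v. A u ** lax_form (R u) z v)) (at u)"
    and A0: "A 0 = mat 1" and u: "u \<in> S"
  shows "A u ** transpose (E u (- z)) = mat 1"
proof -
  have "((\<lambda>x. A x ** transpose (E x (- z))) has_derivative (\<lambda>v. 0)) (at u)" if u: "u \<in> S" for u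
  proof -
    have "((\<lambda>x. A x ** transpose (E x (- z))) has_derivative
      (\<lambda>v. A u ** transpose (E u (- z) ** lax_form (R u) (- z) v)
         + (A u ** lax_form (R u) z v) ** transpose (E u (- z)))) (at u)"
      by (rule bounded_bilinear.FDERIV[OF bounded_bilinear_matrix_matrix A[OF u]])
        (rule bounded_linear.has_derivative[OF bounded_linear_transpose E_deriv[OF u]])
    then show ?thesis
      by (simp add: matrix_transpose_mul transpose_lax_form[OF R_sym[OF u]] mat_distribs)
  qed
  from const_on_S[OF this u] show ?thesis by (simp add: A0 E_0)
qed

lemma E_transpose: "u \<in> S \<Longrightarrow> E u z ** transpose (E u (- z)) = mat 1"
  by (rule solution_transpose[OF E_deriv E_0])

lemma E_transpose': "u \<in> S \<Longrightarrow> transpose (E u (- z)) ** E u z = mat 1"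
  using E_transpose matrix_left_right_inverse by blast

lemma E_transpose_minus: "u \<in> S \<Longrightarrow> E u (- z) ** transpose (E u z) = mat 1"
  "u \<in> S \<Longrightarrow> transpose (E u z) ** E u (- z) = mat 1"
  using E_transpose[of u "- z"] E_transpose'[of u "- z"] by simp_all

lemma E_invertible: "u \<in> S \<Longrightarrow> invertible (E u z)"
  using E_transpose by (auto simp: invertible_right_inverse)

text \<open>Two solutions with the same initial value have the same transposed inverse.\<close>

lemma solution_unique:
  assumes A: "\<And>u. u \<in> S \<Longrightarrow> (A has_derivative (\<lambda>v. A u ** lax_form (R u) z v)) (at u)"
    and A0: "A 0 = mat 1" and u: "u \<in> S"
  shows "A u = E u z"
proof -
  have "A u = A u ** (transpose (E u (- z)) ** E u z)" using E_transpose'[OF u] by simp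
  also have "\<dots> = E u z" using solution_transpose[OF A A0 u] by (simp add: matrix_mul_assoc)
  finally show ?thesis .
qed

text \<open>Conjugation together with \<open>z \<mapsto> - cnj z\<close> preserves the differential equation. Purely imaginary parameters are fixed by
  this involution, so there the frame is real.\<close>

lemma E_conj:
  assumes u: "u \<in> S" shows "conj_mat (E u (- cnj z)) = E u z"
proof (rule solution_unique[OF _ _ u])
  fix u assume u: "u \<in> S"
  show "((\<lambda>x. conj_mat (E x (- cnj z))) has_derivative (\<lambda>v. conj_mat (E u (- cnj z)) ** lax_form (R u) z v)) (at u)"
    using bounded_linear.has_derivative[OF bounded_linear_conj_mat E_deriv[OF u, of "- cnj z"]]
    by (simp add: conj_mat_mult conj_lax_form)
qed (simp add: E_0)

lemma X_conj:
  assumes u: "u \<in> S" shows "conj_vec (X u (- cnj z)) = X u z"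
proof -
  have "((\<lambda>x. conj_vec (X x (- cnj z)) - X x z) has_derivative (\<lambda>v. 0)) (at u)" if u: "u \<in> S" for u
    using has_derivative_diff[OF bounded_linear.has_derivative[OF bounded_linear_conj_vec X_deriv[OF u, of "- cnj z"]]
        X_deriv[OF u, of z]]
    by (simp add: conj_vec_mult E_conj[OF u])
  from const_on_S[OF this u] show ?thesis by (simp add: X_0)
qed

lemma E_unitary:
  assumes "u \<in> S" shows "transpose (conj_mat (E u (of_real t))) ** E u (of_real t) = mat 1"
  using E_conj[OF assms, of "- of_real t"] E_transpose'[OF assms, of "of_real t"] by simp

lemma E_inner: "u \<in> S \<Longrightarrow> (E u (of_real t) *v x) \<bullet> (E u (of_real t) *v y) = x \<bullet> y"
  by (rule unitary_inner[OF E_unitary])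

lemma E_norm: "u \<in> S \<Longrightarrow> norm (E u (of_real t) *v x) = norm x"
  by (simp add: norm_eq_sqrt_inner E_inner)

lemma E_cancel: "u \<in> S \<Longrightarrow> E u z *v x = E u z *v y \<longleftrightarrow> x = y"
  using inj_matrix_vector_mult[OF E_invertible] by (auto simp: inj_def)

end

section \<open>The immersions of a frame\<close>

text \<open>The decomposition of a vector into a tangential and a normal part is unique, which evaluates the description operator
  in \<^const>\<open>second_ff\<close>.\<close>

lemma normal_part_unique:
  assumes T: "subspace T" and w: "\<forall>x\<in>T. orthogonal x w" "p - w \<in> T"
    and w': "\<forall>x\<in>T. orthogonal x w'" "p - w' \<in> T"
  shows "w' = w"
proof -
  have "w' - w \<in> T" using subspace_diff[OF T w(2) w'(2)] by simp
  then have "orthogonal (w' - w) (w' - w)" using w w' by (simp add: orthogonal_def inner_diff_right)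
  then show ?thesis by (simp add: orthogonal_self)
qed

locale smooth_frame = flat_frame S R k E X
  for S :: "(real^'n::finite) set" and R k E X +
  assumes R_smooth: "smooth_on S R" and k_smooth: "smooth_on S k"
    and k_nonzero: "u \<in> S \<Longrightarrow> k u $ i \<noteq> 0"
begin

text \<open>The differential equation expresses the first derivatives of \<open>E\<close> by \<open>E\<close> and the smooth coefficients.\<close>

lemma E_Ck: "Ck_on m S (\<lambda>u. E u z)"
proof (induction m)
  case 0
  have "\<exists>D. ((\<lambda>u. E u z) has_derivative D) (at u within S)" if "u \<in> S" for u
    using E_deriv[OF that] has_derivative_at_withinI by blast
  then show ?case
    by (auto simp: differentiable_on_def differentiable_def intro!: differentiable_imp_continuous_on)
next
  case (Suc m)
  have "Ck_on m S (\<lambda>u. lax_form (R u) z v)" for v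
    unfolding lax_form_def using R_smooth
    by (auto intro!: Ck_on_add Ck_on_const open_S Ck_on_linear[OF _ bounded_linear_lax_form_coeff] simp: smooth_on_def)
  then show ?case
    using Suc by (intro Ck_on_SucI[OF open_S E_deriv] Ck_on_bilinear[OF open_S bounded_bilinear_matrix_matrix])
qed

lemma diag_axis_vector: "diag_matrix (cvec (axis i 1)) *v cvec w = axis i (of_real (w $ i))"
  by (simp add: diag_matrix_vector vec_eq_iff cvec_def axis_def)

lemma axis_component_linear: "bounded_linear (\<lambda>w :: real^'n. axis i (of_real (w $ i)) :: complex^'n)"
  unfolding linear_conv_bounded_linear[symmetric]
  by (rule linearI) (auto simp: axis_def vec_eq_iff scaleR_conv_of_real[where 'a=complex])

lemma X_smooth: "smooth_on S (\<lambda>u. X u z)"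
  unfolding smooth_on_def
proof
  fix m
  have "Ck_on (Suc m) S (\<lambda>u. X u z)"
  proof (rule Ck_on_SucI[OF open_S X_deriv])
    fix i
    show "Ck_on m S (\<lambda>u. E u z *v (diag_matrix (cvec (axis i 1)) *v cvec (k u)))"
      unfolding diag_axis_vector using k_smooth
      by (intro Ck_on_bilinear[OF open_S bounded_bilinear_matrix_vector] E_Ck
          Ck_on_linear[OF open_S axis_component_linear]) (simp add: smooth_on_def)
  qed
  then show "Ck_on m S (\<lambda>u. X u z)" by (rule Ck_on_SucD)
qed

lemma partial_X: "u \<in> S \<Longrightarrow> partial i (\<lambda>u. X u z) u = E u z *v axis i (of_real (k u $ i))"
  using partial_eq[OF X_deriv] by (simp add: diag_axis_vector)

text \<open>The tangential part of the second derivative of \<open>X\<close>, in the frame \<open>E\<close>; it is real and independent of the parameter.\<close>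

definition hess :: "'n \<Rightarrow> 'n \<Rightarrow> real^'n \<Rightarrow> real^'n" where
  "hess i j u = (\<chi> l. (axis i 1 $ l - axis i 1 $ j) * R u $ l $ j * k u $ j) + axis j (partial i (\<lambda>x. k x $ j) u)"

lemma k_deriv: "u \<in> S \<Longrightarrow> (k has_derivative frechet_derivative k (at u)) (at u)"
  using k_smooth Ck_on.simps(2)[of 0 S k] unfolding smooth_on_def
  by (auto simp: frechet_derivative_works simp del: Ck_on.simps)

lemma k_nth_deriv: "u \<in> S \<Longrightarrow> ((\<lambda>x. k x $ j) has_derivative (\<lambda>v. frechet_derivative k (at u) v $ j)) (at u)"
  by (rule bounded_linear.has_derivative[OF bounded_linear_vec_nth k_deriv])

lemma partial_k_nth: "u \<in> S \<Longrightarrow> partial i (\<lambda>x. k x $ j) u = partial i k u $ j"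
  using partial_eq[OF k_nth_deriv] by (simp add: partial_def)

lemma partial_partial_X:
  assumes u: "u \<in> S"
  shows "partial i (partial j (\<lambda>u. X u z)) u =
    E u z *v ((if i = j then axis j (\<i> * z * of_real (k u $ j)) else 0) + cvec (hess i j u))"
proof -
  have "((\<lambda>x. E x z *v axis j (of_real (k x $ j))) has_derivative
     (\<lambda>v. E u z *v axis j (of_real (frechet_derivative k (at u) v $ j))
        + (E u z ** lax_form (R u) z v) *v axis j (of_real (k u $ j)))) (at u)"
    by (rule bounded_bilinear.FDERIV[OF bounded_bilinear_matrix_vector E_deriv[OF u]])
      (rule bounded_linear.has_derivative[OF axis_component_linear k_deriv[OF u]])
  from partial_eq[OF this, of i]
  have "partial i (\<lambda>x. E x z *v axis j (of_real (k x $ j))) u =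
     E u z *v (lax_form (R u) z (axis i 1) *v axis j (of_real (k u $ j)) + axis j (of_real (partial i (\<lambda>x. k x $ j) u)))"
    by (simp add: partial_k_nth[OF u] partial_def[of i k] matrix_vector_mul_assoc matrix_vector_right_distrib)
  moreover have "lax_form (R u) z (axis i 1) *v axis j (of_real (k u $ j)) =
      (if i = j then axis j (\<i> * z * of_real (k u $ j)) else 0)
       + cvec (\<chi> l. (axis i 1 $ l - axis i 1 $ j) * R u $ l $ j * k u $ j)"
  proof (rule vec_eq_iff[THEN iffD2, rule_format])
    fix l
    have "(lax_form (R u) z (axis i 1) *v axis j (of_real (k u $ j))) $ l =
        lax_form (R u) z (axis i 1) $ l $ j * of_real (k u $ j)"
      by (simp add: matrix_vector_mult_def axis_def if_distrib sum.If_cases cong: if_cong)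
    then show "(lax_form (R u) z (axis i 1) *v axis j (of_real (k u $ j))) $ l =
      ((if i = j then axis j (\<i> * z * of_real (k u $ j)) else 0)
       + cvec (\<chi> l. (axis i 1 $ l - axis i 1 $ j) * R u $ l $ j * k u $ j)) $ l"
      by (auto simp: lax_form_def comm_form_nth cscale_def diag_matrix_def cvec_def axis_def)
  qed
  moreover have "partial i (partial j (\<lambda>u. X u z)) u = partial i (\<lambda>x. E x z *v axis j (of_real (k x $ j))) u"
    by (rule partial_cong[OF open_S u]) (simp add: partial_X)
  ultimately show ?thesis
    by (simp add: hess_def cvec_simps cvec_axis add.assoc)
qed

lemma first_ff_X:
  assumes "u \<in> S" shows "first_ff (\<lambda>u. X u (of_real t)) u = diag_metric k u"
  by (simp add: first_ff_def vec_eq_iff partial_X[OF assms] E_inner[OF assms] inner_axis_axis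
      diag_metric_def diag_matrix_def power2_eq_square inner_complex_def)

text \<open>As no \<open>k\<^sub>i\<close> vanishes, the columns of \<open>E\<close> form a real basis of the tangent space.\<close>

lemma tangent_space:
  assumes u: "u \<in> S"
  shows "range (frechet_derivative (\<lambda>u. X u z) (at u)) = range (\<lambda>w. E u z *v cvec w)"
proof -
  define m where "m v = (\<chi> i. v $ i * k u $ i)" for v
  have "surj m"
    by (rule surjI[of m "\<lambda>w. \<chi> i. w $ i / k u $ i"]) (use k_nonzero[OF u] in \<open>simp add: m_def vec_eq_iff\<close>)
  have "frechet_derivative (\<lambda>u. X u z) (at u) = (\<lambda>v. E u z *v cvec (m v))"
    unfolding frechet_derivative_at[OF X_deriv[OF u], symmetric]
    by (simp add: diag_matrix_vector cvec_def m_def)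
  then have "range (frechet_derivative (\<lambda>u. X u z) (at u)) = (\<lambda>w. E u z *v cvec w) ` range m"
    by (simp add: image_image)
  then show ?thesis using \<open>surj m\<close> by simp
qed

lemma inj_frechet_X:
  assumes u: "u \<in> S" shows "inj (frechet_derivative (\<lambda>u. X u z) (at u))"
  by (rule injI) (simp flip: frechet_derivative_at[OF X_deriv[OF u]] add: E_cancel[OF u],
    use k_nonzero[OF u] in \<open>simp add: diag_matrix_vector cvec_def vec_eq_iff\<close>)

lemma lagrangian_X:
  assumes u: "u \<in> S"
  shows "partial i (\<lambda>u. X u (of_real t)) u \<bullet> (\<i> *s partial j (\<lambda>u. X u (of_real t)) u) = 0"
proof -
  have "\<i> *s axis j (of_real a) = axis j (\<i> * of_real a)" for a :: real
    by (simp add: axis_def vec_eq_iff)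
  then show ?thesis
    by (simp add: partial_X[OF u] vector_mult_scale[symmetric] E_inner[OF u] inner_axis_axis inner_complex_def)
qed

text \<open>Multiplication by \<open>\<i>\<close> maps the tangent space, spanned by the columns of a unitary matrix, to its orthogonal complement.
  The second derivative is tangential except for the term that comes from \<open>\<i>\<lambda>\<delta>\<close>.\<close>

lemma second_ff_X:
  assumes u: "u \<in> S"
  shows "second_ff (\<lambda>u. X u (of_real t)) u i j =
    (if i = j then t *\<^sub>R (\<i> *s partial i (\<lambda>u. X u (of_real t)) u) else 0)"
proof -
  let ?T = "range (frechet_derivative (\<lambda>u. X u (of_real t)) (at u))"
  let ?w = "(if i = j then t *\<^sub>R (\<i> *s partial i (\<lambda>u. X u (of_real t)) u) else 0)"
  have w: "?w = E u (of_real t) *v (if i = j then axis j (\<i> * of_real t * of_real (k u $ j)) else 0)"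
  proof -
    have "t *\<^sub>R (\<i> *s axis j (of_real a)) = axis j (\<i> * of_real t * of_real a)" for a :: real
      by (simp add: axis_def vec_eq_iff scaleR_conv_of_real[where 'a=complex])
    then show ?thesis
      by (simp add: partial_X[OF u] vector_mult_scale[symmetric] matrix_vector_scaleR[symmetric])
  qed
  have T: "x \<in> ?T \<longleftrightarrow> (\<exists>a. x = E u (of_real t) *v cvec a)" for x
    unfolding tangent_space[OF u] by auto
  have orth: "\<forall>x\<in>?T. orthogonal x ?w"
  proof
    fix x assume "x \<in> ?T"
    then obtain a where a: "x = E u (of_real t) *v cvec a" using T by blast
    show "orthogonal x ?w"
      unfolding a w orthogonal_def E_inner[OF u]
      by (simp add: inner_axis cvec_def inner_complex_def)
  qed
  have tang: "partial i (partial j (\<lambda>u. X u (of_real t))) u - ?w \<in> ?T"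
    unfolding T w partial_partial_X[OF u] matrix_vector_mult_diff_distrib[symmetric] by auto
  have sub: "subspace ?T"
    using linear_subspace_image[OF has_derivative_linear[OF X_deriv[OF u]] subspace_UNIV]
    by (simp add: frechet_derivative_at[OF X_deriv[OF u], symmetric])
  show ?thesis
    unfolding second_ff_def Let_def
  proof (rule the_equality)
    show "(\<forall>x\<in>?T. orthogonal x ?w) \<and> partial i (partial j (\<lambda>u. X u (of_real t))) u - ?w \<in> ?T"
      using orth tang by (rule conjI)
  next
    fix w' assume "(\<forall>x\<in>?T. orthogonal x w') \<and> partial i (partial j (\<lambda>u. X u (of_real t))) u - w' \<in> ?T"
    then show "w' = ?w" using normal_part_unique[OF sub orth tang] by (elim conjE)
  qed
qed

text \<open>At the parameter \<open>0\<close> the frame is orthogonal and \<open>X\<close> is an isometric immersion with values in the real space, where the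
  second derivatives are tangential.\<close>

lemma flat_metric: "flat_metric_on S (diag_metric k)"
proof (rule flat_metric_on_parallel[OF open_S, where Y="\<lambda>u. X u 0" and c="\<lambda>l i j u. hess i j u $ l / k u $ l"])
  show "Ck_on 3 S (\<lambda>u. X u 0)" using X_smooth by (simp only: smooth_on_def)
next
  fix u i j assume u: "u \<in> S"
  show "diag_metric k u $ i $ j = partial i (\<lambda>u. X u 0) u \<bullet> partial j (\<lambda>u. X u 0) u"
    using first_ff_X[OF u, of 0, symmetric] by (simp add: first_ff_def)
  show "partial i (partial j (\<lambda>u. X u 0)) u =
      (\<Sum>l\<in>UNIV. (hess i j u $ l / k u $ l) *\<^sub>R partial l (\<lambda>u. X u 0) u)"
  proof -
    have "cvec (hess i j u) = (\<Sum>l\<in>UNIV. (hess i j u $ l / k u $ l) *\<^sub>R axis l (of_real (k u $ l)))"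
      using k_nonzero[OF u]
      by (simp add: vec_eq_iff cvec_def axis_def if_distrib if_distribR sum.If_cases scaleR_conv_of_real[where 'a=complex] cong: if_cong)
    moreover have "partial i (partial j (\<lambda>u. X u 0)) u = E u 0 *v cvec (hess i j u)"
      using partial_partial_X[OF u, of i j 0] by (simp add: axis_zero)
    ultimately show ?thesis
      by (simp add: partial_X[OF u] matrix_vector_scaleR[symmetric] linear_sum[OF matrix_vector_mul_linear])
  qed
next
  fix u assume u: "u \<in> S"
  have "diag_metric k u ** diag_matrix (\<chi> i. 1 / (k u $ i)\<^sup>2) = mat 1"
    using k_nonzero[OF u]
    by (simp add: diag_metric_def vec_eq_iff diag_matrix_mult_left) (simp add: diag_matrix_def mat_def)
  then show "invertible (diag_metric k u)" by (auto simp: invertible_right_inverse)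
next
  fix u l i j assume u: "u \<in> S"
  have R: "R differentiable (at u)" and k: "k differentiable (at u)" and k1: "partial i k differentiable (at u)"
    using R_smooth k_smooth u unfolding smooth_on_def by (metis Ck_on.simps(2))+
  have nth: "(\<lambda>x. f x $ a) differentiable (at u)" if "f differentiable (at u)" for f :: "real^'n \<Rightarrow> 'x::real_normed_vector^'n" and a
    using bounded_linear.has_derivative[OF bounded_linear_vec_nth] that unfolding differentiable_def by blast
  have "((\<lambda>u. ((axis i 1 $ l - axis i 1 $ j) * R u $ l $ j * k u $ j
       + (if l = j then partial i k u $ j else 0)) / k u $ l) differentiable (at u))"
    using k_nonzero[OF u] nth[OF nth[OF R]] nth[OF k] nth[OF k1]
    by (cases "l = j"; intro differentiable_divide differentiable_add differentiable_mult differentiable_const;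
        simp)
  moreover have "hess i j u $ l = (axis i 1 $ l - axis i 1 $ j) * R u $ l $ j * k u $ j
       + (if l = j then partial i k u $ j else 0)" if "u \<in> S" for u
    by (simp add: hess_def partial_k_nth[OF that]) (simp add: axis_def)
  ultimately show "(\<lambda>u. hess i j u $ l / k u $ l) differentiable (at u)"
    by - (rule differentiable_transform_open[OF _ open_S u], assumption, simp)
qed

text \<open>The symmetry of the second derivatives of \<open>X\<close> at the parameter \<open>0\<close> forces \<open>R\<close> to be, off the diagonal, the rotation
  coefficient matrix of \<open>k\<close>: a solvable linear system determines its own metric.\<close>

lemma partial_k_off_diag:
  assumes u: "u \<in> S" and ij: "i \<noteq> j"
  shows "partial j (\<lambda>x. k x $ i) u = R u $ i $ j * k u $ j"
proof -
  have "partial i (partial j (\<lambda>u. X u 0)) u = partial j (partial i (\<lambda>u. X u 0)) u"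
    by (rule partial_commute[OF open_S u]) (use X_smooth in \<open>simp only: smooth_on_def\<close>)
  then have "hess i j u = hess j i u"
    using ij by (simp add: partial_partial_X[OF u] E_cancel[OF u])
  from arg_cong[OF this, of "\<lambda>w. w $ i"] show ?thesis
    using ij by (simp add: hess_def) (simp add: axis_def)
qed

lemma rotation_coeff_eq:
  assumes u: "u \<in> S" and "\<And>i. R u $ i $ i = 0"
  shows "rotation_coeff k u = R u"
  using assms k_nonzero[OF u] by (simp add: rotation_coeff_def vec_eq_iff partial_k_off_diag)

lemma flat_lagrangian_X: "flat_lagrangian_immersion S (\<lambda>u. X u (of_real t))"
proof -
  have "flat_metric_on S (first_ff (\<lambda>u. X u (of_real t)))"
  proof (rule flat_metric_on_cong[OF open_S])
    show "\<And>u. u \<in> S \<Longrightarrow> diag_metric k u = first_ff (\<lambda>u. X u (of_real t)) u" by (simp add: first_ff_X)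
  qed (rule flat_metric)
  then show ?thesis
    by (simp add: flat_lagrangian_immersion_def X_smooth inj_frechet_X lagrangian_X)
qed

end

section \<open>Immersions into spheres\<close>

context smooth_frame
begin

lemma k_deriv_partials:
  assumes u: "u \<in> S"
  shows "frechet_derivative k (at u) v $ i = (\<Sum>j\<in>UNIV. v $ j * partial j (\<lambda>x. k x $ i) u)"
  using arg_cong[OF linear_axis_sum[OF has_derivative_linear[OF k_deriv[OF u]]], of "\<lambda>w. w $ i" v]
  by (simp add: partial_k_nth[OF u]) (simp add: partial_def)

text \<open>Off the diagonal the partial derivatives of \<open>k\<close> are given by the rotation coefficients, and invariance under the
  diagonal translations determines the remaining ones.\<close>

lemma k_deriv_del_invariant:
  assumes u: "u \<in> S" and inv: "del_invariant S k"
  shows "cvec (frechet_derivative k (at u) v) = - (comm_form (R u) v *v cvec (k u))"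
proof (rule vec_eq_iff[THEN iffD2, rule_format])
  fix i
  have "(\<Sum>j\<in>UNIV. v $ i * partial j (\<lambda>x. k x $ i) u) = 0"
    using inv u by (simp add: del_invariant_def flip: sum_distrib_left)
  then have "frechet_derivative k (at u) v $ i = (\<Sum>j\<in>UNIV. (v $ j - v $ i) * partial j (\<lambda>x. k x $ i) u)"
    by (simp add: k_deriv_partials[OF u] left_diff_distrib sum_subtractf)
  also have "\<dots> = (\<Sum>j\<in>UNIV. - ((v $ i - v $ j) * R u $ i $ j * k u $ j))"
  proof (rule sum.cong)
    fix j
    show "(v $ j - v $ i) * partial j (\<lambda>x. k x $ i) u = - ((v $ i - v $ j) * R u $ i $ j * k u $ j)"
      by (cases "i = j") (simp_all add: partial_k_off_diag[OF u] algebra_simps)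
  qed simp
  finally show "cvec (frechet_derivative k (at u) v) $ i = (- (comm_form (R u) v *v cvec (k u))) $ i"
    by (simp add: cvec_def matrix_vector_mult_def comm_form_nth sum_negf)
qed

text \<open>By the previous lemma \<open>E k\<close> and \<open>\<i>\<lambda>X\<close> have the same derivative.\<close>

lemma position_del_invariant:
  assumes inv: "del_invariant S k" and u: "u \<in> S"
  shows "E u z *v cvec (k u) - cvec (k 0) = (\<i> * z) *s X u z"
proof -
  have "((\<lambda>x. E x z *v cvec (k x) - (\<i> * z) *s X x z) has_derivative (\<lambda>v. 0)) (at u)" if u: "u \<in> S" for u
  proof -
    have "((\<lambda>x. E x z *v cvec (k x) - (\<i> * z) *s X x z) has_derivative
       (\<lambda>v. (E u z *v cvec (frechet_derivative k (at u) v) + (E u z ** lax_form (R u) z v) *v cvec (k u))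
          - (\<i> * z) *s (E u z *v (diag_matrix (cvec v) *v cvec (k u))))) (at u)"
      by (intro has_derivative_diff bounded_linear.has_derivative[OF bounded_linear_scale X_deriv[OF u]]
          bounded_bilinear.FDERIV[OF bounded_bilinear_matrix_vector E_deriv[OF u]]
          bounded_linear.has_derivative[OF bounded_linear_cvec k_deriv[OF u]])
    moreover have "(E u z *v cvec (frechet_derivative k (at u) v) + (E u z ** lax_form (R u) z v) *v cvec (k u))
          - (\<i> * z) *s (E u z *v (diag_matrix (cvec v) *v cvec (k u))) = 0" for v
      by (simp add: k_deriv_del_invariant[OF u inv] lax_form_def cscale_vector vector_mult_scale matrix_vector_minus
          matrix_vector_mult_add_rdistrib matrix_vector_right_distrib flip: matrix_vector_mul_assoc)
    ultimately show ?thesis by simp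
  qed
  from const_on_S[OF this u] show ?thesis by (simp add: E_0 X_0 algebra_simps)
qed

text \<open>The position formula at the parameter \<open>0\<close> says that an orthogonal matrix takes \<open>k u\<close> to \<open>k 0\<close>.\<close>

lemma norm_k_del_invariant:
  assumes "del_invariant S k" and "u \<in> S" shows "norm (cvec (k u)) = norm (cvec (k 0))"
  using position_del_invariant[OF assms, of 0] E_norm[OF assms(2), of 0 "cvec (k u)"] by simp

lemma norm_k_0: "norm (cvec (k 0)) > 0"
  using k_nonzero[OF zero_S] by (auto simp: cvec_def vec_eq_iff)

text \<open>Dividing the position formula by \<open>\<i>t\<close> exhibits \<open>X\<close> as a translate of a unitary image of \<open>k / (\<i>t)\<close>,
  and the length of \<open>k\<close> is constant. The centre and radius only involve \<open>k 0\<close> and \<open>t\<close>.\<close>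

lemma sphere_del_invariant:
  assumes inv: "del_invariant S k" and u: "u \<in> S" and t: "t \<noteq> 0"
  shows "X u (of_real t) \<in> sphere ((\<i> / of_real t) *s cvec (k 0)) (norm (cvec (k 0)) / \<bar>t\<bar>)"
proof -
  have nrm: "norm (c *s x) = cmod c * norm x" for c and x :: "complex^'n"
    by (simp add: norm_vec_def L2_set_def norm_mult power_mult_distrib real_sqrt_mult flip: sum_distrib_left)
  have "E u (of_real t) *v cvec (k u) = cvec (k 0) + (\<i> * of_real t) *s X u (of_real t)"
    using position_del_invariant[OF inv u, of "of_real t"] by (simp add: algebra_simps)
  then have eq: "(\<i> / of_real t) *s (E u (of_real t) *v cvec (k u)) = (\<i> / of_real t) *s cvec (k 0) - X u (of_real t)"
    using t by (simp add: vec_eq_iff field_simps)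
  have "dist ((\<i> / of_real t) *s cvec (k 0)) (X u (of_real t)) = norm (cvec (k u)) / \<bar>t\<bar>"
    unfolding dist_norm by (simp add: nrm E_norm[OF u] norm_divide flip: eq)
  then show ?thesis by (simp add: norm_k_del_invariant[OF inv u])
qed

lemma comm_form_ones: "comm_form M (\<chi> i. 1) = 0"
  by (simp add: comm_form_def diag_matrix_ones)

text \<open>If \<open>X\<close> lies in a sphere, then the vector \<open>X - c\<close> is orthogonal to the tangent space, so that in the frame \<open>E\<close> its
  coordinates \<open>a\<close> are imaginary. Along the vector \<open>(1, \<dots>, 1)\<close>, on which \<open>[\<delta>, \<beta>]\<close> vanishes, the differential equation
  of \<open>a\<close> is \<open>\<partial>a = k - \<i>ta\<close>. Its real part gives \<open>\<i>ta = k\<close>, and then the equation itself says \<open>\<partial>a = 0\<close>,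
  hence \<open>\<partial>k = 0\<close>.\<close>

lemma del_invariant_of_sphere:
  assumes t: "t \<noteq> 0" and sph: "in_hypersphere S (\<lambda>u. X u (of_real t))"
  shows "del_invariant S k"
proof -
  obtain c r where c: "\<And>u. u \<in> S \<Longrightarrow> dist c (X u (of_real t)) = r"
    using sph by (auto simp: in_hypersphere_def sphere_def image_subset_iff)
  define a where "a u = transpose (E u (- of_real t)) *v (X u (of_real t) - c)" for u
  have Ea: "E u (of_real t) *v a u = X u (of_real t) - c" if "u \<in> S" for u
    using E_transpose[OF that] by (simp add: a_def matrix_vector_mul_assoc)
  have Re_a: "Re (a u $ i) = 0" if u: "u \<in> S" for u i
  proof -
    have d1: "((\<lambda>x. (X x (of_real t) - c) \<bullet> (X x (of_real t) - c)) has_derivative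
      (\<lambda>v. (X u (of_real t) - c) \<bullet> (E u (of_real t) *v (diag_matrix (cvec v) *v cvec (k u)) - 0)
         + (E u (of_real t) *v (diag_matrix (cvec v) *v cvec (k u)) - 0) \<bullet> (X u (of_real t) - c))) (at u)"
      by (intro has_derivative_inner has_derivative_diff X_deriv[OF u] has_derivative_const)
    have "((\<lambda>x. (X x (of_real t) - c) \<bullet> (X x (of_real t) - c)) has_derivative (\<lambda>v. 0)) (at u)"
    proof (rule has_derivative_transform_within_open[OF has_derivative_const open_S u])
      show "r\<^sup>2 = (X x (of_real t) - c) \<bullet> (X x (of_real t) - c)" if "x \<in> S" for x
        using c[OF that] by (simp add: dist_norm norm_minus_commute flip: power2_norm_eq_inner)
    qed
    from fun_cong[OF has_derivative_unique[OF d1 this], of "axis i 1"]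
    have "(X u (of_real t) - c) \<bullet> (E u (of_real t) *v axis i (of_real (k u $ i))) = 0"
      by (simp add: diag_axis_vector inner_commute)
    then have "a u \<bullet> axis i (of_real (k u $ i)) = 0"
      by (simp add: E_inner[OF u] flip: Ea[OF u])
    then show ?thesis using k_nonzero[OF u] by (simp add: inner_axis inner_complex_def)
  qed
  define a' where "a' u v = transpose (E u (- of_real t)) *v (E u (of_real t) *v (diag_matrix (cvec v) *v cvec (k u)) - 0)
     + transpose (E u (- of_real t) ** lax_form (R u) (- of_real t) v) *v (X u (of_real t) - c)" for u v
  have a_deriv: "(a has_derivative a' u) (at u)" if u: "u \<in> S" for u
    unfolding a_def a'_def
    by (intro bounded_bilinear.FDERIV[OF bounded_bilinear_matrix_vector] has_derivative_diff X_deriv[OF u] has_derivative_const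
        bounded_linear.has_derivative[OF bounded_linear_transpose E_deriv[OF u]])
  have a'_ones: "a' u (\<chi> i. 1) = cvec (k u) - (\<i> * of_real t) *s a u" if u: "u \<in> S" for u
  proof -
    have "lax_form (R u) (- of_real t) (\<chi> i. 1) = cscale (- (\<i> * of_real t)) (mat 1)"
      by (simp add: lax_form_def comm_form_ones diag_matrix_ones)
    then have "a' u (\<chi> i. 1) = cvec (k u) + (- (\<i> * of_real t)) *s a u"
      by (simp add: a'_def diag_matrix_ones matrix_vector_mul_assoc E_transpose'[OF u] cscale_mult_right
          transpose_cscale cscale_vector a_def)
    then show ?thesis by (simp add: vec_eq_iff)
  qed
  have Im_a: "t * Im (a u $ i) = - k u $ i" if u: "u \<in> S" for u i
  proof -
    have bl: "bounded_linear (\<lambda>x :: complex^'n. Re (x $ i))"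
      by (intro bounded_linear_compose[OF bounded_linear_Re] bounded_linear_vec_nth)
    have "((\<lambda>x. Re (a x $ i)) has_derivative (\<lambda>v. 0)) (at u)"
      by (rule has_derivative_transform_within_open[OF has_derivative_const open_S u]) (simp add: Re_a)
    from fun_cong[OF has_derivative_unique[OF bounded_linear.has_derivative[OF bl a_deriv[OF u]] this], of "\<chi> i. 1"]
    show ?thesis by (simp add: a'_ones[OF u] cvec_def)
  qed
  (* as a is imaginary, its imaginary part determines it *)
  have a_eq: "(\<i> * of_real t) *s a u = cvec (k u)" if u: "u \<in> S" for u
    using Re_a[OF u] Im_a[OF u] by (simp add: vec_eq_iff complex_eq_iff cvec_def)
  show ?thesis
    unfolding del_invariant_def
  proof (intro ballI allI)
    fix u i assume u: "u \<in> S"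
    have "((\<lambda>x. cvec (k x)) has_derivative (\<lambda>v. (\<i> * of_real t) *s a' u v)) (at u)"
      by (rule has_derivative_transform_within_open[OF bounded_linear.has_derivative[OF bounded_linear_scale a_deriv[OF u]] open_S u])
        (simp add: a_eq)
    from fun_cong[OF has_derivative_unique[OF this bounded_linear.has_derivative[OF bounded_linear_cvec k_deriv[OF u]]], of "\<chi> i. 1"]
    have "cvec (frechet_derivative k (at u) (\<chi> i. 1)) = 0"
      by (simp add: a'_ones[OF u] a_eq[OF u])
    then have "frechet_derivative k (at u) (\<chi> i. 1) $ i = 0"
      by (simp add: cvec_def vec_eq_iff)
    then show "(\<Sum>j\<in>UNIV. partial j (\<lambda>x. k x $ i) u) = 0"
      by (simp add: k_deriv_partials[OF u])
  qed
qed

end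

section \<open>Linear equations and differential equations with parameters\<close>

text \<open>A product of a differentiable function and a continuous one, both vanishing at the point, is of smaller than linear
  order.\<close>

lemma bounded_bilinear_has_derivative_zero:
  assumes b: "bounded_bilinear b" and f: "(f has_derivative f') (at u)" "f u = 0"
    and g: "isCont g u" "g u = 0"
  shows "((\<lambda>x. b (f x) (g x)) has_derivative (\<lambda>v. 0)) (at u)"
proof -
  obtain B where B: "B > 0" "\<And>x y. norm (b x y) \<le> norm x * norm y * B"
    using bounded_bilinear.pos_bounded[OF b] by blast
  obtain L where L: "\<And>v. norm (f' v) \<le> norm v * L"
    using bounded_linear.bounded[OF has_derivative_bounded_linear[OF f(1)]] by blast
  let ?r = "\<lambda>y. norm (f y - f u - f' (y - u)) / norm (y - u)"
  show ?thesis
  proof (rule has_derivativeI_sandwich[where e=1 and H="\<lambda>y. (?r y + L) * norm (g y) * B"])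
    fix y assume y: "y \<in> UNIV" "y \<noteq> u" "dist y u < 1"
    have "norm (f y) \<le> norm (f y - f u - f' (y - u)) + norm (f' (y - u))"
      using norm_triangle_ineq[of "f y - f u - f' (y - u)" "f' (y - u)"] f(2) by simp
    also have "\<dots> \<le> (?r y + L) * norm (y - u)" using y L[of "y - u"] by (simp add: field_simps)
    finally have "norm (f y) / norm (y - u) \<le> ?r y + L"
      using y by (subst pos_divide_le_eq) auto
    then have "norm (f y) / norm (y - u) * (norm (g y) * B) \<le> (?r y + L) * (norm (g y) * B)"
      using B by (intro mult_right_mono) auto
    moreover have "norm (b (f y) (g y)) / norm (y - u) \<le> norm (f y) / norm (y - u) * (norm (g y) * B)"
      using B(2)[of "f y" "g y"] by (simp add: divide_right_mono mult.assoc)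
    ultimately show "norm (b (f y) (g y) - b (f u) (g u) - 0) / norm (y - u) \<le> (?r y + L) * norm (g y) * B"
      using f g bounded_bilinear.zero_left[OF b] by (simp add: mult.assoc)
  next
    have "(?r \<longlongrightarrow> 0) (at u)"
      using f(1) by (simp add: has_derivative_iff_norm)
    moreover have "((\<lambda>y. norm (g y)) \<longlongrightarrow> 0) (at u)"
      using g by (metis isCont_def tendsto_norm norm_zero)
    ultimately have "((\<lambda>y. (?r y + L) * norm (g y) * B) \<longlongrightarrow> (0 + L) * 0 * B) (at u)"
      by (intro tendsto_intros)
    then show "((\<lambda>y. (?r y + L) * norm (g y) * B) \<longlongrightarrow> 0) (at u within UNIV)" by simp
  qed auto
qed

text \<open>The solution \<open>Q\<close> of \<open>H Q = M\<close> inherits differentiability from \<open>H\<close> and \<open>M\<close>. With the left inverse \<open>L\<close> of \<open>H u\<close> one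
  has \<open>Q x = L M x - L (H x - H u) (Q x)\<close>. Near \<open>u\<close> this bounds \<open>Q\<close>, then makes it continuous, and finally differentiable,
  because \<open>(H x - H u) (Q x - Q u)\<close> is of smaller than linear order.\<close>

lemma linear_solution_has_derivative:
  fixes H Mt Q :: "'a::real_normed_vector \<Rightarrow> complex^'m::finite^'m"
  assumes U: "open U" "u \<in> U" and eq: "\<And>x. x \<in> U \<Longrightarrow> H x ** Q x = Mt x"
    and H: "(H has_derivative H') (at u)" and Mt: "(Mt has_derivative M') (at u)"
    and L: "L ** H u = mat 1"
  shows "(Q has_derivative (\<lambda>v. L ** (M' v - H' v ** Q u))) (at u)"
proof -
  note bb = bounded_bilinear_matrix_matrix
  obtain B where B: "B > 0" "\<And>(x :: complex^'m^'m) (y :: complex^'m^'m). norm (x ** y) \<le> norm x * norm y * B"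
    using bounded_bilinear.pos_bounded[OF bb] by blast
  have Qx: "Q x = L ** Mt x - L ** ((H x - H u) ** Q x)" if "x \<in> U" for x
    using eq[OF that] L by (simp add: mat_distribs)
  have cont: "isCont Mt u" "isCont H u" using H Mt has_derivative_continuous by blast+
  have inU: "eventually (\<lambda>x. x \<in> U) (at u)"
    using U eventually_at_topological by blast
  have Hlim: "((\<lambda>x. norm (H x - H u)) \<longlongrightarrow> 0) (at u)"
    using cont(2) unfolding isCont_def by (metis LIM_zero_iff tendsto_norm_zero)
  have "((\<lambda>x. norm L * norm (H x - H u) * (B * B)) \<longlongrightarrow> norm L * 0 * (B * B)) (at u)"
    by (intro tendsto_intros Hlim)
  then have "eventually (\<lambda>x. norm L * norm (H x - H u) * (B * B) < 1 / 2) (at u)"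
    by (rule order_tendstoD) simp
  moreover have "((\<lambda>x. norm (L ** Mt x)) \<longlongrightarrow> norm (L ** Mt u)) (at u)"
    using cont(1) unfolding isCont_def
    by (intro tendsto_norm bounded_bilinear.tendsto[OF bb] tendsto_const)
  then have "eventually (\<lambda>x. norm (L ** Mt x) < norm (L ** Mt u) + 1) (at u)"
    by (rule order_tendstoD) simp
  ultimately have Qb: "eventually (\<lambda>x. norm (Q x) \<le> 2 * (norm (L ** Mt u) + 1)) (at u)"
    using inU
  proof eventually_elim
    case (elim x)
    have "norm (L ** ((H x - H u) ** Q x)) \<le> norm L * (norm (H x - H u) * norm (Q x) * B) * B"
      using B by (meson mult_left_mono mult_right_mono norm_ge_zero order_trans less_imp_le)
    also have "\<dots> = (norm L * norm (H x - H u) * (B * B)) * norm (Q x)" by simp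
    also have "\<dots> \<le> 1 / 2 * norm (Q x)" using elim by (intro mult_right_mono) auto
    finally have "norm (Q x) \<le> norm (L ** Mt x) + 1 / 2 * norm (Q x)"
      using norm_triangle_ineq4[of "L ** Mt x" "L ** ((H x - H u) ** Q x)"] Qx[OF elim(3)] by simp
    then show ?case using elim by simp
  qed
  have small: "((\<lambda>x. L ** ((H x - H u) ** Q x)) \<longlongrightarrow> 0) (at u)"
  proof (rule bounded_bilinear.tendsto_right_zero[OF bb])
    show "((\<lambda>x. (H x - H u) ** Q x) \<longlongrightarrow> 0) (at u)"
    proof (rule Lim_null_comparison)
      show "eventually (\<lambda>x. norm ((H x - H u) ** Q x) \<le> norm (H x - H u) * (2 * (norm (L ** Mt u) + 1)) * B) (at u)"
        using Qb
      proof eventually_elim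
        case (elim x)
        have "norm (H x - H u) * norm (Q x) * B \<le> norm (H x - H u) * (2 * (norm (L ** Mt u) + 1)) * B"
          using elim B by (intro mult_right_mono mult_left_mono) auto
        then show ?case using B(2)[of "H x - H u" "Q x"] by linarith
      qed
      have "((\<lambda>x. norm (H x - H u) * (2 * (norm (L ** Mt u) + 1)) * B) \<longlongrightarrow> 0 * (2 * (norm (L ** Mt u) + 1)) * B) (at u)"
        by (intro tendsto_intros Hlim)
      then show "((\<lambda>x. norm (H x - H u) * (2 * (norm (L ** Mt u) + 1)) * B) \<longlongrightarrow> 0) (at u)" by simp
    qed
  qed
  have Qu: "Q u = L ** Mt u" using Qx[OF U(2)] by simp
  have "((\<lambda>x. L ** Mt x - L ** ((H x - H u) ** Q x)) \<longlongrightarrow> L ** Mt u - 0) (at u)"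
    using cont(1) unfolding isCont_def
    by (intro tendsto_diff small bounded_bilinear.tendsto[OF bb] tendsto_const)
  moreover have "eventually (\<lambda>x. L ** Mt x - L ** ((H x - H u) ** Q x) = Q x) (at u)"
    using inU by eventually_elim (rule Qx[symmetric])
  ultimately have "(Q \<longlongrightarrow> Q u) (at u)"
    unfolding Qu by (simp add: tendsto_cong)
  then have Qcont: "isCont Q u" by (simp add: isCont_def)
  (* Q is the function differentiated next: the last correction term has derivative zero *)
  have "((\<lambda>x. (H x - H u) ** (Q x - Q u)) has_derivative (\<lambda>v. 0)) (at u)"
  proof (rule bounded_bilinear_has_derivative_zero[OF bb])
    show "((\<lambda>x. H x - H u) has_derivative (\<lambda>v. H' v - 0)) (at u)"
      by (intro has_derivative_diff H has_derivative_const)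
    show "isCont (\<lambda>x. Q x - Q u) u" using Qcont by (intro continuous_intros)
  qed auto
  then have "((\<lambda>x. L ** Mt x - L ** (H x ** Q u) + Q u - L ** ((H x - H u) ** (Q x - Q u))) has_derivative
      (\<lambda>v. (L ** M' v - L ** (H' v ** Q u)) + 0 - L ** 0)) (at u)"
    using bounded_bilinear.bounded_linear_right[OF bb] bounded_bilinear.bounded_linear_left[OF bb]
    by (intro has_derivative_add has_derivative_diff has_derivative_const
        bounded_linear.has_derivative[OF bounded_bilinear.bounded_linear_right[OF bb]]
        bounded_linear.has_derivative[OF bounded_bilinear.bounded_linear_left[OF bb]] H Mt)
  then have "((\<lambda>x. L ** Mt x - L ** (H x ** Q u) + Q u - L ** ((H x - H u) ** (Q x - Q u))) has_derivative
      (\<lambda>v. L ** (M' v - H' v ** Q u))) (at u)"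
    by (simp add: matrix_diff_ldistrib)
  then show ?thesis
  proof (rule has_derivative_transform_within_open[OF _ U])
    fix x assume "x \<in> U"
    have "L ** (H u ** A) = A" for A :: "complex^'m^'m" using L by (simp add: matrix_mul_assoc)
    then show "L ** Mt x - L ** (H x ** Q u) + Q u - L ** ((H x - H u) ** (Q x - Q u)) = Q x"
      unfolding Qx[OF \<open>x \<in> U\<close>, symmetric] using Qx[OF \<open>x \<in> U\<close>]
      by (simp add: matrix_diff_ldistrib matrix_diff_rdistrib)
  qed
qed

text \<open>The function \<open>exp (- 2 C s) |f s|\<^sup>2\<close> is non-increasing.\<close>

lemma gronwall_unit:
  fixes f :: "real \<Rightarrow> 'b::real_inner"
  assumes d: "\<And>s. 0 \<le> s \<Longrightarrow> s \<le> 1 \<Longrightarrow> (f has_vector_derivative f' s) (at s)"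
    and le: "\<And>s. 0 \<le> s \<Longrightarrow> s \<le> 1 \<Longrightarrow> norm (f' s) \<le> C * norm (f s)"
  shows "norm (f 1) \<le> exp C * norm (f 0)"
proof -
  define N where "N s = exp (- (2 * C * s)) * (f s \<bullet> f s)" for s
  have "N 1 \<le> N 0"
  proof (rule DERIV_nonpos_imp_nonincreasing[of 0 1 N])
    fix s :: real assume s: "0 \<le> s" "s \<le> 1"
    have "((\<lambda>s. f s \<bullet> f s) has_vector_derivative (f s \<bullet> f' s + f' s \<bullet> f s)) (at s)"
      by (rule bounded_bilinear.has_vector_derivative[OF bounded_bilinear_inner d[OF s] d[OF s]])
    then have "((\<lambda>s. f s \<bullet> f s) has_real_derivative 2 * (f s \<bullet> f' s)) (at s)"
      by (simp add: has_real_derivative_iff_has_vector_derivative inner_commute)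
    then have D: "(N has_real_derivative (exp (- (2 * C * s)) * (2 * (f s \<bullet> f' s) - 2 * C * (f s \<bullet> f s)))) (at s)"
      unfolding N_def by (auto intro!: derivative_eq_intros simp: algebra_simps)
    have "f s \<bullet> f' s \<le> norm (f s) * norm (f' s)" by (rule norm_cauchy_schwarz)
    also have "\<dots> \<le> norm (f s) * (C * norm (f s))" by (intro mult_left_mono le s) simp
    also have "\<dots> = C * (f s \<bullet> f s)" by (simp add: power2_norm_eq_inner[symmetric] power2_eq_square)
    finally have "exp (- (2 * C * s)) * (2 * (f s \<bullet> f' s) - 2 * C * (f s \<bullet> f s)) \<le> 0"
      by (intro mult_nonneg_nonpos) auto
    with D show "\<exists>y. (N has_real_derivative y) (at s) \<and> y \<le> 0" by blast
  qed simp
  then have "exp (- C) * exp (- C) * (norm (f 1) * norm (f 1)) \<le> norm (f 0) * norm (f 0)"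
    by (simp add: N_def power2_norm_eq_inner[symmetric] power2_eq_square mult_exp_exp)
  then have "(exp (- C) * norm (f 1))\<^sup>2 \<le> (norm (f 0))\<^sup>2"
    by (simp add: power2_eq_square ac_simps)
  then have "exp (- C) * norm (f 1) \<le> norm (f 0)"
    by (rule power2_le_imp_le) simp
  then show ?thesis by (simp add: exp_minus field_simps)
qed

text \<open>The difference quotient of \<open>f\<close> at the centre is holomorphic, and on the circle it is at most \<open>2 C / r\<close>; the maximum
  principle carries this bound inside.\<close>

lemma holomorphic_lipschitz_center:
  assumes f: "f holomorphic_on UNIV" and r: "r > 0" and b: "\<And>z. z \<in> sphere a r \<Longrightarrow> cmod (f z) \<le> C"
    and z: "z \<in> cball a r"
  shows "cmod (f z - f a) \<le> 2 * C / r * cmod (z - a)"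
proof -
  define q where "q w = (if w = a then deriv f a else (f w - f a) / (w - a))" for w
  have "cmod (f a) \<le> C"
    by (rule maximum_modulus_frontier[of f "cball a r"])
      (use f r b in \<open>auto simp: sphere_def intro: holomorphic_on_subset holomorphic_on_imp_continuous_on\<close>)
  have q: "q holomorphic_on UNIV"
    unfolding q_def by (rule pole_lemma[OF f]) simp
  have "cmod (q z) \<le> 2 * C / r"
  proof (rule maximum_modulus_frontier[of q "cball a r"])
    show "q holomorphic_on interior (cball a r)" "continuous_on (closure (cball a r)) q"
      using q holomorphic_on_imp_continuous_on[OF q] by (auto intro: holomorphic_on_subset continuous_on_subset)
    show "z \<in> cball a r" using z by auto
    fix w assume "w \<in> frontier (cball a r)"
    then have w: "dist a w = r" using r by (simp add: sphere_def)
    have "cmod (f w - f a) \<le> 2 * C"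
      using norm_triangle_ineq4[of "f w" "f a"] b[of w] w \<open>cmod (f a) \<le> C\<close> by (simp add: sphere_def)
    then show "cmod (q w) \<le> 2 * C / r"
      using w r by (auto simp: q_def norm_divide dist_norm norm_minus_commute divide_right_mono)
  qed auto
  from mult_right_mono[OF this, of "cmod (z - a)"] have "cmod (q z * (z - a)) \<le> 2 * C / r * cmod (z - a)"
    by (simp add: norm_mult)
  moreover have "f z - f a = q z * (z - a)" by (simp add: q_def)
  ultimately show ?thesis by simp
qed

text \<open>A family of solutions that is holomorphic in the parameter and solves the differential equation for all parameters
  but one near \<open>a\<close> also solves it at \<open>a\<close>. A bound on a circle around \<open>a\<close> that is uniform in \<open>x\<close> makes both the solutions and
  their derivatives converge uniformly as the parameter tends to \<open>a\<close>.\<close>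

lemma has_derivative_fill:
  fixes f :: "'a::real_normed_vector \<Rightarrow> complex \<Rightarrow> complex^'m::finite^'m"
  assumes S: "open S" "convex S" "u \<in> S" and r: "r > 0"
    and hol: "\<And>x i j. x \<in> S \<Longrightarrow> (\<lambda>z. f x z $ i $ j) holomorphic_on UNIV"
    and der: "\<And>x z. x \<in> S \<Longrightarrow> z \<in> ball a r \<Longrightarrow> z \<noteq> a \<Longrightarrow>
      ((\<lambda>x. f x z) has_derivative (\<lambda>v. f x z ** (cscale (\<i> * z) (D v) + K x v))) (at x)"
    and bound: "\<And>x z. x \<in> S \<Longrightarrow> z \<in> sphere a r \<Longrightarrow> norm (f x z) \<le> C"
    and CD: "CD \<ge> 0" and CK: "CK \<ge> 0"
    and D: "\<And>v. norm (D v) \<le> CD * norm v" and K: "\<And>x v. x \<in> S \<Longrightarrow> norm (K x v) \<le> CK * norm v"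
  shows "((\<lambda>x. f x a) has_derivative (\<lambda>v. f u a ** (cscale (\<i> * a) (D v) + K u v))) (at u)"
proof -
  note bb = bounded_bilinear_matrix_matrix
  obtain B where B: "B > 0" "\<And>(x :: complex^'m^'m) (y :: complex^'m^'m). norm (x ** y) \<le> norm x * norm y * B"
    using bounded_bilinear.pos_bounded[OF bb] by blast
  define N where "N = real CARD('m) * (real CARD('m) * (2 * C / r))"
  have C0: "C \<ge> 0"
    using order_trans[OF norm_ge_zero bound[OF S(3), of "a + of_real r"]] r by (simp add: dist_norm)
  have N0: "N \<ge> 0" using C0 r by (simp add: N_def)
  have lip: "norm (f x z - f x a) \<le> N * cmod (z - a)" if x: "x \<in> S" and z: "z \<in> cball a r" for x z
  proof -
    have "cmod ((f x z - f x a) $ i $ j) \<le> 2 * C / r * cmod (z - a)" for i j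
      using holomorphic_lipschitz_center[OF hol[OF x] r order_trans[OF entry_norm_le bound[OF x]] z, of i j] by simp
    from matrix_norm_entries[OF this] show ?thesis by (simp add: N_def ac_simps)
  qed
  have fa: "norm (f x a) \<le> C + N * r" if x: "x \<in> S" for x
  proof -
    let ?z = "a + of_real r"
    have z: "?z \<in> cball a r" "?z \<in> sphere a r" "cmod (?z - a) = r" using r by (auto simp: dist_norm)
    have "norm (f x a) \<le> norm (f x ?z) + norm (f x ?z - f x a)"
      using norm_triangle_ineq4[of "f x ?z" "f x ?z - f x a"] by simp
    then show ?thesis using bound[OF x z(2)] lip[OF x z(1)] z(3) by simp
  qed
  (* parameters different from a that converge to it *)
  define w where "w n = a + of_real (r / 2 * inverse (real (Suc n)))" for n
  have w_a: "cmod (w n - a) = r / 2 * inverse (real (Suc n))" for n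
    using r by (simp only: w_def add_diff_cancel_left' norm_of_real) simp
  have w_small: "r / 2 * inverse (real (Suc n)) \<le> r / 2" for n
    using r by (simp add: field_simps)
  have w_cball: "w n \<in> ball a r" "w n \<noteq> a" for n
  proof -
    have "0 < cmod (w n - a)" "cmod (w n - a) < r" unfolding w_a using w_small[of n] r by (simp, linarith)
    then show "w n \<in> ball a r" "w n \<noteq> a" by (auto simp: dist_norm norm_minus_commute)
  qed
  have w0: "(\<lambda>n. cmod (w n - a)) \<longlonglongrightarrow> 0"
    unfolding w_a using tendsto_mult[OF tendsto_const LIMSEQ_inverse_real_of_nat, of "r / 2"] by simp
  have lim_f: "(\<lambda>n. f x (w n)) \<longlonglongrightarrow> f x a" if x: "x \<in> S" for x
  proof (rule LIM_zero_cancel, rule Lim_null_comparison)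
    show "eventually (\<lambda>n. norm (f x (w n) - f x a) \<le> N * cmod (w n - a)) sequentially"
      using w_cball(1) by (intro always_eventually allI lip[OF x]) (simp add: less_imp_le)
    show "(\<lambda>n. N * cmod (w n - a)) \<longlonglongrightarrow> 0"
      using tendsto_mult[OF tendsto_const w0, of N] by simp
  qed
  define T where "T x z v = cscale (\<i> * z) (D v) + K x v" for x z v
  have T_bound: "norm (T x z v) \<le> ((cmod a + r) * CD + CK) * norm v" if x: "x \<in> S" and z: "z \<in> cball a r" for x z v
  proof -
    have "cmod z \<le> cmod a + r" using z norm_triangle_ineq[of a "z - a"] by (simp add: dist_norm norm_minus_commute)
    then have "cmod z * norm (D v) \<le> (cmod a + r) * (CD * norm v)"
      using D[of v] r by (intro mult_mono) auto
    then show ?thesis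
      using norm_triangle_ineq[of "cscale (\<i> * z) (D v)" "K x v"] K[OF x, of v]
      by (simp add: T_def norm_cscale norm_mult algebra_simps)
  qed
  have T_diff: "norm (T x z v - T x a v) \<le> cmod (z - a) * (CD * norm v)" for x z v
  proof -
    have "T x z v - T x a v = cscale (\<i> * (z - a)) (D v)"
      by (simp add: T_def vec_eq_iff cscale_def algebra_simps)
    then show ?thesis using mult_left_mono[OF D[of v], of "cmod (z - a)"] by (simp add: norm_cscale norm_mult)
  qed
  define M where "M = N * ((cmod a + r) * CD + CK) * B + (C + N * r) * CD * B"
  have main: "norm (f x z ** T x z v - f x a ** T x a v) \<le> cmod (z - a) * M * norm v"
    if x: "x \<in> S" and z: "z \<in> cball a r" for x z v
  proof -
    have "f x z ** T x z v - f x a ** T x a v = (f x z - f x a) ** T x z v + f x a ** (T x z v - T x a v)"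
      by (simp add: mat_distribs)
    then have "norm (f x z ** T x z v - f x a ** T x a v) \<le>
        norm (f x z - f x a) * norm (T x z v) * B + norm (f x a) * norm (T x z v - T x a v) * B"
      using norm_triangle_mono[OF B(2) B(2)] by simp
    also have "\<dots> \<le> (N * cmod (z - a)) * (((cmod a + r) * CD + CK) * norm v) * B
        + (C + N * r) * (cmod (z - a) * (CD * norm v)) * B"
      using B(1) lip[OF x z] T_bound[OF x z] fa[OF x] T_diff N0 C0 r CD CK
      by (intro add_mono mult_right_mono mult_mono) auto
    also have "\<dots> = cmod (z - a) * M * norm v" by (simp add: M_def algebra_simps)
    finally show ?thesis .
  qed
  have "\<exists>g. \<forall>x\<in>S. (\<lambda>n. f x (w n)) \<longlonglongrightarrow> g x \<and> (g has_derivative (\<lambda>v. f x a ** T x a v)) (at x within S)"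
  proof (rule has_derivative_sequence[where f="\<lambda>n x. f x (w n)", OF S(2) _ _ S(3) lim_f[OF S(3)]])
    show "((\<lambda>x. f x (w n)) has_derivative (\<lambda>v. f x (w n) ** T x (w n) v)) (at x within S)" if "x \<in> S" for n x
      using der[OF that w_cball] unfolding T_def by (rule has_derivative_at_withinI)
    fix e :: real assume e: "e > 0"
    have "(\<lambda>n. cmod (w n - a) * M) \<longlonglongrightarrow> 0"
      using tendsto_mult[OF w0 tendsto_const, of M] by simp
    then have "eventually (\<lambda>n. cmod (w n - a) * M < e) sequentially" using e by (rule order_tendstoD)
    then show "eventually (\<lambda>n. \<forall>x\<in>S. \<forall>v. norm (f x (w n) ** T x (w n) v - f x a ** T x a v) \<le> e * norm v) sequentially"
    proof eventually_elim
      case (elim n)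
      show ?case
      proof (intro ballI allI)
        fix x v assume x: "x \<in> S"
        have "norm (f x (w n) ** T x (w n) v - f x a ** T x a v) \<le> cmod (w n - a) * M * norm v"
          using w_cball(1)[of n] by (intro main[OF x]) auto
        also have "\<dots> \<le> e * norm v" using elim by (intro mult_right_mono) auto
        finally show "norm (f x (w n) ** T x (w n) v - f x a ** T x a v) \<le> e * norm v" .
      qed
    qed
  qed
  then obtain g where g: "\<And>x. x \<in> S \<Longrightarrow> (\<lambda>n. f x (w n)) \<longlonglongrightarrow> g x"
    "\<And>x. x \<in> S \<Longrightarrow> (g has_derivative (\<lambda>v. f x a ** T x a v)) (at x within S)" by blast
  have "(g has_derivative (\<lambda>v. f u a ** T u a v)) (at u)"
    using g(2)[OF S(3)] at_within_open[OF S(3) S(1)] by simp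
  then show ?thesis
    unfolding T_def
    by (rule has_derivative_transform_within_open[OF _ S(1,3)]) (use LIMSEQ_unique[OF g(1) lim_f] in auto)
qed

section \<open>Dressing with two simple poles\<close>

text \<open>The gauge identity of dressing. Here \<open>\<zeta> = \<i>z\<close>, the second summand on the left is \<open>w\<close> times the derivative of \<open>Q\<close>, and
  the factor \<open>1 + w Q\<close> transforms the form \<open>\<zeta> D + K\<close> into a form with the same leading term. The hypothesis on \<open>w\<close> says that
  \<open>1 + w\<close> is \<open>(z + \<i>\<alpha>) / (z - \<i>\<alpha>)\<close> for \<open>a = \<alpha>\<close>.\<close>

lemma dressing_identity:
  fixes D K Q :: "complex^'m::finite^'m"
  assumes Q: "Q ** Q = Q" and w: "w * (\<zeta> + a) = - 2 * a"
  shows "(cscale \<zeta> D + K) ** (mat 1 + cscale w Q)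
      + cscale w (Q ** (cscale a D + K) ** (mat 1 - Q) - (mat 1 - Q) ** (cscale (- a) D + K) ** Q)
    = (mat 1 + cscale w Q) ** (cscale \<zeta> D + K - cscale (2 * a) (D ** Q - Q ** D))"
proof -
  have Q': "A ** Q ** Q = A ** Q" for A :: "complex^'m^'m" by (simp add: Q flip: matrix_mul_assoc)
  show ?thesis
    apply (simp add: mat_distribs Q Q')
    apply (simp add: vec_eq_iff cscale_def)
    using w by algebra
qed

lemma holomorphic_matrix_continuous:
  fixes f :: "complex \<Rightarrow> complex^'m::finite^'k::finite"
  assumes "\<And>i j. (\<lambda>z. f z $ i $ j) holomorphic_on UNIV" shows "continuous_on A f"
proof -
  have "isCont f a" for a
  proof -
    have "isCont (\<lambda>z. f z $ i $ j) a" for i j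
      using holomorphic_on_imp_continuous_on[OF assms] continuous_on_eq_continuous_at[of UNIV] by auto
    then show ?thesis unfolding isCont_def by (intro vec_tendstoI) auto
  qed
  then show ?thesis by (simp add: continuous_at_imp_continuous_on)
qed

lemma holomorphic_matrix_sandwich:
  fixes f :: "complex \<Rightarrow> complex^'m::finite^'k::finite"
  assumes "\<And>i j. (\<lambda>z. f z $ i $ j) holomorphic_on UNIV"
  shows "(\<lambda>z. (A ** f z ** B) $ i $ j) holomorphic_on UNIV"
  unfolding matrix_matrix_mult_def by (auto intro!: holomorphic_intros assms)

text \<open>The quotient \<open>f z / (z - a)\<close>, continued holomorphically to \<open>a\<close> when \<open>f a = 0\<close>.\<close>

definition divided :: "complex \<Rightarrow> (complex \<Rightarrow> complex^'m^'k) \<Rightarrow> complex \<Rightarrow> complex^'m^'k" where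
  "divided a f z = (\<chi> i j. if z = a then deriv (\<lambda>z. f z $ i $ j) a else f z $ i $ j / (z - a))"

lemma divided_eq: "z \<noteq> a \<Longrightarrow> divided a f z = cscale (1 / (z - a)) (f z)"
  by (simp add: divided_def cscale_def)

lemma divided_holomorphic:
  assumes "\<And>i j. (\<lambda>z. f z $ i $ j) holomorphic_on UNIV" "f a = 0"
  shows "(\<lambda>z. divided a f z $ i $ j) holomorphic_on UNIV"
  using pole_lemma[OF assms(1), of a i j] by (simp add: divided_def assms(2) cong: if_cong)

text \<open>Dressing of a solution \<open>F\<close> of \<open>F\<^sup>-\<^sup>1 dF = \<i>zD + K\<close> by a rational factor with poles at \<open>\<plusminus> \<i>\<alpha>\<close>. The last two
  assumptions say that \<open>Q u\<close> is the (possibly oblique) projection onto \<open>F (\<i>\<alpha>)\<^sup>-\<^sup>1 (Im P)\<close> along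
  \<open>F (- \<i>\<alpha>)\<^sup>-\<^sup>1 (ker P)\<close>: multiplying by \<open>1 - P\<close> and by \<open>P\<close> one gets \<open>(1 - P) F (\<i>\<alpha>) Q = 0\<close> and
  \<open>P F (- \<i>\<alpha>) (1 - Q) = 0\<close>.\<close>

locale two_pole_dressing =
  fixes S :: "(real^'n::finite) set" and D :: "real^'n \<Rightarrow> complex^'m::finite^'m" and K :: "real^'n \<Rightarrow> real^'n \<Rightarrow> complex^'m^'m"
    and F :: "real^'n \<Rightarrow> complex \<Rightarrow> complex^'m^'m" and P :: "complex^'m^'m" and \<alpha> :: real
    and Q :: "real^'n \<Rightarrow> complex^'m^'m"
  assumes open_S: "open S" and \<alpha>: "\<alpha> \<noteq> 0"
    and D_linear: "bounded_linear D" and K_linear: "u \<in> S \<Longrightarrow> bounded_linear (K u)"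
    and K_cont: "continuous_on S (\<lambda>u. K u v)"
    and F_deriv: "u \<in> S \<Longrightarrow> ((\<lambda>x. F x z) has_derivative (\<lambda>v. F u z ** (cscale (\<i> * z) (D v) + K u v))) (at u)"
    and F_hol: "u \<in> S \<Longrightarrow> (\<lambda>z. F u z $ i $ j) holomorphic_on UNIV"
    and P_proj: "P ** P = P"
    and H_inv: "u \<in> S \<Longrightarrow> invertible ((mat 1 - P) ** F u (\<i> * \<alpha>) + P ** F u (- \<i> * \<alpha>))"
    and HQ: "u \<in> S \<Longrightarrow> ((mat 1 - P) ** F u (\<i> * \<alpha>) + P ** F u (- \<i> * \<alpha>)) ** Q u = P ** F u (- \<i> * \<alpha>)"
begin

definition "H u = (mat 1 - P) ** F u (\<i> * \<alpha>) + P ** F u (- \<i> * \<alpha>)"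

lemmas P_left = projection_absorb[OF P_proj]

lemma H_split: "(mat 1 - P) ** H u = (mat 1 - P) ** F u (\<i> * \<alpha>)" "P ** H u = P ** F u (- \<i> * \<alpha>)"
  by (simp_all add: H_def matrix_add_ldistrib P_left)

text \<open>These two equations say that the residues of the dressed solution at its two possible poles vanish.\<close>

lemma kernel_plus: "u \<in> S \<Longrightarrow> (mat 1 - P) ** F u (\<i> * \<alpha>) ** Q u = 0"
  by (metis H_split(1) HQ H_def P_left(2) matrix_mul_assoc)

lemma kernel_minus: "u \<in> S \<Longrightarrow> P ** F u (- \<i> * \<alpha>) ** Q u = P ** F u (- \<i> * \<alpha>)"
  by (metis H_split(2) HQ H_def P_left(1) matrix_mul_assoc)

lemma Q_idem:
  assumes u: "u \<in> S" shows "Q u ** Q u = Q u"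
proof -
  obtain L where L: "L ** H u = mat 1" using H_inv[OF u] by (auto simp: H_def invertible_def)
  have "H u ** (Q u ** Q u) = (H u ** Q u) ** Q u" by (simp add: matrix_mul_assoc)
  also have "\<dots> = H u ** Q u" using HQ[OF u] kernel_minus[OF u] by (simp add: H_def)
  finally have "L ** (H u ** (Q u ** Q u)) = L ** (H u ** Q u)" by simp
  then show ?thesis by (simp add: matrix_mul_assoc L)
qed

text \<open>The derivative of \<open>Q\<close>: differentiating the two equations for its image and its kernel determines the block from the image
  to the kernel and the block from the kernel to the image, and the other two vanish as \<open>Q\<close> is idempotent.\<close>

definition "dQ u v = Q u ** (cscale (of_real \<alpha>) (D v) + K u v) ** (mat 1 - Q u)
    - (mat 1 - Q u) ** (cscale (- of_real \<alpha>) (D v) + K u v) ** Q u"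

lemma Q_deriv:
  assumes u: "u \<in> S" shows "(Q has_derivative dQ u) (at u)"
proof -
  obtain L where L: "L ** H u = mat 1" using H_inv[OF u] by (auto simp: H_def invertible_def)
  define \<theta>p where "\<theta>p v = cscale (- of_real \<alpha>) (D v) + K u v" for v
  define \<theta>m where "\<theta>m v = cscale \<alpha> (D v) + K u v" for v
  have Fp: "((\<lambda>x. F x (\<i> * \<alpha>)) has_derivative (\<lambda>v. F u (\<i> * \<alpha>) ** \<theta>p v)) (at u)"
    using F_deriv[OF u, of "\<i> * \<alpha>"] by (simp add: \<theta>p_def flip: mult.assoc)
  have Fm: "((\<lambda>x. F x (- \<i> * \<alpha>)) has_derivative (\<lambda>v. F u (- \<i> * \<alpha>) ** \<theta>m v)) (at u)"
    using F_deriv[OF u, of "- \<i> * \<alpha>"] by (simp add: \<theta>m_def flip: mult.assoc)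
  note lin = bounded_linear.has_derivative[OF bounded_bilinear.bounded_linear_right[OF bounded_bilinear_matrix_matrix]]
  have H': "(H has_derivative (\<lambda>v. (mat 1 - P) ** (F u (\<i> * \<alpha>) ** \<theta>p v) + P ** (F u (- \<i> * \<alpha>) ** \<theta>m v))) (at u)"
    unfolding H_def by (intro has_derivative_add lin Fp Fm)
  have M': "((\<lambda>x. P ** F x (- \<i> * \<alpha>)) has_derivative (\<lambda>v. P ** (F u (- \<i> * \<alpha>) ** \<theta>m v))) (at u)"
    by (intro lin Fm)
  have "(Q has_derivative (\<lambda>v. L ** (P ** (F u (- \<i> * \<alpha>) ** \<theta>m v) -
      ((mat 1 - P) ** (F u (\<i> * \<alpha>) ** \<theta>p v) + P ** (F u (- \<i> * \<alpha>) ** \<theta>m v)) ** Q u))) (at u)"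
    by (rule linear_solution_has_derivative[OF open_S u _ H' M' L]) (unfold H_def, rule HQ)
  moreover have "L ** (P ** (F u (- \<i> * \<alpha>) ** \<theta>m v) -
      ((mat 1 - P) ** (F u (\<i> * \<alpha>) ** \<theta>p v) + P ** (F u (- \<i> * \<alpha>) ** \<theta>m v)) ** Q u) = dQ u v" for v
  proof -
    have HQ1: "H u ** Q u = P ** F u (- \<i> * \<alpha>)" using HQ[OF u] by (simp add: H_def)
    have HQ2: "H u ** (mat 1 - Q u) = (mat 1 - P) ** F u (\<i> * \<alpha>)"
      unfolding matrix_diff_ldistrib HQ1 by (simp add: H_def)
    have "H u ** dQ u v = (H u ** Q u) ** \<theta>m v ** (mat 1 - Q u) - (H u ** (mat 1 - Q u)) ** \<theta>p v ** Q u"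
      by (simp only: dQ_def \<theta>m_def \<theta>p_def matrix_diff_ldistrib[of "H u" "_ ** _"] matrix_mul_assoc)
    also have "\<dots> = P ** (F u (- \<i> * \<alpha>) ** \<theta>m v) -
      ((mat 1 - P) ** (F u (\<i> * \<alpha>) ** \<theta>p v) + P ** (F u (- \<i> * \<alpha>) ** \<theta>m v)) ** Q u"
      unfolding HQ1 HQ2 by (simp add: mat_distribs)
    finally show ?thesis by (metis L matrix_mul_assoc matrix_mul_lid)
  qed
  ultimately show ?thesis by simp
qed

text \<open>The product \<open>((1 - P) + (z - \<i>\<alpha>) / (z + \<i>\<alpha>) P) F ((1 - Q) + (z + \<i>\<alpha>) / (z - \<i>\<alpha>) Q)\<close> in partial fractions, with
  the removable singularities at \<open>\<plusminus> \<i>\<alpha>\<close> filled in.\<close>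

definition "dressed u z = F u z
   + cscale (2 * \<i> * \<alpha>) (divided (\<i> * \<alpha>) (\<lambda>z. (mat 1 - P) ** F u z ** Q u) z)
   - cscale (2 * \<i> * \<alpha>) (divided (- \<i> * \<alpha>) (\<lambda>z. P ** F u z ** (mat 1 - Q u)) z)"

lemma dressed_eq:
  assumes z: "z \<noteq> \<i> * \<alpha>" "z \<noteq> - \<i> * \<alpha>"
  shows "dressed u z = (mat 1 + cscale (- 2 * \<i> * \<alpha> / (z + \<i> * \<alpha>)) P) ** F u z
      ** (mat 1 + cscale (2 * \<i> * \<alpha> / (z - \<i> * \<alpha>)) (Q u))"
proof -
  define w where "w = 2 * \<i> * \<alpha> / (z - \<i> * \<alpha>)"
  define w' where "w' = - 2 * \<i> * \<alpha> / (z + \<i> * \<alpha>)"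
  have "z - \<i> * \<alpha> \<noteq> 0" "z + \<i> * \<alpha> \<noteq> 0" using z by (auto simp: add_eq_0_iff)
  then have w: "w * w' = - w - w'" by (simp add: w_def w'_def divide_simps) (simp add: algebra_simps)
  have "dressed u z = F u z + cscale w ((mat 1 - P) ** F u z ** Q u) + cscale w' (P ** F u z ** (mat 1 - Q u))"
    using z by (simp add: dressed_def divided_eq cscale_cscale w_def w'_def) (simp add: vec_eq_iff cscale_def)
  also have "\<dots> = (mat 1 + cscale w' P) ** F u z ** (mat 1 + cscale w (Q u))"
    apply (simp add: mat_distribs)
    apply (simp add: vec_eq_iff cscale_def)
    using w by algebra
  finally show ?thesis by (simp add: w_def w'_def)
qed

lemma dressed_holomorphic:
  assumes u: "u \<in> S" shows "(\<lambda>z. dressed u z $ i $ j) holomorphic_on UNIV"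
proof -
  have "P ** F u (- \<i> * \<alpha>) ** (mat 1 - Q u) = 0" using kernel_minus[OF u] by (simp add: matrix_diff_ldistrib)
  then show ?thesis
    unfolding dressed_def using kernel_plus[OF u]
    by (auto simp: cscale_def intro!: holomorphic_intros F_hol[OF u] divided_holomorphic holomorphic_matrix_sandwich)
qed

definition "K' u v = K u v - cscale (2 * of_real \<alpha>) (D v ** Q u - Q u ** D v)"

lemma dressed_deriv_regular:
  assumes u: "u \<in> S" and z: "z \<noteq> \<i> * \<alpha>" "z \<noteq> - \<i> * \<alpha>"
  shows "((\<lambda>x. dressed x z) has_derivative (\<lambda>v. dressed u z ** (cscale (\<i> * z) (D v) + K' u v))) (at u)"
proof -
  define w where "w = 2 * \<i> * \<alpha> / (z - \<i> * \<alpha>)"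
  define G where "G = mat 1 + cscale (- 2 * \<i> * \<alpha> / (z + \<i> * \<alpha>)) P"
  have w: "w * (\<i> * z + of_real \<alpha>) = - 2 * of_real \<alpha>"
  proof -
    have "\<i> * z + \<alpha> = \<i> * (z - \<i> * \<alpha>)" by (simp add: algebra_simps)
    then show ?thesis using z by (simp add: w_def)
  qed
  note lin = bounded_linear.has_derivative[OF bounded_bilinear.bounded_linear_right[OF bounded_bilinear_matrix_matrix]]
  have "((\<lambda>x. (G ** F x z) ** (mat 1 + cscale w (Q x))) has_derivative
     (\<lambda>v. (G ** F u z) ** (0 + cscale w (dQ u v))
        + (G ** (F u z ** (cscale (\<i> * z) (D v) + K u v))) ** (mat 1 + cscale w (Q u)))) (at u)"
    by (intro bounded_bilinear.FDERIV[OF bounded_bilinear_matrix_matrix] lin F_deriv[OF u] has_derivative_add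
        has_derivative_const bounded_linear.has_derivative[OF bounded_linear_cscale] Q_deriv[OF u])
  moreover have "(G ** F u z) ** (0 + cscale w (dQ u v))
        + (G ** (F u z ** (cscale (\<i> * z) (D v) + K u v))) ** (mat 1 + cscale w (Q u))
      = ((G ** F u z) ** (mat 1 + cscale w (Q u))) ** (cscale (\<i> * z) (D v) + K' u v)" for v
  proof -
    have "(G ** F u z) ** (0 + cscale w (dQ u v))
        + (G ** (F u z ** (cscale (\<i> * z) (D v) + K u v))) ** (mat 1 + cscale w (Q u))
      = (G ** F u z) ** ((cscale (\<i> * z) (D v) + K u v) ** (mat 1 + cscale w (Q u)) + cscale w (dQ u v))"
      by (simp only: matrix_add_ldistrib[of "G ** F u z"] matrix_mul_assoc add.commute add_0_left add_0_right)
    also have "(cscale (\<i> * z) (D v) + K u v) ** (mat 1 + cscale w (Q u)) + cscale w (dQ u v)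
      = (mat 1 + cscale w (Q u)) ** (cscale (\<i> * z) (D v) + K' u v)"
      unfolding dQ_def K'_def add_diff_eq using dressing_identity[OF Q_idem[OF u] w] by simp
    finally show ?thesis by (simp only: matrix_mul_assoc)
  qed
  ultimately show ?thesis
    unfolding dressed_eq[OF z] G_def w_def by simp
qed

lemma K_bound:
  assumes C: "compact C" "C \<subseteq> S"
  shows "\<exists>B\<ge>0. \<forall>u\<in>C. \<forall>v. norm (K u v) \<le> B * norm v"
proof -
  have "\<exists>b. \<forall>u\<in>C. norm (K u (axis i 1)) \<le> b" for i
    using compact_imp_bounded[OF compact_continuous_image[OF continuous_on_subset[OF K_cont C(2)] C(1)], of "axis i 1"]
    unfolding bounded_iff by auto
  then obtain b where b: "\<And>u i. u \<in> C \<Longrightarrow> norm (K u (axis i 1)) \<le> b i" by metis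
  have "norm (K u v) \<le> (\<Sum>i\<in>UNIV. \<bar>b i\<bar>) * norm v" if u: "u \<in> C" for u v
  proof -
    have "linear (K u)" using K_linear C u by (auto intro: bounded_linear.linear)
    from linear_axis_sum[OF this, of v] have "norm (K u v) \<le> (\<Sum>i\<in>UNIV. norm (v $ i *\<^sub>R K u (axis i 1)))"
      by (metis norm_sum)
    also have "\<dots> \<le> (\<Sum>i\<in>UNIV. norm v * \<bar>b i\<bar>)"
    proof (rule sum_mono)
      fix i
      have "norm (K u (axis i 1)) \<le> \<bar>b i\<bar>" using b[OF u, of i] by linarith
      then show "norm (v $ i *\<^sub>R K u (axis i 1)) \<le> norm v * \<bar>b i\<bar>"
        using component_le_norm_cart[of v i] by (simp add: mult_mono)
    qed
    also have "\<dots> = (\<Sum>i\<in>UNIV. \<bar>b i\<bar>) * norm v" by (simp add: sum_distrib_left mult.commute)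
    finally show ?thesis .
  qed
  moreover have "(\<Sum>i\<in>UNIV. \<bar>b i\<bar>) \<ge> 0" by (simp add: sum_nonneg)
  ultimately show ?thesis by blast
qed

text \<open>By Gronwall along segments the growth of \<open>F\<close> in \<open>u\<close> is bounded uniformly for bounded parameters.\<close>

lemma F_bound:
  assumes r: "cball u0 r \<subseteq> S" "r > 0"
  shows "\<exists>C. \<forall>u\<in>cball u0 r. \<forall>z\<in>cball 0 \<rho>. norm (F u z) \<le> C"
proof -
  obtain B where B: "B > 0" "\<And>(x :: complex^'m^'m) (y :: complex^'m^'m). norm (x ** y) \<le> norm x * norm y * B"
    using bounded_bilinear.pos_bounded[OF bounded_bilinear_matrix_matrix] by blast
  obtain CD where CD: "CD > 0" "\<And>v. norm (D v) \<le> norm v * CD" using bounded_linear.pos_bounded[OF D_linear] by blast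
  obtain CK where CK: "CK \<ge> 0" "\<And>u v. u \<in> cball u0 r \<Longrightarrow> norm (K u v) \<le> CK * norm v"
    using K_bound[OF _ r(1)] by auto
  have u0: "u0 \<in> S" using r by auto
  have "bounded (F u0 ` cball 0 \<rho>)"
    by (intro compact_imp_bounded compact_continuous_image holomorphic_matrix_continuous F_hol[OF u0]) simp
  then obtain C0 where C0: "\<And>z. z \<in> cball 0 \<rho> \<Longrightarrow> norm (F u0 z) \<le> C0"
    unfolding bounded_iff by (metis imageI)
  define M where "M = (\<bar>\<rho>\<bar> * CD + CK) * r * B"
  have "norm (F u z) \<le> exp M * C0" if u: "u \<in> cball u0 r" and z: "z \<in> cball 0 \<rho>" for u z
  proof -
    define p where "p s = u0 + s *\<^sub>R (u - u0)" for s
    have p_in: "p s \<in> cball u0 r" if "0 \<le> s" "s \<le> 1" for s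
    proof -
      have "norm (s *\<^sub>R (u - u0)) \<le> 1 * norm (u - u0)" using that by (simp add: mult_left_le_one_le)
      then show ?thesis using u by (simp add: p_def dist_norm norm_minus_commute)
    qed
    have "norm (F (p 1) z) \<le> exp M * norm (F (p 0) z)"
    proof (rule gronwall_unit)
      fix s :: real assume s: "0 \<le> s" "s \<le> 1"
      let ?T = "cscale (\<i> * z) (D (u - u0)) + K (p s) (u - u0)"
      have pS: "p s \<in> S" using p_in[OF s] r by auto
      have "(p has_derivative (\<lambda>h. h *\<^sub>R (u - u0))) (at s)"
        unfolding p_def by (auto intro!: derivative_eq_intros)
      from diff_chain_at[OF this F_deriv[OF pS, of z]]
      have "((\<lambda>s. F (p s) z) has_derivative (\<lambda>h. F (p s) z ** (cscale (\<i> * z) (D (h *\<^sub>R (u - u0))) + K (p s) (h *\<^sub>R (u - u0))))) (at s)"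
        by (simp add: o_def)
      moreover have "F (p s) z ** (cscale (\<i> * z) (D (h *\<^sub>R (u - u0))) + K (p s) (h *\<^sub>R (u - u0))) = h *\<^sub>R (F (p s) z ** ?T)" for h
        by (simp add: linear_cmul[OF bounded_linear.linear[OF D_linear]] linear_cmul[OF bounded_linear.linear[OF K_linear[OF pS]]]
            bounded_bilinear.scaleR_right[OF bounded_bilinear_matrix_matrix, symmetric]
            linear_cmul[OF bounded_linear.linear[OF bounded_linear_cscale]] scaleR_add_right)
      ultimately show "((\<lambda>s. F (p s) z) has_vector_derivative F (p s) z ** ?T) (at s)"
        by (simp add: has_vector_derivative_def)
      have "norm ?T \<le> cmod z * (norm (u - u0) * CD) + CK * norm (u - u0)"
        using norm_triangle_ineq[of "cscale (\<i> * z) (D (u - u0))" "K (p s) (u - u0)"] CK(2)[OF p_in[OF s], of "u - u0"]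
          mult_left_mono[OF CD(2)[of "u - u0"], of "cmod z"] by (simp add: norm_cscale norm_mult)
      also have "\<dots> \<le> \<bar>\<rho>\<bar> * (r * CD) + CK * r"
        using u z CD CK r(2) by (intro add_mono mult_mono) (auto simp: dist_norm norm_minus_commute)
      finally have "norm ?T * B \<le> (\<bar>\<rho>\<bar> * (r * CD) + CK * r) * B"
        using B(1) by (intro mult_right_mono) auto
      also have "\<dots> = M" by (simp add: M_def algebra_simps)
      finally have "norm ?T * B \<le> M" .
      then show "norm (F (p s) z ** ?T) \<le> M * norm (F (p s) z)"
        using B(2)[of "F (p s) z" ?T] mult_left_mono[of "norm ?T * B" M "norm (F (p s) z)"] by (simp add: ac_simps)
    qed
    then have "norm (F u z) \<le> exp M * norm (F u0 z)" by (simp add: p_def)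
    also have "\<dots> \<le> exp M * C0" by (intro mult_left_mono C0 z) simp
    finally show ?thesis .
  qed
  then show ?thesis by blast
qed

text \<open>For the parameters \<open>\<plusminus> \<i>\<alpha>\<close> the differential equation follows from the neighbouring ones. The circles of radius
  \<open>|\<alpha>|\<close> around the two points stay at distance at least \<open>|\<alpha>|\<close> from both, so that there the scalar factors are at most \<open>2\<close>.\<close>

lemma dressed_deriv:
  assumes u: "u \<in> S"
  shows "((\<lambda>x. dressed x z) has_derivative (\<lambda>v. dressed u z ** (cscale (\<i> * z) (D v) + K' u v))) (at u)"
proof (cases "z = \<i> * \<alpha> \<or> z = - \<i> * \<alpha>")
  case False
  then show ?thesis using dressed_deriv_regular[OF u] by blast
next
  case True
  obtain B where B: "B > 0" "\<And>(x :: complex^'m^'m) (y :: complex^'m^'m). norm (x ** y) \<le> norm x * norm y * B"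
    using bounded_bilinear.pos_bounded[OF bounded_bilinear_matrix_matrix] by blast
  obtain CD where CD: "CD > 0" "\<And>v. norm (D v) \<le> norm v * CD" using bounded_linear.pos_bounded[OF D_linear] by blast
  have "isCont Q u" using Q_deriv[OF u] has_derivative_continuous by blast
  then obtain d where d: "d > 0" "\<And>x. dist x u < d \<Longrightarrow> dist (Q x) (Q u) < 1"
    unfolding continuous_at_eps_delta using zero_less_one by blast
  obtain e where e: "e > 0" "cball u e \<subseteq> S" using open_S u open_contains_cball by blast
  (* a ball on which Q is bounded by q *)
  define r where "r = min (d / 2) e"
  have r: "r > 0" "cball u r \<subseteq> S" using d e by (auto simp: r_def)
  define q where "q = norm (Q u) + 1"
  have Qb: "norm (Q x) \<le> q" if "x \<in> cball u r" for x
  proof -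
    have "dist (Q x) (Q u) < 1" using that d by (intro d(2)) (auto simp: r_def dist_commute)
    then show ?thesis using norm_triangle_ineq[of "Q u" "Q x - Q u"] by (simp add: q_def dist_norm)
  qed
  have q0: "q \<ge> 0" by (simp add: q_def)
  obtain CK where CK: "CK \<ge> 0" "\<And>x v. x \<in> cball u r \<Longrightarrow> norm (K x v) \<le> CK * norm v"
    using K_bound[OF _ r(2)] by auto
  obtain CF where CF: "\<And>x z. x \<in> cball u r \<Longrightarrow> z \<in> cball 0 (2 * \<bar>\<alpha>\<bar>) \<Longrightarrow> norm (F x z) \<le> CF"
    using F_bound[OF r(2,1)] by meson
  define n where "n = norm (mat 1 :: complex^'m^'m)"
  have za: "cmod z = \<bar>\<alpha>\<bar>" using True by (auto simp: norm_mult)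
  show ?thesis
  proof (rule has_derivative_fill[where S="ball u r" and r="\<bar>\<alpha>\<bar>" and CD=CD and CK="CK + 2 * \<bar>\<alpha>\<bar> * (2 * (CD * q * B))"
        and C="((n + 2 * norm P) * CF * B) * (n + 2 * q) * B"])
    show "open (ball u r)" "convex (ball u r)" "u \<in> ball u r" "\<bar>\<alpha>\<bar> > 0" "CD \<ge> 0" "norm (D v) \<le> CD * norm v" for v
      using r \<alpha> CD by (auto simp: mult.commute)
    show "CK + 2 * \<bar>\<alpha>\<bar> * (2 * (CD * q * B)) \<ge> 0" using CK CD q0 B by simp
    show "(\<lambda>z. dressed x z $ i $ j) holomorphic_on UNIV" if "x \<in> ball u r" for x i j
      using that r by (intro dressed_holomorphic) auto
  next
    fix x y assume x: "x \<in> ball u r" and y: "y \<in> ball z \<bar>\<alpha>\<bar>" "y \<noteq> z"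
    have "cmod (\<i> * \<alpha> - (- \<i> * \<alpha>)) = 2 * \<bar>\<alpha>\<bar>" "cmod (- \<i> * \<alpha> - \<i> * \<alpha>) = 2 * \<bar>\<alpha>\<bar>"
      by (simp_all add: norm_mult flip: mult_2)
    then have "y \<noteq> \<i> * \<alpha>" "y \<noteq> - \<i> * \<alpha>" using y True by (auto simp: dist_norm)
    then show "((\<lambda>x. dressed x y) has_derivative (\<lambda>v. dressed x y ** (cscale (\<i> * y) (D v) + K' x v))) (at x)"
      using x r by (intro dressed_deriv_regular) auto
  next
    fix x y assume x: "x \<in> ball u r" and y: "y \<in> sphere z \<bar>\<alpha>\<bar>"
    have far: "cmod (y - \<i> * \<alpha>) \<ge> \<bar>\<alpha>\<bar>" "cmod (y + \<i> * \<alpha>) \<ge> \<bar>\<alpha>\<bar>"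
    proof -
      have tr: "cmod (2 * \<i> * \<alpha>) \<le> cmod (y - \<i> * \<alpha>) + cmod (y + \<i> * \<alpha>)"
        using norm_triangle_ineq4[of "y + \<i> * \<alpha>" "y - \<i> * \<alpha>"] by (simp add: algebra_simps)
      have "cmod (y - \<i> * \<alpha>) = \<bar>\<alpha>\<bar> \<or> cmod (y + \<i> * \<alpha>) = \<bar>\<alpha>\<bar>"
        using y True by (auto simp: dist_norm norm_minus_commute)
      then show "cmod (y - \<i> * \<alpha>) \<ge> \<bar>\<alpha>\<bar>" "cmod (y + \<i> * \<alpha>) \<ge> \<bar>\<alpha>\<bar>"
        using tr by (auto simp: norm_mult)
    qed
    then have ne: "y \<noteq> \<i> * \<alpha>" "y \<noteq> - \<i> * \<alpha>" using \<alpha> by auto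
    have w: "cmod (2 * \<i> * \<alpha> / (y - \<i> * \<alpha>)) \<le> 2" "cmod (- 2 * \<i> * \<alpha> / (y + \<i> * \<alpha>)) \<le> 2"
      using far \<alpha> by (simp_all add: norm_divide norm_mult divide_simps)
    have "cmod y \<le> 2 * \<bar>\<alpha>\<bar>" using y za norm_triangle_ineq[of z "y - z"] by (simp add: dist_norm norm_minus_commute)
    then have Fb: "norm (F x y) \<le> CF" using x by (intro CF) auto
    let ?A = "mat 1 + cscale (- 2 * \<i> * \<alpha> / (y + \<i> * \<alpha>)) P" and ?C = "mat 1 + cscale (2 * \<i> * \<alpha> / (y - \<i> * \<alpha>)) (Q x)"
    have A: "norm ?A \<le> n + 2 * norm P"
      using norm_triangle_ineq[of "mat 1" "cscale (- 2 * \<i> * \<alpha> / (y + \<i> * \<alpha>)) P"] mult_right_mono[OF w(2), of "norm P"]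
      unfolding norm_cscale n_def by simp
    have C: "norm ?C \<le> n + 2 * q"
      using norm_triangle_ineq[of "mat 1" "cscale (2 * \<i> * \<alpha> / (y - \<i> * \<alpha>)) (Q x)"]
        mult_mono[OF w(1) Qb[of x]] x unfolding norm_cscale n_def by simp
    define M where "M = (n + 2 * norm P) * CF * B"
    have n0: "n \<ge> 0" "CF \<ge> 0" using order_trans[OF norm_ge_zero Fb] by (simp_all add: n_def)
    have "norm (?A ** F x y) \<le> norm ?A * norm (F x y) * B" by (rule B(2))
    also have "\<dots> \<le> M"
      unfolding M_def using A Fb B(1) n0 by (intro mult_right_mono mult_mono) auto
    finally have AF: "norm (?A ** F x y) \<le> M" .
    have "norm (?A ** F x y ** ?C) \<le> norm (?A ** F x y) * norm ?C * B" by (rule B(2))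
    also have "\<dots> \<le> M * (n + 2 * q) * B"
      using C AF B(1) order_trans[OF norm_ge_zero AF] by (intro mult_right_mono mult_mono) auto
    finally have "norm (?A ** F x y ** ?C) \<le> ((n + 2 * norm P) * CF * B) * (n + 2 * q) * B"
      by (simp add: M_def)
    then show "norm (dressed x y) \<le> ((n + 2 * norm P) * CF * B) * (n + 2 * q) * B"
      unfolding dressed_eq[OF ne] .
  next
    fix x v assume x: "x \<in> ball u r"
    then have xc: "x \<in> cball u r" by auto
    have "norm (D v) * norm (Q x) * B \<le> (norm v * CD) * q * B"
      using CD B Qb[OF xc] q0 by (intro mult_right_mono mult_mono) auto
    then have DQ: "norm (D v) * norm (Q x) * B \<le> (CD * q * B) * norm v" by (simp add: ac_simps)
    have 1: "norm (D v ** Q x) \<le> (CD * q * B) * norm v" using B(2)[of "D v" "Q x"] DQ by linarith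
    have 2: "norm (Q x ** D v) \<le> (CD * q * B) * norm v" using B(2)[of "Q x" "D v"] DQ by (simp add: mult.commute)
    have "norm (K' x v) \<le> norm (K x v) + 2 * \<bar>\<alpha>\<bar> * norm (D v ** Q x - Q x ** D v)"
      using norm_triangle_ineq4[of "K x v" "cscale (2 * of_real \<alpha>) (D v ** Q x - Q x ** D v)"]
      by (simp add: K'_def norm_cscale norm_mult)
    also have "\<dots> \<le> CK * norm v + 2 * \<bar>\<alpha>\<bar> * ((CD * q * B) * norm v + (CD * q * B) * norm v)"
    proof (intro add_mono mult_left_mono CK(2) xc)
      show "norm (D v ** Q x - Q x ** D v) \<le> (CD * q * B) * norm v + (CD * q * B) * norm v"
        using norm_triangle_ineq4[of "D v ** Q x" "Q x ** D v"] 1 2 by linarith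
    qed simp
    finally show "norm (K' x v) \<le> (CK + 2 * \<bar>\<alpha>\<bar> * (2 * (CD * q * B))) * norm v"
      by (simp add: algebra_simps)
  qed
qed

end

section \<open>Dressing of a frame along a real projection\<close>

text \<open>Equal images give \<open>A B = B\<close> and \<open>B A = A\<close>; taking adjoints in the first equation gives \<open>B A = B\<close>.\<close>

lemma hermitian_projection_unique:
  assumes A: "hermitian_projection A" and B: "hermitian_projection B" and r: "range ((*v) A) = range ((*v) B)"
  shows "A = B"
proof -
  have fix_range: "M *v x = x" if "hermitian_projection M" "x \<in> range ((*v) M)" for M :: "complex^'n^'n" and x
  proof -
    from that(2) obtain y where y: "x = M *v y" by blast
    have "M ** M = M" using that(1) by (simp add: hermitian_projection_def)
    then show ?thesis by (simp add: y matrix_vector_mul_assoc)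
  qed
  have "A *v (B *v x) = B *v x" for x by (rule fix_range[OF A]) (simp add: r)
  then have AB: "A ** B = B" by (simp add: matrix_eq matrix_vector_mul_assoc)
  have "B *v (A *v x) = A *v x" for x by (rule fix_range[OF B]) (simp flip: r)
  then have BA: "B ** A = A" by (simp add: matrix_eq matrix_vector_mul_assoc)
  have "B = transpose (conj_mat (A ** B))" using B AB by (simp add: hermitian_projection_def)
  also have "\<dots> = B ** A" using A B by (simp add: conj_mat_mult matrix_transpose_mul hermitian_projection_def)
  finally show ?thesis using BA by simp
qed

text \<open>Dressing by a projection that is real, hence symmetric. Its image and kernel are orthogonal also for the
  bilinear pairing. In comments, \<open>E\<^sub>+\<close> and \<open>E\<^sub>-\<close> stand for \<open>Ep\<close> and \<open>Em\<close>, the values of the frame at \<open>\<plusminus> \<i>\<alpha>\<close>.\<close>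

locale frame_dressing = smooth_frame S R k E X
  for S :: "(real^'n::finite) set" and R k E X +
  fixes \<alpha> :: real and P :: "complex^'n^'n"
  assumes R_diag: "u \<in> S \<Longrightarrow> R u $ i $ i = 0"
    and E_hol: "u \<in> S \<Longrightarrow> (\<lambda>z. E u z $ i $ j) holomorphic_on UNIV"
    and X_hol: "u \<in> S \<Longrightarrow> (\<lambda>z. X u z $ i) holomorphic_on UNIV"
    and alpha: "\<alpha> \<noteq> 0"
    and P_idem: "P ** P = P" and P_sym: "transpose P = P" and P_real: "conj_mat P = P"
begin

definition "Ep u = E u (\<i> * of_real \<alpha>)"
definition "Em u = E u (- \<i> * of_real \<alpha>)"
definition "Xm u = X u (- \<i> * of_real \<alpha>)"

lemma EpEm: "u \<in> S \<Longrightarrow> transpose (Ep u) ** Em u = mat 1" "u \<in> S \<Longrightarrow> Em u ** transpose (Ep u) = mat 1"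
  using E_transpose_minus[of u "\<i> * of_real \<alpha>"] by (simp_all add: Ep_def Em_def)

lemma E_real: "u \<in> S \<Longrightarrow> conj_mat (Ep u) = Ep u" "u \<in> S \<Longrightarrow> conj_mat (Em u) = Em u"
  "u \<in> S \<Longrightarrow> conj_vec (Xm u) = Xm u"
  using E_conj[of u "\<i> * of_real \<alpha>"] E_conj[of u "- \<i> * of_real \<alpha>"] X_conj[of u "- \<i> * of_real \<alpha>"]
  by (simp_all add: Ep_def Em_def Xm_def)

definition "H0 u = (mat 1 - P) ** Ep u + P ** Em u"

lemmas P_left = projection_absorb[OF P_idem]

lemma H0_split: "(mat 1 - P) ** H0 u = (mat 1 - P) ** Ep u" "P ** H0 u = P ** Em u"
  by (simp_all add: H0_def matrix_add_ldistrib P_left)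

text \<open>A vector \<open>x\<close> in the kernel satisfies \<open>E\<^sub>+ x \<in> Im P\<close> and \<open>E\<^sub>- x \<in> ker P\<close>. As \<open>E\<^sub>+\<close> is real with transposed inverse
  \<open>E\<^sub>-\<close>, the Hermitian product of these two vectors is \<open>|x|\<^sup>2\<close>, and it vanishes because \<open>Im P\<close> and \<open>ker P\<close> are orthogonal.\<close>

lemma H0_kernel:
  assumes u: "u \<in> S" and x: "H0 u *v x = 0" shows "x = 0"
proof -
  have "((mat 1 - P) ** Ep u) *v x = 0" "(P ** Em u) *v x = 0"
    using x by (simp_all add: H0_split[symmetric] matrix_vector_mul_assoc[symmetric])
  then have p: "Ep u *v x = P *v (Ep u *v x)" and m: "P *v (Em u *v x) = 0"
    by (simp_all add: matrix_diff_rdistrib matrix_vector_mult_diff_rdistrib matrix_vector_mul_assoc P_left)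
  have "conj_vec (Ep u *v x) = P *v conj_vec (Ep u *v x)"
    using arg_cong[OF p, of conj_vec] by (simp add: conj_vec_mult P_real)
  then have pc: "Ep u *v conj_vec x = P *v (Ep u *v conj_vec x)" by (simp add: conj_vec_mult E_real[OF u])
  have "bdot (conj_vec x) x = bdot (Ep u *v conj_vec x) (Em u *v x)"
    by (simp add: bdot_transpose matrix_vector_mul_assoc EpEm[OF u])
  also have "\<dots> = bdot (P *v (Ep u *v conj_vec x)) (Em u *v x)" using pc by simp
  also have "\<dots> = 0" using m by (simp add: bdot_transpose[of P] P_sym bdot_linear)
  finally show ?thesis by (simp add: bdot_conj_self)
qed

lemma H0_inv: "u \<in> S \<Longrightarrow> invertible (H0 u)"
  using H0_kernel matrix_left_invertible_ker[of "H0 u"] by (auto simp: invertible_left_inverse)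

lemma H0_cancel:
  assumes u: "u \<in> S" and eq: "H0 u ** A = H0 u ** B" shows "A = B"
proof -
  obtain L where "L ** H0 u = mat 1" using H0_inv[OF u] by (auto simp: invertible_def)
  then show ?thesis using arg_cong[OF eq, of "(**) L"] by (simp add: matrix_mul_assoc)
qed

text \<open>The linear equation encodes \<open>E\<^sub>+ (Im Q) \<subseteq> Im P\<close> and \<open>E\<^sub>- (Im (1 - Q)) \<subseteq> ker P\<close>. The relation between \<open>E\<^sub>+\<close> and
  \<open>E\<^sub>-\<close> turns orthogonality of \<open>Im P\<close> and \<open>ker P\<close> into orthogonality of the image of \<open>Q\<close> and that of \<open>1 - Q\<close>.\<close>

lemma proj_characterization:
  assumes u: "u \<in> S" and Q: "H0 u ** Q = P ** Em u"
  shows "Q ** Q = Q" "transpose Q = Q" "conj_mat Q = Q"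
    "range ((*v) Q) = (\<lambda>x. matrix_inv (Ep u) *v x) ` range ((*v) P)"
proof -
  have kp: "(mat 1 - P) ** (Ep u ** Q) = 0"
    using arg_cong[OF Q, of "\<lambda>A. (mat 1 - P) ** A"] H0_split(1)[of u] P_left(2) by (metis matrix_mul_assoc)
  have km: "P ** (Em u ** Q) = P ** Em u"
    using arg_cong[OF Q, of "\<lambda>A. P ** A"] H0_split(2)[of u] P_left(1) by (metis matrix_mul_assoc)
  (* H0 is injective, and it takes the same value on A and on Q A *)
  have fixQ: "Q ** A = A" if "(mat 1 - P) ** (Ep u ** A) = 0" for A :: "complex^'n^'n"
  proof (rule H0_cancel[OF u])
    have "H0 u ** A = P ** Em u ** A"
      using that by (simp add: H0_def matrix_add_rdistrib' flip: matrix_mul_assoc)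
    then show "H0 u ** (Q ** A) = H0 u ** A" using Q by (simp add: matrix_mul_assoc)
  qed
  show QQ: "Q ** Q = Q" by (rule fixQ[OF kp])
  show real: "conj_mat Q = Q"
  proof (rule H0_cancel[OF u])
    have "conj_mat (H0 u) = H0 u"
      using E_real[OF u] by (simp add: H0_def conj_mat_add conj_mat_diff conj_mat_mult P_real)
    then have "H0 u ** conj_mat Q = conj_mat (H0 u ** Q)" by (simp add: conj_mat_mult)
    also have "\<dots> = H0 u ** Q" unfolding Q by (simp add: conj_mat_mult P_real E_real[OF u])
    finally show "H0 u ** conj_mat Q = H0 u ** Q" .
  qed
  have EpQ: "Ep u ** Q = P ** (Ep u ** Q)" using kp by (simp add: matrix_diff_rdistrib)
  have "transpose Q ** (mat 1 - Q) = transpose Q ** (transpose (Ep u) ** Em u) ** (mat 1 - Q)"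
    using EpEm[OF u] by simp
  also have "\<dots> = transpose (Ep u ** Q) ** (Em u ** (mat 1 - Q))"
    by (simp add: matrix_transpose_mul matrix_mul_assoc)
  also have "\<dots> = transpose (P ** (Ep u ** Q)) ** (Em u ** (mat 1 - Q))" using EpQ by simp
  also have "\<dots> = transpose (Ep u ** Q) ** (P ** (Em u ** (mat 1 - Q)))"
    by (simp add: matrix_transpose_mul P_sym matrix_mul_assoc)
  also have "\<dots> = 0" using km by (simp add: matrix_diff_ldistrib)
  finally have t: "transpose Q = transpose Q ** Q" by (simp add: matrix_diff_ldistrib)
  have "transpose (transpose Q) = transpose (transpose Q ** Q)" by (rule arg_cong[OF t])
  then have q: "Q = transpose Q ** Q" by (simp add: matrix_transpose_mul)
  show "transpose Q = Q" by (rule trans[OF t q[symmetric]])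
  have L1: "matrix_inv (Ep u) ** Ep u = mat 1"
    unfolding Ep_def by (rule matrix_inv_left[OF E_invertible[OF u]])
  have L2: "Ep u ** matrix_inv (Ep u) = mat 1"
    by (rule matrix_left_right_inverse[THEN iffD1, OF L1])
  show "range ((*v) Q) = (\<lambda>x. matrix_inv (Ep u) *v x) ` range ((*v) P)"
  proof (intro equalityI subsetI)
    fix x assume "x \<in> range ((*v) Q)"
    then obtain y where y: "x = Q *v y" by blast
    have "Ep u *v x = P *v (Ep u *v x)" using arg_cong[OF EpQ, of "\<lambda>A. A *v y"] by (simp add: y matrix_vector_mul_assoc matrix_mul_assoc P_idem)
    moreover have "x = matrix_inv (Ep u) *v (Ep u *v x)"
      by (simp add: matrix_vector_mul_assoc L1)
    ultimately have "x = matrix_inv (Ep u) *v (P *v (Ep u *v x))" by metis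
    then show "x \<in> (\<lambda>x. matrix_inv (Ep u) *v x) ` range ((*v) P)" by blast
  next
    fix x assume "x \<in> (\<lambda>x. matrix_inv (Ep u) *v x) ` range ((*v) P)"
    then obtain y where y: "x = (matrix_inv (Ep u) ** P) *v y" by (auto simp: matrix_vector_mul_assoc)
    have "Q ** (matrix_inv (Ep u) ** P) = matrix_inv (Ep u) ** P"
      by (rule fixQ) (simp add: matrix_mul_assoc[of "Ep u"] L2, simp add: matrix_diff_rdistrib P_idem)
    then have "x = Q *v x" by (simp add: y matrix_vector_mul_assoc)
    then show "x \<in> range ((*v) Q)" by blast
  qed
qed

abbreviation "Q u \<equiv> dressed_proj E \<alpha> P u"
abbreviation "\<eta> u \<equiv> dressing_eta E X \<alpha> u"

text \<open>The projection onto \<open>E\<^sub>+\<^sup>-\<^sup>1 (Im P)\<close> solves a linear equation with invertible differentiable coefficients; this is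
  what makes it differentiable in \<open>u\<close>.\<close>

lemma Q_char:
  assumes u: "u \<in> S" shows "H0 u ** Q u = P ** Em u"
proof -
  obtain L where L: "H0 u ** L = mat 1" using H0_inv[OF u] by (auto simp: invertible_def)
  define Q' where "Q' = L ** (P ** Em u)"
  have Q': "H0 u ** Q' = P ** Em u" by (simp add: Q'_def matrix_mul_assoc L)
  note c = proj_characterization[OF u Q']
  have "Q u = Q'"
    unfolding dressed_proj_def hermitian_projection_onto_def Ep_def[symmetric]
  proof (rule the_equality)
    show Q'': "hermitian_projection Q' \<and> range ((*v) Q') = (\<lambda>x. matrix_inv (Ep u) *v x) ` range ((*v) P)"
      using c by (simp add: hermitian_projection_def)
    show "A = Q'" if "hermitian_projection A \<and> range ((*v) A) = (\<lambda>x. matrix_inv (Ep u) *v x) ` range ((*v) P)" for A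
      using that Q'' by (intro hermitian_projection_unique) simp_all
  qed
  then show ?thesis using Q' by simp
qed

lemmas Q_idem = proj_characterization(1)[OF _ Q_char]
  and Q_sym = proj_characterization(2)[OF _ Q_char]
  and Q_real = proj_characterization(3)[OF _ Q_char]

text \<open>The vector \<open>\<xi>\<close> is the last column of the oblique projection in the larger matrix algebra, see \<open>Qh\<close> below.\<close>

definition "\<xi> u = Q u *v \<eta> u"

lemma Em_eta: "u \<in> S \<Longrightarrow> Em u *v \<eta> u = Xm u"
  using EpEm(2)[of u] by (simp add: dressing_eta_def matrix_vector_mul_assoc Ep_def Em_def Xm_def)

lemma eta_real: "u \<in> S \<Longrightarrow> conj_vec (\<eta> u) = \<eta> u"
proof -
  assume u: "u \<in> S"
  have "conj_mat (transpose A) = transpose (conj_mat A)" for A :: "complex^'n^'n"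
    by (simp add: vec_eq_iff conj_mat_def transpose_def)
  then show ?thesis using E_real[OF u] by (simp add: dressing_eta_def conj_vec_mult Ep_def Xm_def)
qed

lemma xi_real: "u \<in> S \<Longrightarrow> conj_vec (\<xi> u) = \<xi> u"
  by (simp add: \<xi>_def conj_vec_mult Q_real eta_real)

lemma Q_xi: "u \<in> S \<Longrightarrow> Q u *v \<xi> u = \<xi> u"
  by (simp add: \<xi>_def matrix_vector_mul_assoc Q_idem)

text \<open>The data of the extended frame as \<open>(n + 1) \<times> (n + 1)\<close> matrices. With the projection \<open>Ph\<close>, dressing
  the whole extended frame is an instance of the general two-pole dressing, with \<open>Qh\<close> as the oblique projection.\<close>

definition \<delta> :: "real^'n \<Rightarrow> complex^'n^'n" where "\<delta> v = diag_matrix (cvec v)"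
definition "Dh v = block (\<delta> v) 0 0"
definition "Kh u v = block (comm_form (R u) v) (\<delta> v *v cvec (k u)) 0"
definition "Fh u z = block (E u z) (X u z) 1"
definition "Ph = block P 0 0"
definition "Qh u = block (Q u) (\<xi> u) 0"

lemma linear_delta: "linear \<delta>"
  by (rule linearI) (simp_all add: \<delta>_def diag_cvec_linear)

lemma linear_comm_form: "linear (comm_form A)"
  by (rule linearI) (simp_all add: vec_eq_iff comm_form_nth algebra_simps scaleR_conv_of_real[where 'a=complex])

lemma linear_delta_vec: "linear (\<lambda>v. \<delta> v *v x)"
  by (rule linearI) (simp_all add: linear_add[OF linear_delta] linear_cmul[OF linear_delta]
      bounded_bilinear.add_left[OF bounded_bilinear_matrix_vector] bounded_bilinear.scaleR_left[OF bounded_bilinear_matrix_vector])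

lemma Kh_Ck: "Ck_on m S (\<lambda>u. Kh u v)"
proof -
  note lin = bounded_linear.linear[OF bounded_linear_lax_form_coeff[of v]]
  have l1: "bounded_linear (\<lambda>A. block (comm_form A v) 0 0)"
    unfolding linear_conv_bounded_linear[symmetric]
    by (intro linearI) (simp_all add: linear_add[OF lin] linear_cmul[OF lin] block_simps)
  have l2: "bounded_linear (\<lambda>x. block 0 (\<delta> v *v cvec x) 0)"
    unfolding linear_conv_bounded_linear[symmetric]
    by (intro linearI) (simp_all add: cvec_simps block_simps matrix_vector_right_distrib matrix_vector_scaleR)
  have "Ck_on m S (\<lambda>u. block (comm_form (R u) v) 0 0 + block 0 (\<delta> v *v cvec (k u)) 0)"
    using R_smooth k_smooth
    by (intro Ck_on_add[OF open_S] Ck_on_linear[OF open_S l1] Ck_on_linear[OF open_S l2]) (auto simp: smooth_on_def)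
  then show ?thesis by (simp add: Kh_def block_simps)
qed

lemma Hh_eq: "(mat 1 - Ph) ** Fh u (\<i> * of_real \<alpha>) + Ph ** Fh u (- \<i> * of_real \<alpha>)
   = block (H0 u) ((mat 1 - P) *v X u (\<i> * of_real \<alpha>) + P *v Xm u) 1"
  by (simp add: Ph_def Fh_def block_mult block_simps H0_def Ep_def Em_def Xm_def)

sublocale dressing: two_pole_dressing S Dh Kh Fh Ph \<alpha> Qh
proof (rule two_pole_dressing.intro)
  show "open S" "\<alpha> \<noteq> 0" by (rule open_S, rule alpha)
  show "bounded_linear Dh"
    unfolding Dh_def by (rule linear_block[OF linear_delta]) (simp add: linear_zero)
  show "bounded_linear (Kh u)" if "u \<in> S" for u
    unfolding Kh_def by (rule linear_block[OF linear_comm_form linear_delta_vec])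
  show "continuous_on S (\<lambda>u. Kh u v)" for v
    using Kh_Ck[of 0] by simp
  show "((\<lambda>x. Fh x z) has_derivative (\<lambda>v. Fh u z ** (cscale (\<i> * z) (Dh v) + Kh u v))) (at u)" if u: "u \<in> S" for u z
    unfolding Fh_def Dh_def Kh_def block_simps block_mult
    using E_deriv[OF u] X_deriv[OF u]
    by (simp add: has_derivative_block_iff lax_form_def \<delta>_def)
  show "(\<lambda>z. Fh u z $ p $ q) holomorphic_on UNIV" if u: "u \<in> S" for u p q
    by (cases p; cases q) (simp_all add: Fh_def E_hol[OF u] X_hol[OF u])
  show "Ph ** Ph = Ph" by (simp add: Ph_def block_mult P_idem)
  show "invertible ((mat 1 - Ph) ** Fh u (\<i> * of_real \<alpha>) + Ph ** Fh u (- \<i> * of_real \<alpha>))" if "u \<in> S" for u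
    unfolding Hh_eq block_invertible_iff by (rule H0_inv[OF that])
  show "((mat 1 - Ph) ** Fh u (\<i> * of_real \<alpha>) + Ph ** Fh u (- \<i> * of_real \<alpha>)) ** Qh u = Ph ** Fh u (- \<i> * of_real \<alpha>)"
    if u: "u \<in> S" for u
  proof -
    have "H0 u *v \<xi> u = P *v Xm u"
      using Q_char[OF u] Em_eta[OF u] by (simp add: \<xi>_def matrix_vector_mul_assoc) (metis matrix_vector_mul_assoc)
    then show ?thesis
      unfolding Hh_eq using Q_char[OF u] by (simp add: Qh_def Ph_def Fh_def block_mult block_simps Em_def Xm_def)
  qed
qed

definition "k' u = k u - (2 * \<alpha>) *\<^sub>R re_vec (\<xi> u)"
definition "R' u = R u - (2 * \<alpha>) *\<^sub>R re_off_diag (Q u)"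
definition "E' u z = block_mat (dressing.dressed u z)"
definition "X' u z = block_vec (dressing.dressed u z)"

lemma cvec_k': "u \<in> S \<Longrightarrow> cvec (k' u) = cvec (k u) - (2 * of_real \<alpha>) *s \<xi> u"
  using cvec_re_vec[OF xi_real]
  by (simp add: k'_def cvec_simps vec_eq_iff scaleR_conv_of_real[where 'a=complex])

lemma cmat_R':
  assumes u: "u \<in> S" shows "cmat (R' u) = cmat (R u) - cscale (2 * of_real \<alpha>) (off_diag (Q u))"
proof -
  have "of_real (Re (Q u $ i $ j)) = Q u $ i $ j" for i j
    using Q_real[OF u u] by (simp add: conj_mat_def vec_eq_iff complex_eq_iff)
  then show ?thesis
    by (simp add: R'_def cmat_def vec_eq_iff re_off_diag_def off_diag_def cscale_def)
qed

lemma dressed_block: "dressing.dressed u z = block (E' u z) (X' u z) 1"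
proof -
  have 1: "(\<lambda>z. (mat 1 - Ph) ** Fh u z ** Qh u) =
      (\<lambda>z. block ((mat 1 - P) ** E u z ** Q u) ((mat 1 - P) ** E u z *v \<xi> u) 0)"
    by (simp add: Ph_def Fh_def Qh_def block_mult block_simps)
  have 2: "(\<lambda>z. Ph ** Fh u z ** (mat 1 - Qh u)) =
      (\<lambda>z. block (P ** E u z ** (mat 1 - Q u)) (P ** E u z *v (- \<xi> u) + P *v X u z) 0)"
    by (simp add: Ph_def Fh_def Qh_def block_mult block_simps)
  have "dressing.dressed u z $ None $ q = Fh u z $ None $ q" for q
    unfolding dressing.dressed_def 1 2 by (cases q) (simp_all add: cscale_def divided_def)
  then show ?thesis
    by (simp add: option_vec_eq_iff E'_def X'_def block_mat_def block_vec_def Fh_def)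
qed

lemma Q_0: "Q 0 = P"
  using Q_char[OF zero_S] by (simp add: H0_def Ep_def Em_def E_0)

lemma xi_0: "\<xi> 0 = 0"
  by (simp add: \<xi>_def dressing_eta_def X_0)

lemma k'_0: "k' 0 = k 0"
  by (simp add: k'_def xi_0 re_vec_def vec_eq_iff)

lemma dressed_0: "dressing.dressed 0 z = mat 1"
proof -
  have F: "Fh 0 z = mat 1" for z by (simp add: Fh_def E_0 X_0 block_simps)
  have Q: "Qh 0 = Ph" by (simp add: Qh_def Ph_def Q_0 xi_0)
  have "divided a (\<lambda>z. 0) z = (0 :: complex^('n option)^('n option))" for a by (simp add: divided_def vec_eq_iff)
  moreover have "(mat 1 - Ph) ** Ph = 0" "Ph ** (mat 1 - Ph) = 0"
    using dressing.P_proj by (simp_all add: mat_distribs)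
  ultimately show ?thesis by (simp add: dressing.dressed_def F Q)
qed

lemma comm_form_R':
  assumes u: "u \<in> S"
  shows "comm_form (R' u) v = comm_form (R u) v - cscale (2 * of_real \<alpha>) (\<delta> v ** Q u - Q u ** \<delta> v)"
proof -
  have r: "of_real (R' u $ i $ j) = of_real (R u $ i $ j) - 2 * of_real \<alpha> * off_diag (Q u) $ i $ j" for i j
    using arg_cong[OF cmat_R'[OF u], of "\<lambda>A. A $ i $ j"] by (simp add: cmat_def cscale_def)
  show ?thesis
    by (simp add: vec_eq_iff comm_form_nth \<delta>_def diag_matrix_mult_left diag_matrix_mult_right cscale_def
        cvec_def r) (simp add: off_diag_def algebra_simps)
qed

text \<open>In block form the general change \<open>- 2\<alpha> [D, Q]\<close> of the form is the change of \<open>\<beta>\<close> and of \<open>h\<close> at the same time.\<close>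

lemma dressed_form:
  assumes u: "u \<in> S"
  shows "cscale (\<i> * z) (Dh v) + dressing.K' u v = block (lax_form (R' u) z v) (\<delta> v *v cvec (k' u)) 0"
proof -
  have "\<delta> v *v cvec (k' u) = \<delta> v *v cvec (k u) - (2 * of_real \<alpha>) *s (\<delta> v *v \<xi> u)"
    by (simp add: cvec_k'[OF u] matrix_vector_mult_diff_distrib vector_mult_scale)
  then show ?thesis
    by (simp add: dressing.K'_def Dh_def Kh_def Qh_def block_mult block_simps lax_form_def comm_form_R'[OF u] \<delta>_def)
qed

lemma frame': "flat_frame S R' k' E' X'"
proof (rule flat_frame.intro)
  show "open S" "connected S" "0 \<in> S" by (rule open_S, rule connected_S, rule zero_S)
  show "transpose (R' u) = R' u" if u: "u \<in> S" for u
  proof -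
    have "transpose (re_off_diag (Q u)) = re_off_diag (transpose (Q u))"
      by (simp add: re_off_diag_def vec_eq_iff transpose_def)
    then show ?thesis
      using Q_sym[OF u u] R_sym[OF u] by (simp add: R'_def transpose_diff transpose_scalar)
  qed
  show "E' 0 z = mat 1" "X' 0 z = 0" for z
    using dressed_0[of z] unfolding dressed_block by (simp_all add: block_simps)
  have d: "((\<lambda>x. E' x z) has_derivative (\<lambda>v. E' u z ** lax_form (R' u) z v)) (at u) \<and>
     ((\<lambda>x. X' x z) has_derivative (\<lambda>v. E' u z *v (\<delta> v *v cvec (k' u)))) (at u)" if u: "u \<in> S" for u z
    using dressing.dressed_deriv[OF u, of z]
    unfolding dressed_form[OF u] dressed_block block_mult by (simp add: has_derivative_block_iff)
  show "((\<lambda>x. E' x z) has_derivative (\<lambda>v. E' u z ** lax_form (R' u) z v)) (at u)" if u: "u \<in> S" for u z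
    using d[OF u] by blast
  show "((\<lambda>x. X' x z) has_derivative (\<lambda>v. E' u z *v (diag_matrix (cvec v) *v cvec (k' u)))) (at u)"
    if u: "u \<in> S" for u z
    using d[OF u] by (simp add: \<delta>_def)
qed

text \<open>The derivative of the projection is polynomial in the projection, with smooth coefficients.\<close>

lemma Qh_Ck: "Ck_on m S Qh"
proof (induction m)
  case 0
  have "continuous (at u) Qh" if "u \<in> S" for u
    using dressing.Q_deriv[OF that] has_derivative_continuous by blast
  then show ?case by (simp add: continuous_at_imp_continuous_on)
next
  case (Suc m)
  show ?case
    by (rule Ck_on_SucI[OF open_S dressing.Q_deriv])
      (auto simp: dressing.dQ_def intro!: Ck_on_diff Ck_on_add Ck_on_const Kh_Ck Suc open_S
        Ck_on_bilinear[OF open_S bounded_bilinear_matrix_matrix])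
qed

lemma k'_smooth: "smooth_on S k'" and R'_smooth: "smooth_on S R'"
proof -
  have "\<xi> u = block_vec (Qh u)" "Q u = block_mat (Qh u)" for u by (simp_all add: Qh_def)
  then show "smooth_on S k'" "smooth_on S R'"
    unfolding smooth_on_def k'_def R'_def using k_smooth R_smooth
    by (auto simp: smooth_on_def intro!: Ck_on_diff open_S Qh_Ck Ck_on_linear[OF open_S bounded_linear_scaleR_right]
        Ck_on_linear[OF open_S bounded_linear_re_vec] Ck_on_linear[OF open_S bounded_linear_re_off_diag]
        Ck_on_linear[OF open_S bounded_linear_block_vec] Ck_on_linear[OF open_S bounded_linear_block_mat])
qed

lemma smooth_frame':
  assumes U: "nonvanishing_nbhd S k' U" shows "smooth_frame U R' k' E' X'"
proof -
  interpret f: flat_frame S R' k' E' X' by (rule frame')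
  have U': "open U" "connected U" "0 \<in> U" "U \<subseteq> S" "\<And>u i. u \<in> U \<Longrightarrow> k' u $ i \<noteq> 0"
    using U by (auto simp: nonvanishing_nbhd_def)
  show ?thesis
  proof (intro smooth_frame.intro flat_frame.intro smooth_frame_axioms.intro U')
    show "smooth_on U R'" "smooth_on U k'"
      using R'_smooth k'_smooth U' Ck_on_subset unfolding smooth_on_def by blast+
  qed (use U' f.R_sym f.E_0 f.X_0 f.E_deriv f.X_deriv in auto)
qed

lemma R'_diag: "u \<in> S \<Longrightarrow> R' u $ i $ i = 0"
  by (simp add: R'_def R_diag re_off_diag_def)

lemma rotation_coeff_k': "nonvanishing_nbhd S k' U \<Longrightarrow> u \<in> U \<Longrightarrow> rotation_coeff k' u = R' u"
  by (rule smooth_frame.rotation_coeff_eq[OF smooth_frame']) (auto simp: nonvanishing_nbhd_def intro: R'_diag)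

lemma extended_frame':
  assumes U: "nonvanishing_nbhd S k' U" shows "extended_frame U k' E' X'"
proof -
  interpret f: smooth_frame U R' k' E' X' by (rule smooth_frame'[OF U])
  have US: "u \<in> U \<Longrightarrow> u \<in> S" for u using U by (auto simp: nonvanishing_nbhd_def)
  show ?thesis
    unfolding extended_frame_def Let_def
  proof (intro conjI ballI allI)
    show "block (E' 0 z) (X' 0 z) 1 = mat 1" for z using dressed_0 by (simp add: dressed_block)
    show "(\<lambda>z. block (E' u z) (X' u z) 1 $ p $ q) holomorphic_on UNIV" if "u \<in> U" for u p q
      using dressing.dressed_holomorphic[OF US[OF that], of p q] by (simp add: dressed_block)
    show "invertible (block (E' u z) (X' u z) 1)" if "u \<in> U" for u z
      unfolding block_invertible_iff by (rule f.E_invertible[OF that])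
    show "((\<lambda>x. block (E' x z) (X' x z) 1) has_derivative (\<lambda>v. block (E' u z) (X' u z) 1 ** frame_form k' u z v)) (at u)"
      if u: "u \<in> U" for u z
      using f.E_deriv[OF u] f.X_deriv[OF u]
      by (simp add: frame_form_lax rotation_coeff_k'[OF U u] block_mult has_derivative_block_iff)
  qed
qed

lemma X'_eq:
  assumes z: "z \<noteq> \<i> * of_real \<alpha>" "z \<noteq> - \<i> * of_real \<alpha>"
  shows "X' u z = dressed_X E X \<alpha> P u z"
proof -
  define w where "w = 2 * \<i> * of_real \<alpha> / (z - \<i> * of_real \<alpha>)"
  define w' where "w' = - 2 * \<i> * of_real \<alpha> / (z + \<i> * of_real \<alpha>)"
  have ne: "z + \<i> * of_real \<alpha> \<noteq> 0" using z by (auto simp: add_eq_0_iff)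
  have "dressing.dressed u z = (mat 1 + cscale w' Ph) ** Fh u z ** (mat 1 + cscale w (Qh u))"
    unfolding w_def w'_def by (rule dressing.dressed_eq[OF z])
  then have "X' u z = (mat 1 + cscale w' P) *v (E u z *v (w *s \<xi> u) + X u z)"
    by (simp add: X'_def Ph_def Fh_def Qh_def block_mult block_simps matrix_vector_right_distrib matrix_vector_mul_assoc)
  moreover have "simple_factor (- \<i> * of_real \<alpha>) (mat 1 - P) z = mat 1 + cscale w' P"
  proof -
    have "(z - \<i> * of_real \<alpha>) / (z + \<i> * of_real \<alpha>) = 1 + w'"
      using ne by (simp add: w'_def field_simps)
    then show ?thesis by (simp add: simple_factor_def vec_eq_iff cscale_def algebra_simps)
  qed
  ultimately show ?thesis
    by (simp add: dressed_X_def \<xi>_def w_def vector_mult_scale add.commute)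
qed

definition "\<theta>p u v = lax_form (R u) (\<i> * of_real \<alpha>) v"
definition "\<theta>m u v = lax_form (R u) (- \<i> * of_real \<alpha>) v"

text \<open>The forms at \<open>\<plusminus> \<i>\<alpha>\<close>; they are negative transposes of each other.\<close>

lemma theta: "\<theta>p u v = cscale (- of_real \<alpha>) (\<delta> v) + comm_form (R u) v"
  "\<theta>m u v = cscale (of_real \<alpha>) (\<delta> v) + comm_form (R u) v"
  by (simp_all add: \<theta>p_def \<theta>m_def lax_form_def \<delta>_def flip: mult.assoc)

definition "\<xi>' u v = Q u *v (\<delta> v *v cvec (k u)) - Q u *v (\<theta>m u v *v \<xi> u)
      - (\<theta>p u v *v \<xi> u - Q u *v (\<theta>p u v *v \<xi> u))"

lemma xi_deriv:
  assumes u: "u \<in> S"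
  shows "(\<xi> has_derivative \<xi>' u) (at u)"
proof -
  have "((\<lambda>x. block_vec (Qh x)) has_derivative (\<lambda>v. block_vec (dressing.dQ u v))) (at u)"
    by (rule bounded_linear.has_derivative[OF bounded_linear_block_vec dressing.Q_deriv[OF u]])
  moreover have "block_vec (dressing.dQ u v) = \<xi>' u v" for v
    by (simp add: \<xi>'_def dressing.dQ_def Dh_def Kh_def Qh_def block_mult block_simps theta[symmetric] matrix_vector_minus
        matrix_vector_mult_diff_rdistrib matrix_diff_rdistrib flip: matrix_vector_mul_assoc)
  ultimately have "((\<lambda>x. block_vec (Qh x)) has_derivative \<xi>' u) (at u)" by simp
  then show ?thesis by (simp add: Qh_def)
qed

lemma eta_deriv:
  assumes u: "u \<in> S"
  shows "(\<eta> has_derivative (\<lambda>v. \<delta> v *v cvec (k u) - \<theta>m u v *v \<eta> u)) (at u)"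
proof -
  have e: "\<eta> = (\<lambda>x. transpose (Ep x) *v Xm x)" by (simp add: dressing_eta_def Ep_def Xm_def fun_eq_iff)
  have "((\<lambda>x. transpose (Ep x) *v Xm x) has_derivative
     (\<lambda>v. transpose (Ep u) *v (Em u *v (\<delta> v *v cvec (k u))) + transpose (Ep u ** \<theta>p u v) *v Xm u)) (at u)"
    unfolding Ep_def Em_def Xm_def \<theta>p_def \<delta>_def
    by (intro bounded_bilinear.FDERIV[OF bounded_bilinear_matrix_vector] X_deriv[OF u]
        bounded_linear.has_derivative[OF bounded_linear_transpose E_deriv[OF u]])
  moreover have "transpose (Ep u ** \<theta>p u v) *v Xm u = - (\<theta>m u v *v \<eta> u)" for v
    by (simp add: matrix_transpose_mul \<theta>p_def \<theta>m_def transpose_lax_form[OF R_sym[OF u]] e matrix_vector_minus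
        flip: matrix_vector_mul_assoc)
  moreover have "transpose (Ep u) *v (Em u *v x) = x" for x
    by (simp add: matrix_vector_mul_assoc EpEm(1)[OF u])
  ultimately show ?thesis by (simp add: e)
qed

text \<open>As \<open>\<theta>m\<close> and \<open>- \<theta>p\<close> are transposes of each other, the derivative of \<open>\<eta>\<^sup>t \<xi>\<close> reduces to
  \<open>2 \<xi>\<^sup>t \<delta> k - 2\<alpha> \<xi>\<^sup>t \<delta> \<xi>\<close>, which completes the square in \<open>(k - 2\<alpha>\<xi>)\<^sup>t \<delta> (k - 2\<alpha>\<xi>)\<close>.\<close>

lemma potential_deriv:
  assumes u: "u \<in> S"
    and \<phi>: "(\<phi> has_derivative (\<lambda>v. \<Sum>i\<in>UNIV. (k u $ i)\<^sup>2 * v $ i)) (at u)"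
  shows "((\<lambda>x. \<phi> x - 2 * \<alpha> * Re (bdot (\<eta> x) (\<xi> x))) has_derivative (\<lambda>v. \<Sum>i\<in>UNIV. (k' u $ i)\<^sup>2 * v $ i)) (at u)"
proof -
  let ?d\<eta> = "\<lambda>v. \<delta> v *v cvec (k u) - \<theta>m u v *v \<eta> u"
  have "((\<lambda>x. \<phi> x - 2 * \<alpha> * Re (bdot (\<eta> x) (\<xi> x))) has_derivative
    (\<lambda>v. (\<Sum>i\<in>UNIV. (k u $ i)\<^sup>2 * v $ i) - 2 * \<alpha> * Re (bdot (\<eta> u) (\<xi>' u v) + bdot (?d\<eta> v) (\<xi> u)))) (at u)"
    by (intro has_derivative_diff \<phi> has_derivative_mult_right
        bounded_linear.has_derivative[OF bounded_linear_Re] bounded_bilinear.FDERIV[OF bounded_bilinear_bdot] eta_deriv[OF u] xi_deriv[OF u])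
  moreover have "(\<Sum>i\<in>UNIV. (k u $ i)\<^sup>2 * v $ i) - 2 * \<alpha> * Re (bdot (\<eta> u) (\<xi>' u v) + bdot (?d\<eta> v) (\<xi> u))
      = (\<Sum>i\<in>UNIV. (k' u $ i)\<^sup>2 * v $ i)" for v
  proof -
    have Qt: "bdot (\<eta> u) (Q u *v y) = bdot (\<xi> u) y" for y
      using bdot_transpose[of "Q u" "\<eta> u" y] Q_sym[OF u u] by (simp add: \<xi>_def)
    have th: "bdot (\<theta>m u v *v x) y = - bdot x (\<theta>p u v *v y)" for x y
      using transpose_lax_form[OF R_sym[OF u], of "- \<i> * of_real \<alpha>" v]
      by (simp add: bdot_transpose \<theta>p_def \<theta>m_def matrix_vector_minus bdot_linear)
    have diff: "\<theta>m u v *v \<xi> u = \<theta>p u v *v \<xi> u + (2 * of_real \<alpha>) *s (\<delta> v *v \<xi> u)"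
      by (simp add: theta matrix_vector_mult_add_rdistrib cscale_vector) (simp add: vec_eq_iff algebra_simps)
    have c: "bdot (\<delta> v *v cvec (k u)) (\<xi> u) = bdot (\<xi> u) (\<delta> v *v cvec (k u))" by (rule bdot_commute)
    have br: "bdot (\<eta> u) (\<xi>' u v) + bdot (?d\<eta> v) (\<xi> u)
        = 2 * bdot (\<xi> u) (\<delta> v *v cvec (k u)) - 2 * of_real \<alpha> * bdot (\<xi> u) (\<delta> v *v \<xi> u)"
      by (simp add: \<xi>'_def bdot_linear Qt th diff c)
    define x where "x = re_vec (\<xi> u)"
    have \<xi>: "\<xi> u = cvec x" using cvec_re_vec[OF xi_real[OF u]] by (simp add: x_def)
    have real: "bdot (cvec x) (\<delta> v *v cvec y) = of_real (\<Sum>i\<in>UNIV. x $ i * (v $ i * y $ i))" for y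
      by (simp add: bdot_def \<delta>_def diag_matrix_vector cvec_def)
    let ?A = "\<Sum>i\<in>UNIV. x $ i * (v $ i * k u $ i)" and ?B = "\<Sum>i\<in>UNIV. x $ i * (v $ i * x $ i)"
    from br have re: "Re (bdot (\<eta> u) (\<xi>' u v) + bdot (?d\<eta> v) (\<xi> u)) = 2 * ?A - 2 * \<alpha> * ?B"
      by (simp only: \<xi> real) simp
    have "(\<Sum>i\<in>UNIV. (k' u $ i)\<^sup>2 * v $ i) = (\<Sum>i\<in>UNIV. (k u $ i)\<^sup>2 * v $ i
        - 4 * \<alpha> * (x $ i * (v $ i * k u $ i)) + 4 * \<alpha>\<^sup>2 * (x $ i * (v $ i * x $ i)))"
      by (rule sum.cong) (simp_all add: k'_def x_def power2_eq_square algebra_simps)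
    also have "\<dots> = (\<Sum>i\<in>UNIV. (k u $ i)\<^sup>2 * v $ i) - 4 * \<alpha> * ?A + 4 * \<alpha>\<^sup>2 * ?B"
      by (simp only: sum.distrib sum_subtractf sum_distrib_left)
    finally show ?thesis unfolding re by (simp add: power2_eq_square algebra_simps)
  qed
  ultimately show ?thesis by simp
qed

lemma potential_real:
  assumes u: "u \<in> S" shows "of_real (Re (bdot (\<eta> u) (\<xi> u))) = bdot (\<eta> u) (\<xi> u)"
proof -
  have "\<eta> u = cvec (re_vec (\<eta> u))" "\<xi> u = cvec (re_vec (\<xi> u))"
    using cvec_re_vec eta_real xi_real u by metis+
  then have "bdot (\<eta> u) (\<xi> u) = bdot (cvec (re_vec (\<eta> u))) (cvec (re_vec (\<xi> u)))" by metis
  also have "\<dots> = of_real (\<Sum>i\<in>UNIV. re_vec (\<eta> u) $ i * re_vec (\<xi> u) $ i)" by (simp add: bdot_def cvec_def)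
  finally show ?thesis by simp
qed

text \<open>The position formula at \<open>- \<i>\<alpha>\<close> gives \<open>\<alpha>\<eta> = k - E\<^sub>+\<^sup>t (k 0)\<close>, and \<open>Q\<close> annihilates the last term because
  \<open>E\<^sub>+\<close> maps the image of \<open>Q\<close> into the image of \<open>P\<close>, to which \<open>k 0\<close> is orthogonal.\<close>

lemma alpha_xi:
  assumes inv: "del_invariant S k" and P0: "P *v cvec (k 0) = 0" and u: "u \<in> S"
  shows "of_real \<alpha> *s \<xi> u = Q u *v cvec (k u)"
proof -
  have "of_real \<alpha> *s Xm u = Em u *v cvec (k u) - cvec (k 0)"
    using position_del_invariant[OF inv u, of "- \<i> * of_real \<alpha>"] by (simp add: Em_def Xm_def flip: mult.assoc)
  then have "of_real \<alpha> *s \<eta> u = transpose (Ep u) *v (Em u *v cvec (k u) - cvec (k 0))"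
    by (simp add: dressing_eta_def Ep_def Xm_def flip: vector_mult_scale)
  then have "of_real \<alpha> *s \<eta> u = cvec (k u) - transpose (Ep u) *v cvec (k 0)"
    by (simp add: matrix_vector_mult_diff_distrib matrix_vector_mul_assoc EpEm[OF u])
  then have "of_real \<alpha> *s \<xi> u = Q u *v cvec (k u) - (Q u ** transpose (Ep u)) *v cvec (k 0)"
    by (simp add: \<xi>_def matrix_vector_mult_diff_distrib matrix_vector_mul_assoc flip: vector_mult_scale)
  moreover have "(Q u ** transpose (Ep u)) *v cvec (k 0) = 0"
  proof -
    have "Q u ** transpose (Ep u) = transpose (Ep u ** Q u)"
      by (simp add: matrix_transpose_mul Q_sym[OF u u])
    also have "Ep u ** Q u = P ** (Ep u ** Q u)"
    proof -
      have "(mat 1 - P) ** (H0 u ** Q u) = 0" unfolding Q_char[OF u] by (simp add: P_left)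
      then show ?thesis by (simp add: matrix_mul_assoc H0_split) (simp add: matrix_diff_rdistrib)
    qed
    also have "transpose (P ** (Ep u ** Q u)) *v cvec (k 0) = transpose (Ep u ** Q u) *v (P *v cvec (k 0))"
      by (simp add: matrix_transpose_mul P_sym matrix_vector_mul_assoc)
    finally show ?thesis by (simp add: P0)
  qed
  ultimately show ?thesis by simp
qed

text \<open>Along \<open>(1, \<dots>, 1)\<close> the commutator terms vanish and \<open>\<delta>\<close> is the identity, so that only \<open>\<partial>\<xi> = Q k - \<alpha>\<xi>\<close> remains.\<close>

lemma del_k':
  assumes inv: "del_invariant S k" and u: "u \<in> S"
  shows "cvec (\<chi> i. \<Sum>j\<in>UNIV. partial j (\<lambda>x. k' x $ i) u) =
    - ((2 * of_real \<alpha>) *s (Q u *v cvec (k u) - of_real \<alpha> *s \<xi> u))"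
proof -
  let ?o = "(\<chi> i. 1) :: real^'n"
  have dk': "k' differentiable (at u)"
    using k'_smooth u unfolding smooth_on_def by (metis Ck_on.simps(2))
  then have fd: "(k' has_derivative frechet_derivative k' (at u)) (at u)" by (simp add: frechet_derivative_works)
  have "((\<lambda>x. cvec (k x) - (2 * of_real \<alpha>) *s \<xi> x) has_derivative
     (\<lambda>v. cvec (frechet_derivative k (at u) v) - (2 * of_real \<alpha>) *s \<xi>' u v)) (at u)"
    by (intro has_derivative_diff bounded_linear.has_derivative[OF bounded_linear_cvec k_deriv[OF u]]
        bounded_linear.has_derivative[OF bounded_linear_scale xi_deriv[OF u]])
  then have "((\<lambda>x. cvec (k' x)) has_derivative
     (\<lambda>v. cvec (frechet_derivative k (at u) v) - (2 * of_real \<alpha>) *s \<xi>' u v)) (at u)"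
    by (rule has_derivative_transform_within_open[OF _ open_S u]) (simp add: cvec_k')
  from fun_cong[OF has_derivative_unique[OF bounded_linear.has_derivative[OF bounded_linear_cvec fd] this], of ?o]
  have "cvec (frechet_derivative k' (at u) ?o) = cvec (frechet_derivative k (at u) ?o)
     - (2 * of_real \<alpha>) *s (Q u *v cvec (k u) - of_real \<alpha> *s \<xi> u)"
    by (simp add: \<xi>'_def theta comm_form_ones \<delta>_def diag_matrix_ones cscale_vector vector_mult_scale Q_xi[OF u]
        matrix_vector_minus)
  moreover have "frechet_derivative k (at u) ?o = 0"
    using k_deriv_del_invariant[OF u inv, of ?o] by (simp add: comm_form_ones) (simp add: cvec_def vec_eq_iff)
  moreover have "frechet_derivative k' (at u) ?o = (\<chi> i. \<Sum>j\<in>UNIV. partial j (\<lambda>x. k' x $ i) u)"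
  proof (rule vec_eq_iff[THEN iffD2, rule_format])
    fix i
    have "partial j (\<lambda>x. k' x $ i) u = frechet_derivative k' (at u) (axis j 1) $ i" for j
      by (rule partial_eq) (rule bounded_linear.has_derivative[OF bounded_linear_vec_nth fd])
    then show "frechet_derivative k' (at u) ?o $ i = (\<chi> i. \<Sum>j\<in>UNIV. partial j (\<lambda>x. k' x $ i) u) $ i"
      using arg_cong[OF linear_axis_sum[OF has_derivative_linear[OF fd], of ?o], of "\<lambda>w. w $ i"] by simp
  qed
  ultimately show ?thesis by (simp add: cvec_simps)
qed

lemma del_invariant_k':
  assumes inv: "del_invariant S k" and P0: "P *v cvec (k 0) = 0" and U: "U \<subseteq> S"
  shows "del_invariant U k'"
  unfolding del_invariant_def
proof (intro ballI allI)
  fix u i assume "u \<in> U"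
  then have "u \<in> S" using U by blast
  from del_k'[OF inv this] alpha_xi[OF inv P0 this]
  have "cvec (\<chi> i. \<Sum>j\<in>UNIV. partial j (\<lambda>x. k' x $ i) u) = 0" by simp
  then have "(\<chi> i. \<Sum>j\<in>UNIV. partial j (\<lambda>x. k' x $ i) u) = 0"
    unfolding cvec_simps(4)[symmetric] cvec_eq_iff .
  then show "(\<Sum>j\<in>UNIV. partial j (\<lambda>x. k' x $ i) u) = 0" by (simp add: vec_eq_iff)
qed

text \<open>At the origin \<open>\<xi>\<close> vanishes and \<open>Q\<close> is \<open>P\<close>, so \<open>\<partial>k'\<close> is \<open>- 2\<alpha> P (k 0)\<close> there.\<close>

lemma P_k0_of_del_invariant:
  assumes inv: "del_invariant S k" and inv': "del_invariant U k'" and U: "0 \<in> U"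
  shows "P *v cvec (k 0) = 0"
proof -
  have "cvec (\<chi> i. \<Sum>j\<in>UNIV. partial j (\<lambda>x. k' x $ i) 0) = 0"
    using inv' U by (simp add: del_invariant_def cvec_def vec_eq_iff)
  then show ?thesis
    using del_k'[OF inv zero_S] alpha by (simp add: xi_0 Q_0 vec_eq_iff)
qed

end

section \<open>Flat Egoroff metrics\<close>

text \<open>The equation \<open>h\<^sub>i \<partial>\<^sub>j h\<^sub>i = h\<^sub>j \<partial>\<^sub>i h\<^sub>j\<close> is the symmetry of the second derivatives of the potential.\<close>

lemma rotation_coeff_symmetric:
  assumes S: "open S" "u \<in> S" and h: "smooth_on S h" "\<And>i. h u $ i \<noteq> 0"
    and \<phi>: "\<And>u. u \<in> S \<Longrightarrow> (\<phi> has_derivative (\<lambda>v. \<Sum>i\<in>UNIV. (h u $ i)\<^sup>2 * v $ i)) (at u)"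
  shows "transpose (rotation_coeff h u) = rotation_coeff h u"
proof -
  have p\<phi>: "partial i \<phi> u = (h u $ i)\<^sup>2" if "u \<in> S" for u i
    using partial_eq[OF \<phi>[OF that]] by (simp add: axis_def if_distrib sum.If_cases cong: if_cong)
  have hsq: "Ck_on 1 S (\<lambda>u. (h u $ i)\<^sup>2)" for i
    using h(1) unfolding power2_eq_square smooth_on_def
    by (intro Ck_on_bilinear[OF S(1) bounded_bilinear_mult] Ck_on_linear[OF S(1) bounded_linear_vec_nth]) auto
  have "Ck_on 2 S \<phi>"
    unfolding numeral_2_eq_2
    by (rule Ck_on_SucI[OF S(1) \<phi>])
      (use hsq in \<open>simp_all add: axis_def if_distrib sum.If_cases cong: if_cong\<close>)
  then have sym: "partial i (partial j \<phi>) u = partial j (partial i \<phi>) u" for i j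
    by (rule partial_commute[OF S])
  have dh: "((\<lambda>x. h x $ i) has_derivative (\<lambda>v. frechet_derivative h (at u) v $ i)) (at u)" for i
  proof -
    have "h differentiable (at u)" using h(1) S(2) unfolding smooth_on_def by (metis Ck_on.simps(2))
    then show ?thesis by (intro bounded_linear.has_derivative[OF bounded_linear_vec_nth]) (simp add: frechet_derivative_works)
  qed
  have sq: "partial j (partial i \<phi>) u = 2 * h u $ i * partial j (\<lambda>x. h x $ i) u" for i j
  proof -
    have "partial j (partial i \<phi>) u = partial j (\<lambda>x. h x $ i * h x $ i) u"
      by (rule partial_cong[OF S]) (simp add: p\<phi> power2_eq_square)
    also have "\<dots> = h u $ i * frechet_derivative h (at u) (axis j 1) $ i + frechet_derivative h (at u) (axis j 1) $ i * h u $ i"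
      by (rule partial_eq) (rule has_derivative_mult[OF dh dh])
    finally show ?thesis by (simp add: partial_eq[OF dh])
  qed
  have "h u $ i * partial j (\<lambda>x. h x $ i) u = h u $ j * partial i (\<lambda>x. h x $ j) u" for i j
    using sym[of j i] sq[of j i] sq[of i j] by simp
  then show ?thesis
    using h(2) by (simp add: rotation_coeff_def transpose_def vec_eq_iff field_simps)
qed

lemma smooth_on_rotation_coeff:
  assumes S: "open S" and h: "smooth_on S h" "\<And>u i. u \<in> S \<Longrightarrow> h u $ i \<noteq> 0"
  shows "smooth_on S (rotation_coeff h)"
  unfolding smooth_on_def
proof (intro allI Ck_on_vec[OF S])
  fix m i j
  have "Ck_on m S (\<lambda>u. if i = j then 0 else partial j h u $ i * inverse (h u $ j))"
  proof (cases "i = j")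
    case False
    have "Ck_on m S (partial j h)" "Ck_on m S h"
      using h(1) Ck_on.simps(2)[of m S h] unfolding smooth_on_def by blast+
    then show ?thesis
      using False h(2)
      by (auto intro!: Ck_on_bilinear[OF S bounded_bilinear_mult] Ck_on_inverse[OF S] Ck_on_linear[OF S bounded_linear_vec_nth])
  qed (simp add: Ck_on_const[OF S])
  then show "Ck_on m S (\<lambda>u. rotation_coeff h u $ i $ j)"
  proof (rule Ck_on_cong[OF S, rotated])
    fix u assume u: "u \<in> S"
    have "h differentiable (at u)" using h(1) u unfolding smooth_on_def by (metis Ck_on.simps(2))
    then have "partial j (\<lambda>x. h x $ i) u = partial j h u $ i"
      using partial_eq[OF bounded_linear.has_derivative[OF bounded_linear_vec_nth]]
      by (simp add: frechet_derivative_works partial_def)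
    then show "(if i = j then 0 else partial j h u $ i * inverse (h u $ j)) = rotation_coeff h u $ i $ j"
      by (simp add: rotation_coeff_def divide_inverse)
  qed
qed

lemma nonvanishing_nbhd_exists:
  assumes S: "open S" "0 \<in> S" and k: "continuous_on S k" "\<And>i. k 0 $ i \<noteq> 0"
  shows "\<exists>U. nonvanishing_nbhd S k U"
proof -
  have "open (\<Inter>i. {u \<in> S. k u $ i \<noteq> 0})"
  proof (intro open_INT ballI)
    fix i
    have "continuous_on S (\<lambda>u. k u $ i)" by (intro continuous_on_component k)
    then have "open (S \<inter> (\<lambda>u. k u $ i) -` (- {0}))" using S(1) continuous_open_preimage by blast
    moreover have "S \<inter> (\<lambda>u. k u $ i) -` (- {0}) = {u \<in> S. k u $ i \<noteq> 0}" by auto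
    ultimately show "open {u \<in> S. k u $ i \<noteq> 0}" by simp
  qed simp
  moreover have "0 \<in> (\<Inter>i. {u \<in> S. k u $ i \<noteq> 0})" using S k by auto
  ultimately obtain r where r: "r > 0" "ball 0 r \<subseteq> (\<Inter>i. {u \<in> S. k u $ i \<noteq> 0})" using openE by blast
  then have "nonvanishing_nbhd S k (ball 0 r)" by (auto simp: nonvanishing_nbhd_def)
  then show ?thesis by blast
qed

lemma frame_dressing_of_extended_frame:
  assumes "open \<Omega>" "connected \<Omega>" "0 \<in> \<Omega>" and fe: "flat_egoroff \<Omega> h \<phi>" and ef: "extended_frame \<Omega> h E X"
    and "\<alpha> \<noteq> 0" and P: "hermitian_projection P" "conj_mat P = P"
  shows "frame_dressing \<Omega> (rotation_coeff h) h E X \<alpha> P"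
proof -
  have h: "smooth_on \<Omega> h" "\<And>u i. u \<in> \<Omega> \<Longrightarrow> h u $ i \<noteq> 0"
    "\<And>u. u \<in> \<Omega> \<Longrightarrow> (\<phi> has_derivative (\<lambda>v. \<Sum>i\<in>UNIV. (h u $ i)\<^sup>2 * v $ i)) (at u)"
    using fe by (auto simp: flat_egoroff_def)
  have F0: "block (E 0 z) (X 0 z) 1 = mat 1" for z using ef by (simp add: extended_frame_def Let_def)
  have hol: "(\<lambda>z. block (E u z) (X u z) 1 $ p $ q) holomorphic_on UNIV" if "u \<in> \<Omega>" for u p q
    using ef that by (simp add: extended_frame_def Let_def)
  have d: "((\<lambda>x. E x z) has_derivative (\<lambda>v. E u z ** lax_form (rotation_coeff h u) z v)) (at u)"
    "((\<lambda>x. X x z) has_derivative (\<lambda>v. E u z *v (diag_matrix (cvec v) *v cvec (h u)))) (at u)"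
    if u: "u \<in> \<Omega>" for u z
  proof -
    have "((\<lambda>x. block (E x z) (X x z) 1) has_derivative (\<lambda>v. block (E u z) (X u z) 1 ** frame_form h u z v)) (at u)"
      using ef u by (simp add: extended_frame_def Let_def)
    then show "((\<lambda>x. E x z) has_derivative (\<lambda>v. E u z ** lax_form (rotation_coeff h u) z v)) (at u)"
      "((\<lambda>x. X x z) has_derivative (\<lambda>v. E u z *v (diag_matrix (cvec v) *v cvec (h u)))) (at u)"
      by (simp_all add: frame_form_lax block_mult has_derivative_block_iff)
  qed
  show ?thesis
  proof (intro frame_dressing.intro smooth_frame.intro flat_frame.intro smooth_frame_axioms.intro
      frame_dressing_axioms.intro assms h d)
    show "transpose (rotation_coeff h u) = rotation_coeff h u" if "u \<in> \<Omega>" for u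
      by (rule rotation_coeff_symmetric[OF assms(1) that h(1) h(2)[OF that] h(3)])
    show "E 0 z = mat 1" "X 0 z = 0" for z using F0[of z] by (simp_all add: block_simps)
    show "smooth_on \<Omega> (rotation_coeff h)" by (rule smooth_on_rotation_coeff[OF assms(1) h(1,2)])
    show "rotation_coeff h u $ i $ i = 0" for u i by (simp add: rotation_coeff_def)
    show "(\<lambda>z. E u z $ i $ j) holomorphic_on UNIV" if "u \<in> \<Omega>" for u i j
      using hol[OF that, of "Some i" "Some j"] by simp
    show "(\<lambda>z. X u z $ i) holomorphic_on UNIV" if "u \<in> \<Omega>" for u i
      using hol[OF that, of "Some i" None] by simp
    show "P ** P = P" "transpose P = P" using P by (simp_all add: hermitian_projection_def)
  qed
qed

theorem theorem5p4:
  fixes \<Omega> :: "(real^'n::finite) set"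
    and h :: "real^'n \<Rightarrow> real^'n" and \<phi> :: "real^'n \<Rightarrow> real"
    and E :: "real^'n \<Rightarrow> complex \<Rightarrow> complex^'n^'n" and X :: "real^'n \<Rightarrow> complex \<Rightarrow> complex^'n"
    and \<alpha> :: real and P :: "complex^'n^'n"
  assumes "open \<Omega>" and "connected \<Omega>" and "simply_connected \<Omega>" and "0 \<in> \<Omega>"
    and "flat_egoroff \<Omega> h \<phi>" and "del_invariant \<Omega> h"
    and "extended_frame \<Omega> h E X"
    and "\<alpha> \<noteq> 0"
    and "hermitian_projection P" and "conj_mat P = P"
  shows "\<exists>h' \<phi>' \<beta>'.
     (\<forall>u\<in>\<Omega>. let Q = dressed_proj E \<alpha> P u; \<eta> = dressing_eta E X \<alpha> u in
        cvec (h' u) = cvec (h u) - (2 * of_real \<alpha>) *s (Q *v \<eta>) \<and>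
        of_real (\<phi>' u) = of_real (\<phi> u) - 2 * of_real \<alpha> * bdot \<eta> (Q *v \<eta>) \<and>
        cmat (\<beta>' u) = cmat (rotation_coeff h u) - cscale (2 * of_real \<alpha>) (off_diag Q)) \<and>
     (\<exists>U. nonvanishing_nbhd \<Omega> h' U) \<and>
     (\<forall>U. nonvanishing_nbhd \<Omega> h' U \<longrightarrow>
        flat_egoroff U h' \<phi>' \<and>
        (\<forall>u\<in>U. rotation_coeff h' u = \<beta>' u) \<and>
        associated_family U h' (\<lambda>u t. dressed_X E X \<alpha> P u (of_real t)) \<and>
        (\<forall>t::real. t \<noteq> 0 \<longrightarrow> (let Y = (\<lambda>u. dressed_X E X \<alpha> P u (of_real t)) in
           flat_lagrangian_immersion U Y \<and>
           (\<forall>u\<in>U. first_ff Y u = diag_metric h' u \<and>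
              (\<forall>i j. second_ff Y u i j = (if i = j then t *\<^sub>R (\<i> *s partial i Y u) else 0))))) \<and>
        ((\<forall>t::real. t \<noteq> 0 \<longrightarrow> in_hypersphere U (\<lambda>u. dressed_X E X \<alpha> P u (of_real t)))
           \<longleftrightarrow> P *v cvec (h 0) = 0) \<and>
        (P *v cvec (h 0) = 0 \<longrightarrow>
           (\<forall>t::real. t \<noteq> 0 \<longrightarrow>
              (\<exists>c r. r > 0 \<and> (\<lambda>u. X u (of_real t)) ` \<Omega> \<subseteq> sphere c r \<and>
                 (\<lambda>u. dressed_X E X \<alpha> P u (of_real t)) ` U \<subseteq> sphere c r)))) \<and>
     (P *v cvec (h 0) = 0 \<longrightarrow>
        (\<forall>u\<in>\<Omega>. let Q = dressed_proj E \<alpha> P u; \<eta> = dressing_eta E X \<alpha> u in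
           of_real \<alpha> *s (Q *v \<eta>) = Q *v cvec (h u) \<and>
           (\<forall>z. z \<noteq> \<i> * of_real \<alpha> \<and> z \<noteq> - \<i> * of_real \<alpha> \<longrightarrow>
              dressed_X E X \<alpha> P u z =
                simple_factor (- \<i> * of_real \<alpha>) (mat 1 - P) z *v
                  (X u z + (2 * \<i> / (z - \<i> * of_real \<alpha>)) *s (E u z *v (Q *v cvec (h u))))) \<and>
           cvec (h' u) = cvec (h u) - 2 *s (Q *v cvec (h u)) \<and>
           of_real (\<phi>' u) = of_real (\<phi> u) - 2 / of_real \<alpha> * bdot (cvec (h u)) (Q *v cvec (h u)) \<and>
           cmat (\<beta>' u) = cmat (rotation_coeff h u) - cscale (2 * of_real \<alpha>) (off_diag Q)))"
proof -
  interpret d: frame_dressing \<Omega> "rotation_coeff h" h E X \<alpha> P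
    by (rule frame_dressing_of_extended_frame) (use assms in auto)
  let ?Y = "\<lambda>(t::real) u. dressed_X E X \<alpha> P u (of_real t)"
  let ?S = "\<lambda>t::real. sphere ((\<i> / of_real t) *s cvec (h 0)) (norm (cvec (h 0)) / \<bar>t\<bar>)"
  let ?Q = "\<lambda>u. dressed_proj E \<alpha> P u" and ?\<eta> = "\<lambda>u. dressing_eta E X \<alpha> u"
  define h' where "h' = d.k'"
  define \<phi>' where "\<phi>' u = \<phi> u - 2 * \<alpha> * Re (bdot (?\<eta> u) (d.\<xi> u))" for u
  define \<beta>' where "\<beta>' = d.R'"
  have \<phi>: "(\<phi> has_derivative (\<lambda>v. \<Sum>i\<in>UNIV. (h u $ i)\<^sup>2 * v $ i)) (at u)" if "u \<in> \<Omega>" for u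
    using assms(5) that by (simp add: flat_egoroff_def)
  have ne: "complex_of_real t \<noteq> \<i> * of_real \<alpha>" "complex_of_real t \<noteq> - \<i> * of_real \<alpha>" for t
    using assms(8) by (auto simp: complex_eq_iff)
  have form: "cvec (h' u) = cvec (h u) - (2 * of_real \<alpha>) *s (?Q u *v ?\<eta> u)"
    "of_real (\<phi>' u) = of_real (\<phi> u) - 2 * of_real \<alpha> * bdot (?\<eta> u) (?Q u *v ?\<eta> u)"
    "cmat (\<beta>' u) = cmat (rotation_coeff h u) - cscale (2 * of_real \<alpha>) (off_diag (?Q u))" if u: "u \<in> \<Omega>" for u
    using d.cvec_k'[OF u] d.cmat_R'[OF u] d.potential_real[OF u]
    by (simp_all add: h'_def \<phi>'_def \<beta>'_def d.\<xi>_def)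
  have nbhd: "\<exists>U. nonvanishing_nbhd \<Omega> h' U"
  proof (rule nonvanishing_nbhd_exists[OF assms(1,4)])
    show "continuous_on \<Omega> h'" using d.k'_smooth Ck_on.simps(1) unfolding h'_def smooth_on_def by blast
    show "h' 0 $ i \<noteq> 0" for i unfolding h'_def d.k'_0 by (rule d.k_nonzero[OF assms(4)])
  qed
  show ?thesis
    unfolding Let_def
  proof (rule exI[of _ h'], rule exI[of _ \<phi>'], rule exI[of _ \<beta>'], rule conjI[OF _ conjI[OF nbhd conjI]],
      goal_cases)
    case 1
    show ?case using form by blast
  next
    case 2
    show ?case
    proof (intro allI impI, goal_cases)
      case (1 U)
      note U = 1
      have U': "U \<subseteq> \<Omega>" "0 \<in> U" using U by (auto simp: nonvanishing_nbhd_def)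
      have Uk: "nonvanishing_nbhd \<Omega> d.k' U" using U by (simp add: h'_def)
      interpret f: smooth_frame U \<beta>' h' d.E' d.X'
        unfolding \<beta>'_def h'_def by (rule d.smooth_frame'[OF Uk])
      have Y: "?Y t = (\<lambda>u. d.X' u (of_real t))" for t :: real
        by (simp add: d.X'_eq[OF ne])
      have egoroff: "flat_egoroff U h' \<phi>'"
        unfolding flat_egoroff_def
      proof (intro conjI ballI allI)
        show "smooth_on U h'" "flat_metric_on U (diag_metric h')" by (rule f.k_smooth, rule f.flat_metric)
        show "h' u $ i \<noteq> 0" if "u \<in> U" for u i by (rule f.k_nonzero[OF that])
        show "(\<phi>' has_derivative (\<lambda>v. \<Sum>i\<in>UNIV. (h' u $ i)\<^sup>2 * v $ i)) (at u)" if "u \<in> U" for u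
          unfolding \<phi>'_def h'_def using U' that by (intro d.potential_deriv \<phi>) auto
      qed
      have rot: "\<forall>u\<in>U. rotation_coeff h' u = \<beta>' u"
        using d.rotation_coeff_k'[OF Uk] by (simp add: h'_def \<beta>'_def)
      have assoc: "associated_family U h' (\<lambda>u t. dressed_X E X \<alpha> P u (of_real t))"
        unfolding associated_family_def
        by (rule exI[of _ d.E'], rule exI[of _ d.X'])
          (use d.extended_frame'[OF Uk] d.X'_eq[OF ne] in \<open>simp add: h'_def\<close>)
      have imm: "\<forall>t::real. t \<noteq> 0 \<longrightarrow> flat_lagrangian_immersion U (?Y t) \<and>
          (\<forall>u\<in>U. first_ff (?Y t) u = diag_metric h' u \<and>
            (\<forall>i j. second_ff (?Y t) u i j =
              (if i = j then t *\<^sub>R (\<i> *s partial i (?Y t) u) else 0)))"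
        unfolding Y using f.flat_lagrangian_X f.first_ff_X f.second_ff_X by blast
      have sph: "(\<lambda>u. X u (of_real t)) ` \<Omega> \<subseteq> ?S t"
        "?Y t ` U \<subseteq> ?S t"
        "norm (cvec (h 0)) / \<bar>t\<bar> > 0"
        if P0: "P *v cvec (h 0) = 0" and t: "t \<noteq> 0" for t :: real
      proof -
        have inv': "del_invariant U h'" unfolding h'_def by (rule d.del_invariant_k'[OF assms(6) P0 U'(1)])
        have "h' 0 = h 0" unfolding h'_def by (rule d.k'_0)
        then show "?Y t ` U \<subseteq> ?S t"
          unfolding Y using f.sphere_del_invariant[OF inv' _ t] by (simp only: image_subset_iff) blast
        show "(\<lambda>u. X u (of_real t)) ` \<Omega> \<subseteq> ?S t"
          using d.sphere_del_invariant[OF assms(6) _ t] by (simp only: image_subset_iff) blast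
        show "norm (cvec (h 0)) / \<bar>t\<bar> > 0" using d.norm_k_0 t by simp
      qed
      have iff: "(\<forall>t::real. t \<noteq> 0 \<longrightarrow> in_hypersphere U (?Y t))
             \<longleftrightarrow> P *v cvec (h 0) = 0"
      proof
        assume "\<forall>t::real. t \<noteq> 0 \<longrightarrow> in_hypersphere U (?Y t)"
        (* a single member of the family suffices *)
        then have "in_hypersphere U (\<lambda>u. d.X' u (of_real 1))" unfolding Y using zero_neq_one by metis
        then have "del_invariant U h'" by (rule f.del_invariant_of_sphere[rotated]) simp
        then show "P *v cvec (h 0) = 0"
          unfolding h'_def by (rule d.P_k0_of_del_invariant[OF assms(6) _ U'(2)])
      next
        assume "P *v cvec (h 0) = 0"
        then show "\<forall>t::real. t \<noteq> 0 \<longrightarrow> in_hypersphere U (?Y t)"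
          unfolding in_hypersphere_def using sph by blast
      qed
      have same: "P *v cvec (h 0) = 0 \<longrightarrow>
             (\<forall>t::real. t \<noteq> 0 \<longrightarrow>
                (\<exists>c r. r > 0 \<and> (\<lambda>u. X u (of_real t)) ` \<Omega> \<subseteq> sphere c r \<and>
                   ?Y t ` U \<subseteq> sphere c r))"
        by (intro impI allI exI conjI) (erule (1) sph(3), erule (1) sph(1), erule (1) sph(2))
      show ?case
        by (rule conjI[OF egoroff conjI[OF rot conjI[OF assoc conjI[OF imm conjI[OF iff same]]]]])
    qed
  next
    case 3
    show ?case
    proof (intro impI ballI, goal_cases)
      case (1 u)
      note P0 = 1(1) and u = 1(2)
      have a: "of_real \<alpha> *s (?Q u *v ?\<eta> u) = ?Q u *v cvec (h u)"
        using d.alpha_xi[OF assms(6) P0 u] by (simp add: d.\<xi>_def)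
      have a': "?Q u *v cvec (h u) = of_real \<alpha> *s (?Q u *v ?\<eta> u)" using a by simp
      have smult: "(c * of_real \<alpha>) *s x = c *s (of_real \<alpha> *s x)" for c and x :: "complex^'n" by simp
      have X: "dressed_X E X \<alpha> P u z = simple_factor (- \<i> * of_real \<alpha>) (mat 1 - P) z *v
                    (X u z + (2 * \<i> / (z - \<i> * of_real \<alpha>)) *s (E u z *v (?Q u *v cvec (h u))))" for z
        unfolding dressed_X_def a' by (simp add: vector_mult_scale)
      (* as Q is symmetric and idempotent, both quadratic forms only see images under Q *)
      have e: "bdot x (?Q u *v x) = bdot (?Q u *v x) (?Q u *v x)" for x
        using d.Q_idem[OF u u] d.Q_sym[OF u u] by (simp add: bdot_transpose matrix_vector_mul_assoc)
      have "bdot (?Q u *v cvec (h u)) (?Q u *v cvec (h u)) = of_real \<alpha> * of_real \<alpha> * bdot (?Q u *v ?\<eta> u) (?Q u *v ?\<eta> u)"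
        unfolding a' by (simp add: bdot_linear)
      then have "of_real \<alpha> * of_real \<alpha> * bdot (?\<eta> u) (?Q u *v ?\<eta> u) = bdot (cvec (h u)) (?Q u *v cvec (h u))"
        unfolding e[of "?\<eta> u"] e[of "cvec (h u)"] by (rule sym)
      then have "2 * of_real \<alpha> * bdot (?\<eta> u) (?Q u *v ?\<eta> u) = 2 / of_real \<alpha> * bdot (cvec (h u)) (?Q u *v cvec (h u))"
        using assms(8) by (simp add: field_simps)
      then show ?case
        using a X form[OF u] by (simp add: smult)
    qed
  qed
qed

end
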